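(* For any fixed connected graph $H$ with at least three edges the following holds (asymptotics as $n\to\infty$). (i) If $H$ is a tree, then $f^+_H(n)=\Omega\big(n^{\frac{v(H)-1}{v(H)-2}}\big)$. (ii) If $H$ is unicyclic, then $f^+_H(n)=\Omega\big(n^{\frac{v(H)+2}{v(H)+1}}\big)$. (iii) If $H$ is unicyclic, then $f^+_H(n)\ge c_H\, n^{\frac{v(H)}{v(H)-1}}$ for infinitely many values of $n$, where $c_H>0$ depends only on $H$.
   Context: All graphs are finite and simple; implied constants may depend on $H$. A graph is unicyclic if it is connected and contains exactly one cycle. $v(H)$ is the number of vertices of $H$. In the $(1:b)$ (strict) Avoider--Enforcer $H$-game on $K_n$ ($n,b$ positive integers), Avoider and Enforcer alternately claim previously unclaimed edges of $K_n$, Avoider moving first. Avoider claims exactly one edge per turn and Enforcer claims exactly $b$ edges per turn; if strictly fewer than $b$ edges are unclaimed before a move of Enforcer, he claims all of them. The game ends when all edges are claimed. Avoider loses (Enforcer wins) if the graph of Avoider's edges then contains a copy of $H$; otherwise Avoider wins. The upper threshold $f^+_H(n)$ is the largest integer $b$ such that Enforcer has a winning strategy in the $(1:b)$ $H$-game on $K_n$. *)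

theory Defs
  imports "HOL-Library.Landau_Symbols"
begin

section \<open>Finite simple graphs\<close>

text \<open>A graph is given by its vertex set \<open>V\<close> and its set \<open>E\<close> of edges, an edge being a
  two-element set of vertices.\<close>

definition simple_graph :: "'a set \<Rightarrow> 'a set set \<Rightarrow> bool" where
  "simple_graph V E \<longleftrightarrow> finite V \<and> (\<forall>e\<in>E. e \<subseteq> V \<and> card e = 2)"

definition connected_graph :: "'a set \<Rightarrow> 'a set set \<Rightarrow> bool" where
  "connected_graph V E \<longleftrightarrow>
     V \<noteq> {} \<and> (\<forall>u\<in>V. \<forall>v\<in>V. (u, v) \<in> {(x, y). {x, y} \<in> E}\<^sup>*)"

text \<open>A cycle is a subgraph, so it is identified with its edge set: the vertex sequences
  that arise from one another by rotation or reversal describe the same cycle.\<close>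

definition cycle_in :: "'a set set \<Rightarrow> 'a set set \<Rightarrow> bool" where
  "cycle_in E C \<longleftrightarrow> C \<subseteq> E \<and>
     (\<exists>vs. 3 \<le> length vs \<and> distinct vs \<and>
       C = {{vs ! i, vs ! (Suc i mod length vs)} | i. i < length vs})"

definition tree_graph :: "'a set \<Rightarrow> 'a set set \<Rightarrow> bool" where
  "tree_graph V E \<longleftrightarrow> connected_graph V E \<and> \<not> (\<exists>C. cycle_in E C)"

definition unicyclic_graph :: "'a set \<Rightarrow> 'a set set \<Rightarrow> bool" where
  "unicyclic_graph V E \<longleftrightarrow> connected_graph V E \<and> (\<exists>!C. cycle_in E C)"

definition contains_copy :: "'b set \<Rightarrow> 'b set set \<Rightarrow> 'a set \<Rightarrow> 'a set set \<Rightarrow> bool" where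
  "contains_copy V' E' V E \<longleftrightarrow>
     (\<exists>\<phi>. inj_on \<phi> V \<and> \<phi> ` V \<subseteq> V' \<and> (\<forall>e\<in>E. \<phi> ` e \<in> E'))"

section \<open>The strict Avoider--Enforcer game\<close>

definition complete_edges :: "nat \<Rightarrow> nat set set" where
  "complete_edges n = {e. e \<subseteq> {..<n} \<and> card e = 2}"

text \<open>A history is the chronological list of the completed rounds; a round consists of the edge
  claimed by Avoider and the set of edges with which Enforcer answers.\<close>

type_synonym history = "(nat set \<times> nat set set) list"

definition avoider_edges :: "history \<Rightarrow> nat set set" where
  "avoider_edges h = fst ` set h"

definition enforcer_edges :: "history \<Rightarrow> nat set set" where
  "enforcer_edges h = \<Union> (snd ` set h)"

definition free_edges :: "nat \<Rightarrow> history \<Rightarrow> nat set set" where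
  "free_edges n h = complete_edges n - (avoider_edges h \<union> enforcer_edges h)"

definition legal_enforcer_move ::
    "nat \<Rightarrow> nat \<Rightarrow> history \<Rightarrow> nat set \<Rightarrow> nat set set \<Rightarrow> bool" where
  "legal_enforcer_move n b h e M \<longleftrightarrow>
     (let F = free_edges n h - {e} in
       if card F < b then M = F else M \<subseteq> F \<and> card M = b)"

text \<open>A strategy \<open>\<sigma>\<close> of Enforcer maps the history and Avoider's current edge to Enforcer's
  answer.\<close>

inductive played_history ::
    "nat \<Rightarrow> (history \<Rightarrow> nat set \<Rightarrow> nat set set) \<Rightarrow> history \<Rightarrow> bool"
  for n \<sigma> where
  start: "played_history n \<sigma> []"
| round: "played_history n \<sigma> h \<Longrightarrow> e \<in> free_edges n h \<Longrightarrow>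
    played_history n \<sigma> (h @ [(e, \<sigma> h e)])"

text \<open>Every round claims at least one edge, so every play reaches a history without free edges;
  these histories are the finished games.\<close>

definition winning_strategy ::
    "'a set \<Rightarrow> 'a set set \<Rightarrow> nat \<Rightarrow> nat \<Rightarrow> (history \<Rightarrow> nat set \<Rightarrow> nat set set) \<Rightarrow> bool" where
  "winning_strategy V E n b \<sigma> \<longleftrightarrow>
     (\<forall>h e. played_history n \<sigma> h \<longrightarrow> e \<in> free_edges n h \<longrightarrow>
        legal_enforcer_move n b h e (\<sigma> h e)) \<and>
     (\<forall>h. played_history n \<sigma> h \<longrightarrow> free_edges n h = {} \<longrightarrow>
        contains_copy {..<n} (avoider_edges h) V E)"

definition enforcer_wins :: "'a set \<Rightarrow> 'a set set \<Rightarrow> nat \<Rightarrow> nat \<Rightarrow> bool" where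
  "enforcer_wins V E n b \<longleftrightarrow> (\<exists>\<sigma>. winning_strategy V E n b \<sigma>)"

text \<open>On \<open>nat\<close>, \<open>Sup\<close> is the maximum of a nonempty finite set, and \<open>Sup {} = 0\<close>: the threshold
  is 0 if Enforcer wins for no positive bias. Lemma \<open>upper_threshold_greatest\<close> below shows that
  otherwise the maximum is attained.\<close>

definition upper_threshold :: "'a set \<Rightarrow> 'a set set \<Rightarrow> nat \<Rightarrow> nat" where
  "upper_threshold V E n = Sup {b. 0 < b \<and> enforcer_wins V E n b}"

lemma finite_complete_edges: "finite (complete_edges n)"
  by (rule finite_subset[of _ "Pow {..<n}"]) (auto simp: complete_edges_def)

lemma enforcer_wins_bias_bound:
  assumes G: "simple_graph V E" and E: "2 \<le> card E" and w: "enforcer_wins V E n b"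
  shows "b < card (complete_edges n)"
proof (rule ccontr)
  assume nb: "\<not> b < card (complete_edges n)"
  obtain \<sigma> where \<sigma>: "winning_strategy V E n b \<sigma>"
    using w by (auto simp: enforcer_wins_def)
  have no_copy: "\<not> contains_copy {..<n} A V E" if A: "finite A" "card A \<le> 1" for A
  proof
    assume "contains_copy {..<n} A V E"
    then obtain \<phi> where \<phi>: "inj_on \<phi> V" "\<forall>e\<in>E. \<phi> ` e \<in> A"
      by (auto simp: contains_copy_def)
    have "inj_on ((`) \<phi>) E"
      using inj_on_image_Pow[OF \<phi>(1)] G by (rule_tac inj_on_subset) (auto simp: simple_graph_def)
    then have "card E \<le> card A"
      using \<phi>(2) A(1) by (intro card_inj_on_le[of "(`) \<phi>"]) auto
    then show False using E A by simp
  qed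
  show False
  proof (cases "complete_edges n = {}")
    case True
    then show False
      using \<sigma> no_copy[of "{}"] played_history.start[of n \<sigma>]
      by (auto simp: winning_strategy_def free_edges_def avoider_edges_def)
  next
    case False
    then obtain e where e: "e \<in> complete_edges n" by blast
    let ?h = "[(e, \<sigma> [] e)]"
    have f: "e \<in> free_edges n []"
      using e by (simp add: free_edges_def avoider_edges_def enforcer_edges_def)
    have h: "played_history n \<sigma> ?h"
      using played_history.round[OF played_history.start f] by simp
    have "legal_enforcer_move n b [] e (\<sigma> [] e)"
      using \<sigma> f played_history.start by (auto simp: winning_strategy_def)
    moreover have "card (complete_edges n - {e}) < b"
      using nb e finite_complete_edges[of n] by (meson card_Diff1_less leI order_less_le_trans)
    ultimately have "\<sigma> [] e = complete_edges n - {e}"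
      by (simp add: legal_enforcer_move_def free_edges_def avoider_edges_def enforcer_edges_def)
    then have "free_edges n ?h = {}"
      by (auto simp: free_edges_def avoider_edges_def enforcer_edges_def)
    then have "contains_copy {..<n} (avoider_edges ?h) V E"
      using \<sigma> h unfolding winning_strategy_def by blast
    then show False using no_copy[of "{e}"] by (simp add: avoider_edges_def)
  qed
qed

lemma upper_threshold_greatest:
  assumes "simple_graph V E" and "2 \<le> card E" and "0 < b" and "enforcer_wins V E n b"
  shows "0 < upper_threshold V E n" and "enforcer_wins V E n (upper_threshold V E n)"
    and "b \<le> upper_threshold V E n"
proof -
  let ?B = "{b. 0 < b \<and> enforcer_wins V E n b}"
  have fin: "finite ?B"
    by (rule finite_subset[of _ "{..<card (complete_edges n)}"])
      (use enforcer_wins_bias_bound[OF assms(1,2)] in auto)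
  have b: "b \<in> ?B" using assms by simp
  then have "?B \<noteq> {}" by blast
  then have "upper_threshold V E n = Max ?B"
    unfolding upper_threshold_def Sup_nat_def by (simp only: if_False)
  then show "0 < upper_threshold V E n" "enforcer_wins V E n (upper_threshold V E n)"
      "b \<le> upper_threshold V E n"
    using Max_in[OF fin] Max_ge[OF fin b] b by auto
qed

end

theory Submission
  imports Defs "HOL-Library.Disjoint_Sets"
begin

text \<open>Label the vertices of \<open>K\<^sub>n\<close> by the vertices of \<open>H\<close> and consider only edges whose labels form
  an edge of \<open>H\<close>. Enforcer burns useless edges first, so that sooner or later Avoider is forced to
  play useful ones, and every such edge merges two partial copies of \<open>H\<close> into a larger one.
  After each phase Enforcer keeps the partial copies of the most frequent new type only. A block of
  \<open>s\<close> vertices of \<open>H\<close> then still has about \<open>b (n / b)\<^sup>s\<close> disjoint copies, as in a random graph of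
  density \<open>1 / b\<close>. When a single edge of \<open>H\<close> is missing, every remaining useful edge is a threat.
  Enforcer preserves as many threats as there are edges left in the last round, that is, the
  remainder of \<open>n choose 2\<close> modulo \<open>b + 1\<close>, and Avoider has to take one of them. So it remains to find
  biases of the right order for which this remainder is small.\<close>

section \<open>Positional form of the game\<close>

text \<open>The estimate b (n/b)^s equals n^s / b^(s-1): s vertices joined by s - 1 edges, each
  present with probability 1/b. With R = b/n it reads b / R^s, and linked blocks with x and y pieces
  should yield about x y / b pieces of their union. The obstacle is that Avoider decides which
  useful edges he plays, hence which blocks grow. Enforcer therefore burns edges between the linked
  blocks with the largest product x y; the gain of a phase is then comparable with x y / b for all
  linked pairs at once. If H is unicyclic, Avoider may also close the cycle inside a block too
  early, which makes the pieces of that block rarer than usual. With remainder r and v vertices of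
  H, the last missing edge needs about r R^v <= b if it lies inside a block, and r R^v <= b^2 if it
  joins two blocks. The remainder is of order at most R^2 for general n and is 1 for special n,
  whence the exponents (v+2)/(v+1) and v/(v-1). For trees the phases themselves need R^(v-1) <= b,
  which gives (v-1)/(v-2).\<close>

definition reply :: "nat \<Rightarrow> 'e set \<Rightarrow> 'e set \<Rightarrow> bool" where
  "reply b F B \<longleftrightarrow> (if card F < b then B = F else B \<subseteq> F \<and> card B = b)"

text \<open>Avoider is to move in every position, so Enforcer's answer is folded into the round.
  Stopping early at \<open>now\<close> is sound because the goals used below are monotone in
  Avoider's edges; a full board that misses the goal has no derivation.\<close>

inductive wins :: "nat \<Rightarrow> ('e set \<Rightarrow> bool) \<Rightarrow> 'e set \<Rightarrow> 'e set \<Rightarrow> bool" for b P where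
  now: "P A \<Longrightarrow> wins b P A F"
| round: "F \<noteq> {} \<Longrightarrow> (\<And>e. e \<in> F \<Longrightarrow>
      \<exists>B. reply b (F - {e}) B \<and> wins b P (insert e A) (F - {e} - B)) \<Longrightarrow> wins b P A F"

text \<open>Only full answers of exactly \<open>b\<close> edges are allowed, so each round removes
  \<open>b + 1\<close> edges and the residue of \<open>card F\<close> modulo \<open>b + 1\<close>
  survives until \<open>Q\<close> is reached. Unlike the goal of \<open>wins\<close>,
  \<open>Q\<close> describes an intermediate position and need not persist.\<close>

inductive forces :: "nat \<Rightarrow> ('e set \<Rightarrow> 'e set \<Rightarrow> bool) \<Rightarrow> 'e set \<Rightarrow> 'e set \<Rightarrow> bool" for b Q where
  now: "Q A F \<Longrightarrow> forces b Q A F"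
| round: "F \<noteq> {} \<Longrightarrow> (\<And>e. e \<in> F \<Longrightarrow>
      \<exists>B. B \<subseteq> F - {e} \<and> card B = b \<and> forces b Q (insert e A) (F - {e} - B)) \<Longrightarrow>
    forces b Q A F"

lemma reply_exists: "finite F \<Longrightarrow> \<exists>B. reply b F B"
  by (metis reply_def linorder_not_less obtain_subset_with_card_n)

text \<open>A goal once reached persists by monotonicity, so in the case \<open>now\<close> any
  legal answer will do.\<close>

lemma wins_step:
  assumes "wins b P A F" and "mono P" and "finite F" and "e \<in> F"
  shows "\<exists>B. reply b (F - {e}) B \<and> wins b P (insert e A) (F - {e} - B)"
  using assms(1)
proof cases
  case now
  then have "P (insert e A)"
    using assms(2) by (metis (full_types) le_boolE monoD subset_insertI)
  then show ?thesis
    using reply_exists[of "F - {e}" b] assms(3) wins.now by blast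
next
  case round
  then show ?thesis using assms(4) by blast
qed

text \<open>Choosing some answer that leads to a winning position again makes winning an invariant
  of all plays. On a full board such a position can only come from \<open>now\<close>.\<close>

lemma enforcer_winsI:
  assumes w: "wins b (\<lambda>A. contains_copy {..<n} A V E) {} (complete_edges n)"
  shows "enforcer_wins V E n b"
proof -
  define P where "P = (\<lambda>A. contains_copy {..<n} A V E)"
  have mono: "mono P"
    unfolding P_def contains_copy_def by (intro monoI le_boolI) (meson subsetD)
  define ok where "ok h e B \<longleftrightarrow> reply b (free_edges n h - {e}) B \<and>
      wins b P (insert e (avoider_edges h)) (free_edges n h - {e} - B)" for h e B
  define \<sigma> where "\<sigma> h e = (SOME B. ok h e B)" for h e
  have fin: "finite (free_edges n h)" for h
    using finite_complete_edges by (simp add: free_edges_def)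
  have \<sigma>: "ok h e (\<sigma> h e)"
    if "wins b P (avoider_edges h) (free_edges n h)" "e \<in> free_edges n h" for h e
    unfolding \<sigma>_def
    by (rule someI_ex) (use wins_step[OF that(1) mono fin that(2)] in \<open>simp add: ok_def\<close>)
  have inv: "wins b P (avoider_edges h) (free_edges n h)" if "played_history n \<sigma> h" for h
    using that
  proof induction
    case start
    then show ?case
      using w by (simp add: P_def avoider_edges_def enforcer_edges_def free_edges_def)
  next
    case (round h e)
    have "free_edges n (h @ [(e, \<sigma> h e)]) = free_edges n h - {e} - \<sigma> h e"
      by (auto simp: free_edges_def avoider_edges_def enforcer_edges_def)
    moreover have "avoider_edges (h @ [(e, \<sigma> h e)]) = insert e (avoider_edges h)"
      by (auto simp: avoider_edges_def)
    ultimately show ?case using \<sigma>[OF round.IH round.hyps(2)] by (simp add: ok_def)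
  qed
  have "winning_strategy V E n b \<sigma>"
    unfolding winning_strategy_def
  proof (intro conjI allI impI)
    fix h e assume "played_history n \<sigma> h" "e \<in> free_edges n h"
    then show "legal_enforcer_move n b h e (\<sigma> h e)"
      using \<sigma>[OF inv] by (simp add: ok_def legal_enforcer_move_def reply_def Let_def)
  next
    fix h assume h: "played_history n \<sigma> h" "free_edges n h = {}"
    show "contains_copy {..<n} (avoider_edges h) V E"
      using inv[OF h(1)] h(2) by cases (auto simp: P_def)
  qed
  then show ?thesis by (auto simp: enforcer_wins_def)
qed

lemma forces_wins:
  assumes "forces b Q A F" and "finite F"
    and "\<And>A' F'. Q A' F' \<Longrightarrow> card F' mod Suc b = card F mod Suc b \<Longrightarrow> wins b P A' F'"
  shows "wins b P A F"
proof -
  have "finite F \<longrightarrow>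
      (\<forall>A' F'. Q A' F' \<longrightarrow> card F' mod Suc b = card F mod Suc b \<longrightarrow> wins b P A' F') \<longrightarrow>
      wins b P A F"
    using assms(1)
  proof induction
    case (now A F)
    then show ?case by simp
  next
    case (round F A)
    show ?case
    proof (intro impI, rule wins.round[OF round.hyps(1)])
      fix e assume e: "e \<in> F" and fin: "finite F"
        and Q: "\<forall>A' F'. Q A' F' \<longrightarrow> card F' mod Suc b = card F mod Suc b \<longrightarrow> wins b P A' F'"
      obtain B where B: "B \<subseteq> F - {e}" "card B = b" and IH: "finite (F - {e} - B) \<longrightarrow>
          (\<forall>A' F'. Q A' F' \<longrightarrow> card F' mod Suc b = card (F - {e} - B) mod Suc b \<longrightarrow> wins b P A' F') \<longrightarrow>
          wins b P (insert e A) (F - {e} - B)"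
        using round.IH[OF e] by (elim exE conjE) (rule that)
      have le: "b \<le> card (F - {e})"
        using B card_mono[of "F - {e}" B] fin by simp
      then have r: "reply b (F - {e}) B" using B by (simp add: reply_def)
      have "card (F - {e} - B) = card (F - {e}) - b"
        using B fin finite_subset[of B F] by (subst card_Diff_subset) auto
      then have "card F = card (F - {e} - B) + Suc b"
        using le e card_Suc_Diff1[OF fin e] by linarith
      then have "card F mod Suc b = card (F - {e} - B) mod Suc b" by (metis mod_add_self2)
      then have "wins b P (insert e A) (F - {e} - B)"
        using IH Q fin by simp
      with r show "\<exists>B. reply b (F - {e}) B \<and> wins b P (insert e A) (F - {e} - B)" by blast
    qed
  qed
  then show ?thesis using assms(2,3) by simp
qed

text \<open>Outside \<open>T\<close> there are edges for exactly \<open>j\<close> rounds. While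
  Avoider stays outside \<open>T\<close>, Enforcer can do so as well, until nothing but threats is
  left.\<close>

lemma wins_by_threats:
  assumes "mono P" and "finite F" and "T \<subseteq> F" and "\<And>e. e \<in> T \<Longrightarrow> P (insert e A)"
    and "card F = j * Suc b + card T" and "T \<noteq> {}"
  shows "wins b P A F"
  using assms
proof (induction j arbitrary: A F)
  case 0
  then have "T = F" by (metis add_0 card_subset_eq mult_0)
  then show ?case
    using 0 by (metis finite_Diff reply_exists wins.now wins.round)
next
  case (Suc j)
  show ?case
  proof (rule wins.round)
    show "F \<noteq> {}" using Suc.prems by auto
    fix e assume e: "e \<in> F"
    show "\<exists>B. reply b (F - {e}) B \<and> wins b P (insert e A) (F - {e} - B)"
    proof (cases "e \<in> T")
      case True
      then show ?thesis
        using Suc.prems by (metis finite_Diff reply_exists wins.now)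
    next
      case False
      have fT: "finite T" using Suc.prems finite_subset by blast
      have cF: "card (F - {e}) = j * Suc b + card T + b"
        using e Suc.prems by simp
      have "card (F - {e} - T) = j * Suc b + b"
        using False Suc.prems cF fT by (subst card_Diff_subset) auto
      then obtain B where B: "B \<subseteq> F - {e} - T" "card B = b"
        by (metis le_add2 obtain_subset_with_card_n)
      then have "reply b (F - {e}) B" by (auto simp: reply_def cF)
      have "card (F - {e} - B) = j * Suc b + card T"
        using cF B Suc.prems(2) finite_subset[of B F] by (subst card_Diff_subset) auto
      moreover have "P (insert x (insert e A))" if "x \<in> T" for x
        using Suc.prems(4)[OF that] monoD[OF Suc.prems(1), of "insert x A" "insert x (insert e A)"]
        by (auto simp: le_bool_def)
      ultimately have "wins b P (insert e A) (F - {e} - B)"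
        using Suc.prems(1-3,6) B False by (intro Suc.IH) auto
      then show ?thesis using \<open>reply b (F - {e}) B\<close> by blast
    qed
  qed
qed

section \<open>Edge counts\<close>

lemma connected_boundary:
  assumes "connected_graph V E" and "s \<in> S" "s \<in> V" "t \<in> V" "t \<notin> S"
  shows "\<exists>x y. x \<in> S \<and> y \<notin> S \<and> {x, y} \<in> E"
proof -
  have "(s, t) \<in> {(x, y). {x, y} \<in> E}\<^sup>*"
    using assms by (auto simp: connected_graph_def)
  then have "t \<in> S \<or> (\<exists>x y. x \<in> S \<and> y \<notin> S \<and> {x, y} \<in> E)"
    by (induction rule: rtrancl_induct) (use assms(2) in auto)
  then show ?thesis using assms(5) by blast
qed

text \<open>A largest vertex set that spans at least one edge less than it has vertices must be
  \<open>V\<close>: otherwise an edge leaving it adds one vertex and one edge.\<close>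

lemma connected_edge_count:
  assumes fin: "finite V" "finite E" and con: "connected_graph V E"
    and sub: "\<And>e. e \<in> E \<Longrightarrow> e \<subseteq> V"
  shows "card V \<le> card E + 1"
proof -
  define Q where "Q S \<longleftrightarrow> S \<noteq> {} \<and> S \<subseteq> V \<and> (\<exists>E'\<subseteq>E. (\<forall>e\<in>E'. e \<subseteq> S) \<and> card S \<le> card E' + 1)" for S
  obtain v where "v \<in> V" using con by (auto simp: connected_graph_def)
  then have v: "Q {v}" unfolding Q_def by (intro conjI exI[of _ "{}"]) auto
  have "\<exists>S. Q S \<and> (\<forall>S'. Q S' \<longrightarrow> card S' \<le> card S)"
    by (rule ex_has_greatest_nat[where b = "Suc (card V)" and P = Q and f = card, OF v])
      (auto simp: Q_def less_Suc_eq_le intro: card_mono fin)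
  then obtain S where S: "Q S" and max: "\<And>S'. Q S' \<Longrightarrow> card S' \<le> card S" by blast
  then obtain E' where E': "E' \<subseteq> E" "\<forall>e\<in>E'. e \<subseteq> S" "card S \<le> card E' + 1" and SV: "S \<subseteq> V" "S \<noteq> {}"
    by (auto simp: Q_def)
  have "S = V"
  proof (rule ccontr)
    assume "S \<noteq> V"
    then obtain s t where st: "s \<in> S" "t \<in> V" "t \<notin> S" using SV by blast
    then obtain x y where xy: "x \<in> S" "y \<notin> S" "{x, y} \<in> E"
      using connected_boundary[OF con, of s S t] SV by blast
    have "{x, y} \<notin> E'" using E' xy by auto
    have fE: "finite E'" "finite S" using E'(1) SV(1) fin by (auto intro: finite_subset)
    have "Q (insert y S)"
      unfolding Q_def
    proof (intro conjI exI[of _ "insert {x, y} E'"])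
      show "insert y S \<subseteq> V" using xy sub[OF xy(3)] SV by auto
      show "card (insert y S) \<le> card (insert {x, y} E') + 1"
        using xy fE E' \<open>{x, y} \<notin> E'\<close> by simp
    qed (use xy E' in auto)
    then show False using max[of "insert y S"] xy fE by simp
  qed
  then show ?thesis
    using E' card_mono[OF fin(2) E'(1)] by simp
qed

text \<open>The first vertex of a longest path has a neighbour besides the second vertex. By
  maximality it lies on the path, and the initial segment up to it closes to a cycle. Quantifying
  over all \<open>z\<close> encodes minimum degree two.\<close>

lemma cycle_if_two_neighbours:
  assumes fin: "finite V" "V \<noteq> {}"
    and nb: "\<And>x z. x \<in> V \<Longrightarrow> \<exists>y\<in>V. y \<noteq> x \<and> y \<noteq> z \<and> {x, y} \<in> E"
  shows "\<exists>C. cycle_in E C"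
proof -
  define path where "path vs \<longleftrightarrow> distinct vs \<and> set vs \<subseteq> V \<and> vs \<noteq> [] \<and>
    (\<forall>i. Suc i < length vs \<longrightarrow> {vs ! i, vs ! Suc i} \<in> E)" for vs
  obtain v where "v \<in> V" using fin by blast
  then have v: "path [v]" by (simp add: path_def)
  have "\<exists>vs. path vs \<and> (\<forall>ws. path ws \<longrightarrow> length ws \<le> length vs)"
    by (rule ex_has_greatest_nat[where b = "Suc (card V)" and P = path and f = length, OF v])
      (metis path_def card_mono distinct_card fin(1) le_imp_less_Suc)
  then obtain vs where vs: "path vs" and max: "\<And>ws. path ws \<Longrightarrow> length ws \<le> length vs" by blast
  define x where "x = vs ! 0"
  \<comment> \<open>On a one-vertex path \<open>vs ! 1\<close> is unspecified, which is harmless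
    because \<open>nb\<close> holds for every \<open>z\<close>.\<close>
  define z where "z = vs ! 1"
  have x: "x \<in> V" using vs by (auto simp: path_def x_def)
  obtain y where y: "y \<in> V" "y \<noteq> x" "y \<noteq> z" "{x, y} \<in> E" using nb[OF x, of z] by blast
  have "y \<in> set vs"
  proof (rule ccontr)
    assume "y \<notin> set vs"
    then have "path (y # vs)"
      using vs y by (auto simp: path_def x_def nth_Cons insert_commute split: nat.splits)
    then show False using max[of "y # vs"] by simp
  qed
  then obtain j where j: "j < length vs" "vs ! j = y" by (auto simp: in_set_conv_nth)
  have "j \<noteq> 0" using y j by (metis x_def)
  moreover have "j \<noteq> 1" using y j by (metis z_def)
  ultimately have j2: "2 \<le> j" by simp
  define ws where "ws = take (Suc j) vs"
  have len: "length ws = Suc j" using j by (simp add: ws_def)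
  have "{ws ! i, ws ! (Suc i mod length ws)} \<in> E" if "i < length ws" for i
  proof (cases "i = j")
    case True
    then show ?thesis using y j len by (simp add: ws_def x_def insert_commute)
  next
    case False
    then show ?thesis using that vs j len by (simp add: ws_def path_def)
  qed
  then have "cycle_in E {{ws ! i, ws ! (Suc i mod length ws)} | i. i < length ws}"
    unfolding cycle_in_def using len j2 vs by (intro conjI exI[of _ ws]) (auto simp: ws_def path_def)
  then show ?thesis by blast
qed

lemma cycle_in_mono: "cycle_in E C \<Longrightarrow> E \<subseteq> E' \<Longrightarrow> cycle_in E' C"
  by (auto simp: cycle_in_def)

text \<open>Some vertex has at most one neighbour, since minimum degree two would force a cycle;
  deleting it loses at most one edge.\<close>

lemma acyclic_edge_count:
  assumes "finite V" "V \<noteq> {}" and "\<And>e. e \<in> E \<Longrightarrow> e \<subseteq> V \<and> card e = 2" and "\<nexists>C. cycle_in E C"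
  shows "card E < card V"
  using assms
proof (induction "card V" arbitrary: V E)
  case 0
  then show ?case by simp
next
  case (Suc k)
  have fE: "finite E"
    using Suc.prems(1,3) by (intro finite_subset[of E "Pow V"]) auto
  obtain x z where x: "x \<in> V" and z: "\<And>y. y \<in> V \<Longrightarrow> y \<noteq> x \<Longrightarrow> {x, y} \<in> E \<Longrightarrow> y = z"
    using cycle_if_two_neighbours[OF Suc.prems(1,2)] Suc.prems(4) by metis
  show ?case
  proof (cases "V = {x}")
    case True
    then have "E = {}"
      using Suc.prems(3) by (metis card_1_singleton_iff card_mono equals0I finite.emptyI finite_insert
          numeral_le_one_iff semiring_norm(69) is_singletonI is_singleton_altdef)
    then show ?thesis using True by simp
  next
    case False
    define E' where "E' = {e \<in> E. x \<notin> e}"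
    have "E - E' \<subseteq> {{x, z}}"
    proof
      fix e assume "e \<in> E - E'"
      then have e: "e \<in> E" "x \<in> e" by (auto simp: E'_def)
      then obtain y where "e = {x, y}" "y \<noteq> x"
        using Suc.prems(3)[OF e(1)] by (auto simp: card_2_iff)
      then show "e \<in> {{x, z}}" using z e Suc.prems(3)[OF e(1)] by auto
    qed
    then have "card (E - E') \<le> 1" using card_mono[of "{{x, z}}"] by simp
    then have "card E \<le> card E' + 1"
      using fE by (simp add: card_Diff_subset E'_def)
    moreover have "card E' < card (V - {x})"
    proof (rule Suc.hyps(1))
      show "V - {x} \<noteq> {}" using False x by auto
      show "\<nexists>C. cycle_in E' C"
        using Suc.prems(4) cycle_in_mono[of E' _ E] by (auto simp: E'_def)
    qed (use Suc.hyps(2) Suc.prems x in \<open>auto simp: E'_def\<close>)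
    ultimately show ?thesis using Suc.prems(1) x by simp
  qed
qed

text \<open>Removing one edge of the only cycle leaves an acyclic graph on the same
  vertices.\<close>

lemma unicyclic_edge_count:
  assumes G: "simple_graph V E" and u: "unicyclic_graph V E"
  shows "card E \<le> card V"
proof -
  obtain C where C: "cycle_in E C" and uniq: "\<And>C'. cycle_in E C' \<Longrightarrow> C' = C"
    using u by (auto simp: unicyclic_graph_def)
  obtain vs where vs: "3 \<le> length vs"
    "C = {{vs ! i, vs ! (Suc i mod length vs)} | i. i < length vs}"
    using C unfolding cycle_in_def by (elim conjE exE) (rule that)
  obtain g where g: "g \<in> C"
    using vs(1) unfolding vs(2) by (metis (mono_tags, lifting) gr0I mem_Collect_eq not_numeral_le_zero)
  have "\<nexists>C'. cycle_in (E - {g}) C'"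
  proof
    assume "\<exists>C'. cycle_in (E - {g}) C'"
    then obtain C' where C': "cycle_in (E - {g}) C'" by blast
    then have "C' = C" using uniq cycle_in_mono by blast
    then show False using C' g by (auto simp: cycle_in_def)
  qed
  then have "card (E - {g}) < card V"
    using G u by (intro acyclic_edge_count)
      (auto simp: simple_graph_def unicyclic_graph_def connected_graph_def)
  then show ?thesis
    using g C by (auto simp: cycle_in_def card_Diff_singleton_if split: if_splits)
qed

section \<open>Labelled boards\<close>

text \<open>For disjoint blocks these are the parallel edges between them in the multigraph that
  arises from \<open>H\<close> by contracting every block.\<close>

definition links :: "'a set set \<Rightarrow> 'a set \<Rightarrow> 'a set \<Rightarrow> 'a set set" where
  "links U X Y = {g \<in> U. g \<inter> X \<noteq> {} \<and> g \<inter> Y \<noteq> {}}"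

lemma links_commute: "links U X Y = links U Y X"
  by (auto simp: links_def)

text \<open>A labelling of the vertices of \<open>K\<^sub>n\<close> by vertices of \<open>H\<close> turns a partial copy of \<open>H\<close> into a
  set of vertices with distinct labels, and an edge \<open>e\<close> of the board plays the role of the edge
  \<open>lab ` e\<close> of \<open>H\<close>.\<close>

locale board =
  fixes V :: "'a set" and E :: "'a set set" and n :: nat and lab :: "nat \<Rightarrow> 'a"
  assumes graph: "simple_graph V E"
begin

definition inner :: "'a set set \<Rightarrow> nat set \<Rightarrow> nat set set" where
  "inner U D = {e. e \<subseteq> D \<and> lab ` e \<in> U}"

definition cross :: "'a set set \<Rightarrow> nat set \<Rightarrow> nat set \<Rightarrow> nat set set" where
  "cross U D D' = {{u, w} | u w. u \<in> D \<and> w \<in> D' \<and> {lab u, lab w} \<in> U}"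

definition cnt :: "nat set set \<Rightarrow> 'a set \<Rightarrow> nat" where
  "cnt DD Z = card {D \<in> DD. lab ` D = Z}"

text \<open>\<open>U\<close> is the set of edges of \<open>H\<close> that no piece has acquired yet, and \<open>\<pi>\<close> collects the label
  sets of the pieces.\<close>

definition position ::
    "'a set set \<Rightarrow> 'a set set \<Rightarrow> nat set set \<Rightarrow> nat set set \<Rightarrow> nat set set \<Rightarrow> bool" where
  "position \<pi> U DD A F \<longleftrightarrow> partition_on V \<pi> \<and> U \<subseteq> E \<and> (\<forall>g\<in>E - U. \<exists>Z\<in>\<pi>. g \<subseteq> Z) \<and>
     card V \<le> card (E - U) + card \<pi> \<and>
     finite A \<and> finite F \<and> A \<inter> F = {} \<and> \<Union>DD \<subseteq> {..<n} \<and> disjoint DD \<and>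
     (\<forall>D\<in>DD. inj_on lab D \<and> lab ` D \<in> \<pi> \<and> inner (E - U) D \<subseteq> A \<and> inner U D \<subseteq> F) \<and>
     (\<forall>D\<in>DD. \<forall>D'\<in>DD. lab ` D \<noteq> lab ` D' \<longrightarrow> cross U D D' \<subseteq> F)"

lemma finite_V: "finite V" and edgeD: "g \<in> E \<Longrightarrow> g \<subseteq> V \<and> card g = 2"
  using graph by (auto simp: simple_graph_def)

lemma finite_E: "finite E"
  using edgeD finite_V by (intro finite_subset[of E "Pow V"]) auto

lemma cross_commute: "cross U D D' = cross U D' D"
proof -
  have "cross U D D' \<subseteq> cross U D' D" for D D'
  proof
    fix e assume "e \<in> cross U D D'"
    then obtain u w where uw: "u \<in> D" "w \<in> D'" "e = {u, w}" "{lab u, lab w} \<in> U"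
      unfolding cross_def by blast
    then have "e = {w, u}" "{lab w, lab u} \<in> U" by (simp_all add: insert_commute)
    then show "e \<in> cross U D' D" using uw unfolding cross_def by blast
  qed
  then show ?thesis by blast
qed

lemma cross_Un_left: "cross U (D \<union> D') D'' = cross U D D'' \<union> cross U D' D''"
  by (auto simp: cross_def)

lemma crossD:
  assumes "e \<in> cross U D D'"
  shows "e \<subseteq> D \<union> D'" "e \<inter> D \<noteq> {}" "e \<inter> D' \<noteq> {}" "lab ` e \<in> U"
proof -
  obtain u w where "e = {u, w}" "u \<in> D" "w \<in> D'" "{lab u, lab w} \<in> U"
    using assms unfolding cross_def by blast
  then show "e \<subseteq> D \<union> D'" "e \<inter> D \<noteq> {}" "e \<inter> D' \<noteq> {}" "lab ` e \<in> U" by simp_all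
qed

lemma finite_inner: "finite D \<Longrightarrow> finite (inner U D)"
  by (rule finite_subset[of _ "Pow D"]) (auto simp: inner_def)

lemma inner_Un:
  assumes "inj_on lab (D \<union> D')" and "U \<subseteq> E"
  shows "inner U (D \<union> D') = inner U D \<union> inner U D' \<union> cross U D D'"
proof
  show "inner U (D \<union> D') \<subseteq> inner U D \<union> inner U D' \<union> cross U D D'"
  proof
    fix e assume "e \<in> inner U (D \<union> D')"
    then have e: "e \<subseteq> D \<union> D'" "lab ` e \<in> U" by (auto simp: inner_def)
    have "card (lab ` e) = card e"
      using assms(1) e(1) by (intro card_image) (blast intro: inj_on_subset)
    then have "card e = 2" using edgeD[of "lab ` e"] e assms by auto
    then obtain u w where uw: "e = {u, w}" by (auto simp: card_2_iff)
    have "e \<in> cross U D D'" if "\<not> e \<subseteq> D" "\<not> e \<subseteq> D'"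
    proof -
      have uw': "{lab u, lab w} \<in> U" "{lab w, lab u} \<in> U" "e = {w, u}"
        using e uw by (auto simp: insert_commute)
      have "u \<in> D \<and> w \<in> D' \<or> w \<in> D \<and> u \<in> D'" using that e uw by auto
      then show ?thesis using uw uw' unfolding cross_def by blast
    qed
    then show "e \<in> inner U D \<union> inner U D' \<union> cross U D D'"
      using e by (auto simp: inner_def)
  qed
  show "inner U D \<union> inner U D' \<union> cross U D D' \<subseteq> inner U (D \<union> D')"
    by (auto simp: inner_def dest: crossD)
qed

lemma disjoint_Un_labels:
  assumes "inj_on lab D" "inj_on lab D'" "lab ` D \<inter> lab ` D' = {}"
  shows "inj_on lab (D \<union> D')"
proof (rule inj_onI)
  fix x y assume xy: "x \<in> D \<union> D'" "y \<in> D \<union> D'" "lab x = lab y"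
  have "\<not> (x \<in> D \<and> y \<in> D')" "\<not> (x \<in> D' \<and> y \<in> D)"
    using assms(3) xy(3) by (metis IntI emptyE imageI)+
  then show "x = y" using xy inj_onD[OF assms(1)] inj_onD[OF assms(2)] by blast
qed

text \<open>Labels are injective on the union of both pieces, so an edge between them is determined
  by its label edge. Hence the number depends on the label sets only.\<close>

lemma card_cross:
  assumes "inj_on lab D" "inj_on lab D'" "lab ` D \<inter> lab ` D' = {}" "U \<subseteq> E"
  shows "card (cross U D D') = card (links U (lab ` D) (lab ` D'))"
proof -
  have inj: "inj_on lab (D \<union> D')" using assms disjoint_Un_labels by blast
  have "bij_betw ((`) lab) (cross U D D') (links U (lab ` D) (lab ` D'))"
    unfolding bij_betw_def
  proof
    show "inj_on ((`) lab) (cross U D D')"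
      using inj_on_image_Pow[OF inj] by (rule inj_on_subset) (auto dest: crossD)
    show "(`) lab ` cross U D D' = links U (lab ` D) (lab ` D')"
    proof
      show "(`) lab ` cross U D D' \<subseteq> links U (lab ` D) (lab ` D')"
        by (auto simp: cross_def links_def)
      show "links U (lab ` D) (lab ` D') \<subseteq> (`) lab ` cross U D D'"
      proof
        fix g assume "g \<in> links U (lab ` D) (lab ` D')"
        then obtain u w where uw: "g \<in> U" "u \<in> D" "w \<in> D'" "lab u \<in> g" "lab w \<in> g"
          by (auto simp: links_def)
        have "lab u \<noteq> lab w" using uw assms(3) by auto
        moreover have "card g = 2" using edgeD uw assms(4) by blast
        ultimately have "g = {lab u, lab w}" using uw by (auto simp: card_2_iff)
        then show "g \<in> (`) lab ` cross U D D'"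
          using uw by (auto simp: cross_def intro!: image_eqI[of _ _ "{u, w}"])
      qed
    qed
  qed
  then show ?thesis by (rule bij_betw_same_card)
qed

lemma cnt_le: "\<Union>DD \<subseteq> {..<n} \<Longrightarrow> disjoint DD \<Longrightarrow> Z \<noteq> {} \<Longrightarrow> cnt DD Z \<le> n"
proof -
  assume DD: "\<Union>DD \<subseteq> {..<n}" "disjoint DD" and Z: "Z \<noteq> {}"
  let ?S = "{D \<in> DD. lab ` D = Z}"
  have "inj_on Min ?S"
  proof (rule inj_onI)
    fix D D' assume D: "D \<in> ?S" "D' \<in> ?S" "Min D = Min D'"
    have "D \<subseteq> {..<n}" "D' \<subseteq> {..<n}" using D DD(1) by auto
    then have "finite D" "D \<noteq> {}" "finite D'" "D' \<noteq> {}"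
      using D Z finite_subset[of _ "{..<n}"] by auto
    then have "Min D \<in> D \<inter> D'" using D(3) by (metis IntI Min_in)
    then show "D = D'" using DD(2) D by (auto simp: disjoint_def)
  qed
  moreover have "Min ` ?S \<subseteq> {..<n}"
  proof
    fix x assume "x \<in> Min ` ?S"
    then obtain D where D: "D \<in> ?S" "x = Min D" by blast
    have "D \<subseteq> {..<n}" using D DD(1) by auto
    moreover have "Min D \<in> D"
      using D(1) Z \<open>D \<subseteq> {..<n}\<close> by (intro Min_in) (auto intro: finite_subset)
    ultimately show "x \<in> {..<n}" using D(2) by auto
  qed
  ultimately show ?thesis
    unfolding cnt_def using card_inj_on_le[of Min ?S "{..<n}"] by simp
qed

end

section \<open>One phase of Enforcer's strategy\<close>

locale phase = board +
  fixes \<pi> U :: "'a set set" and DD0 X1 Y1 :: "nat set set" and A0 F0 :: "nat set set"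
    and X Y :: "'a set"
  assumes pos: "position \<pi> U DD0 A0 F0"
    and XY: "X \<in> \<pi>" "Y \<in> \<pi>" "X \<noteq> Y"
    and X1: "X1 \<subseteq> {D \<in> DD0. lab ` D = X}"
    and Y1: "Y1 \<subseteq> {D \<in> DD0. lab ` D = Y}"
begin

text \<open>Enforcer's waiting moves are taken from the edges between \<open>X1\<close> and \<open>Y1\<close>. A pair in \<open>L\<close> is
  still untouched by them, and pieces meeting \<open>X1\<close> and \<open>Y1\<close> may only be merged along such a pair;
  hence a merged piece never lacks an edge.\<close>

definition conflict :: "nat set \<Rightarrow> nat set \<Rightarrow> bool" where
  "conflict D D' \<longleftrightarrow> (D \<inter> \<Union>X1 \<noteq> {} \<and> D' \<inter> \<Union>Y1 \<noteq> {}) \<or> (D \<inter> \<Union>Y1 \<noteq> {} \<and> D' \<inter> \<Union>X1 \<noteq> {})"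

definition compat :: "(nat set \<times> nat set) set \<Rightarrow> nat set \<Rightarrow> nat set \<Rightarrow> bool" where
  "compat L D D' \<longleftrightarrow> lab ` D \<inter> lab ` D' = {} \<and> (conflict D D' \<longrightarrow> (D, D') \<in> L \<or> (D', D) \<in> L)"

definition connecting :: "nat set set \<Rightarrow> (nat set \<times> nat set) set \<Rightarrow> nat set set" where
  "connecting DD L = {e. \<exists>D\<in>DD. \<exists>D'\<in>DD. compat L D D' \<and> e \<in> cross U D D'}"

definition good :: "nat set set \<Rightarrow> (nat set \<times> nat set) set \<Rightarrow> nat set set" where
  "good DD L = (\<Union>D\<in>DD. inner U D) \<union> connecting DD L"

section \<open>Pieces and the invariant kept during a phase\<close>

definition blocks :: "nat set \<Rightarrow> 'a set set" where
  "blocks D = {Z \<in> \<pi>. Z \<subseteq> lab ` D}"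

text \<open>A piece is a union of blocks none of whose edges has been lost to Enforcer. The bound on
  \<open>card (blocks D)\<close> is a spanning tree count and preserves the counting clause of
  \<open>position\<close>; the last clause later supplies two linked blocks inside a merged
  piece.\<close>

definition piece :: "nat set set \<Rightarrow> nat set set \<Rightarrow> nat set \<Rightarrow> bool" where
  "piece A F D \<longleftrightarrow> D \<noteq> {} \<and> D \<subseteq> {..<n} \<and> inj_on lab D \<and> lab ` D \<subseteq> V \<and>
     (\<forall>Z\<in>\<pi>. Z \<subseteq> lab ` D \<or> Z \<inter> lab ` D = {}) \<and>
     (D \<in> DD0 \<or> inner U D \<inter> A \<noteq> {}) \<and> inner (E - U) D \<subseteq> A \<and> inner U D \<subseteq> A \<union> F \<and>
     card (blocks D) \<le> card (inner U D \<inter> A) + 1 \<and>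
     (\<forall>Z\<in>blocks D. lab ` D \<noteq> Z \<longrightarrow> (\<exists>Z'\<in>blocks D. Z' \<noteq> Z \<and> links U Z Z' \<noteq> {}))"

text \<open>Original pieces are only ever absorbed, so the untouched ones can be counted at the end.
  Edges between incompatible pieces may already be burnt, hence freeness is demanded of
  \<open>connecting DD L\<close> only.\<close>

definition valid ::
    "nat set set \<Rightarrow> (nat set \<times> nat set) set \<Rightarrow> nat set set \<Rightarrow> nat set set \<Rightarrow> bool" where
  "valid DD L A F \<longleftrightarrow> finite A \<and> finite F \<and> A \<inter> F = {} \<and> disjoint DD \<and> (\<forall>D\<in>DD. piece A F D) \<and>
     (\<forall>D0\<in>DD0. \<exists>D\<in>DD. D0 \<subseteq> D) \<and> connecting DD L \<subseteq> F \<and> L \<subseteq> (X1 \<inter> DD) \<times> (Y1 \<inter> DD)"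

lemma part: "partition_on V \<pi>" and UE: "U \<subseteq> E" and claimed_in_block: "g \<in> E - U \<Longrightarrow> \<exists>Z\<in>\<pi>. g \<subseteq> Z"
  using pos by (auto simp: position_def)

lemma block_ne: "Z \<in> \<pi> \<Longrightarrow> Z \<noteq> {}" and block_sub: "Z \<in> \<pi> \<Longrightarrow> Z \<subseteq> V"
  and block_disj: "Z \<in> \<pi> \<Longrightarrow> Z' \<in> \<pi> \<Longrightarrow> Z \<noteq> Z' \<Longrightarrow> Z \<inter> Z' = {}"
  using part by (auto simp: partition_on_def disjoint_def)

lemma finite_pi: "finite \<pi>"
  using part finite_V finite_elements by blast

lemma base_disj: "D \<in> DD0 \<Longrightarrow> D' \<in> DD0 \<Longrightarrow> D \<noteq> D' \<Longrightarrow> D \<inter> D' = {}"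
  using pos by (auto simp: position_def disjoint_def)

lemma base_ne: "D \<in> DD0 \<Longrightarrow> D \<noteq> {}"
  using pos block_ne[of "lab ` D"] by (auto simp: position_def)

lemma base_sub: "D \<in> DD0 \<Longrightarrow> D \<subseteq> {..<n}"
  using pos by (auto simp: position_def)

lemma valid_disj: "valid DD L A F \<Longrightarrow> D \<in> DD \<Longrightarrow> D' \<in> DD \<Longrightarrow> D \<noteq> D' \<Longrightarrow> D \<inter> D' = {}"
  by (auto simp: valid_def disjoint_def)

lemma validD:
  assumes "valid DD L A F"
  shows "finite A" "finite F" "A \<inter> F = {}" "D \<in> DD \<Longrightarrow> piece A F D"
    "connecting DD L \<subseteq> F" "L \<subseteq> (X1 \<inter> DD) \<times> (Y1 \<inter> DD)"
  using assms by (auto simp: valid_def)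

lemma pieceD:
  assumes "piece A F D"
  shows "D \<noteq> {}" "D \<subseteq> {..<n}" "inj_on lab D" "finite D" "lab ` D \<subseteq> V"
    "Z \<in> \<pi> \<Longrightarrow> Z \<subseteq> lab ` D \<or> Z \<inter> lab ` D = {}" "D \<in> DD0 \<or> inner U D \<inter> A \<noteq> {}"
    "inner (E - U) D \<subseteq> A" "inner U D \<subseteq> A \<union> F" "card (blocks D) \<le> card (inner U D \<inter> A) + 1"
    "Z \<in> blocks D \<Longrightarrow> lab ` D \<noteq> Z \<Longrightarrow> \<exists>Z'\<in>blocks D. Z' \<noteq> Z \<and> links U Z Z' \<noteq> {}"
  using assms finite_subset[of D "{..<n}"] by (auto simp: piece_def)

lemma compat_sym: "compat L D D' \<longleftrightarrow> compat L D' D"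
proof -
  have "conflict D D' \<longleftrightarrow> conflict D' D" by (metis conflict_def)
  then show ?thesis by (metis compat_def Int_commute)
qed

lemma compat_ne: "compat L D D' \<Longrightarrow> D \<noteq> {} \<Longrightarrow> D \<noteq> D'"
  by (auto simp: compat_def)

lemma blocks_base: "D \<in> DD0 \<Longrightarrow> blocks D = {lab ` D}"
proof -
  assume D: "D \<in> DD0"
  then have "lab ` D \<in> \<pi>" using pos by (auto simp: position_def)
  moreover have "Z = lab ` D" if "Z \<in> \<pi>" "Z \<subseteq> lab ` D" for Z
    using that block_disj[of Z "lab ` D"] block_ne[of Z] \<open>lab ` D \<in> \<pi>\<close> by blast
  ultimately show ?thesis unfolding blocks_def by blast
qed

lemma piece_base:
  assumes D: "D \<in> DD0"
  shows "piece A0 F0 D"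
proof -
  have "lab ` D \<in> \<pi>" "inj_on lab D" "inner (E - U) D \<subseteq> A0" "inner U D \<subseteq> F0"
    using D pos by (auto simp: position_def)
  then show ?thesis
    unfolding piece_def blocks_base[OF D]
    using D base_ne base_sub block_sub block_disj by auto blast
qed

lemma valid_start: "valid DD0 (X1 \<times> Y1) A0 F0"
  unfolding valid_def
proof (intro conjI ballI)
  show "connecting DD0 (X1 \<times> Y1) \<subseteq> F0"
  proof
    fix e assume "e \<in> connecting DD0 (X1 \<times> Y1)"
    then obtain D D' where D: "D \<in> DD0" "D' \<in> DD0" "lab ` D \<inter> lab ` D' = {}" "e \<in> cross U D D'"
      by (auto simp: connecting_def compat_def)
    then have "lab ` D \<noteq> lab ` D'" using base_ne by auto
    then show "e \<in> F0" using D pos unfolding position_def by blast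
  qed
  show "X1 \<times> Y1 \<subseteq> (X1 \<inter> DD0) \<times> (Y1 \<inter> DD0)" using X1 Y1 by auto
  show "piece A0 F0 D" if "D \<in> DD0" for D using piece_base[OF that] .
qed (use pos in \<open>auto simp: position_def\<close>)

lemma piece_claim:
  assumes D: "piece A F D" and fin: "finite A"
  shows "piece (insert e A) (F - {e}) D"
proof -
  have "card (inner U D \<inter> A) \<le> card (inner U D \<inter> insert e A)"
    using fin by (intro card_mono) auto
  then show ?thesis
    using D unfolding piece_def by auto
qed

lemma valid_claim:
  assumes v: "valid DD L A F" and e: "e \<in> F" "e \<notin> connecting DD L"
  shows "valid DD L (insert e A) (F - {e})"
proof -
  have "piece (insert e A) (F - {e}) D" if "D \<in> DD" for D
    using v that by (intro piece_claim) (auto simp: valid_def)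
  then show ?thesis using v e unfolding valid_def by auto
qed

text \<open>No edge of \<open>E - U\<close> runs between the two pieces: it would lie in one block,
  but the pieces are unions of different blocks. All edges of \<open>U\<close> between them are free
  by compatibility. The numbers of blocks add up, and \<open>e\<close> makes up for the extra one in
  the count.\<close>

lemma piece_merge:
  assumes v: "valid DD L A F" and D: "D \<in> DD" "D' \<in> DD" "compat L D D'" "e \<in> cross U D D'"
  shows "piece (insert e A) (F - {e}) (D \<union> D')"
proof -
  have p: "piece A F D" "piece A F D'" using v D by (auto simp: valid_def)
  have disj: "lab ` D \<inter> lab ` D' = {}" using D(3) by (simp add: compat_def)
  have inj: "inj_on lab (D \<union> D')"
    using disjoint_Un_labels pieceD(3)[OF p(1)] pieceD(3)[OF p(2)] disj by blast
  note Un = inner_Un[OF inj]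
  have fin: "finite D" "finite D'" "finite A" using p v by (auto simp: pieceD validD)
  have cF: "cross U D D' \<subseteq> F"
    using v D unfolding valid_def connecting_def by blast
  have eF: "e \<in> F" using cF D(4) by blast
  then have eA: "e \<notin> A" using v by (auto simp: valid_def)
  have sat: "Z \<subseteq> lab ` (D \<union> D') \<or> Z \<inter> lab ` (D \<union> D') = {}" if "Z \<in> \<pi>" for Z
    using pieceD(6)[OF p(1) that] pieceD(6)[OF p(2) that] by auto
  have bl: "blocks (D \<union> D') = blocks D \<union> blocks D'"
  proof
    show "blocks (D \<union> D') \<subseteq> blocks D \<union> blocks D'"
    proof
      fix Z assume "Z \<in> blocks (D \<union> D')"
      then have Z: "Z \<in> \<pi>" "Z \<subseteq> lab ` D \<union> lab ` D'" by (auto simp: blocks_def)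
      then have "Z \<subseteq> lab ` D \<or> Z \<subseteq> lab ` D'"
        using pieceD(6)[OF p(1) Z(1)] by auto
      then show "Z \<in> blocks D \<union> blocks D'" using Z(1) by (auto simp: blocks_def)
    qed
  qed (auto simp: blocks_def)
  \<comment> \<open>The labels are disjoint, so only the empty set could lie in both families, and
    it is no edge.\<close>
  have sep: "inner W D \<inter> inner W' D' = {}" if "W \<subseteq> E" for W W'
  proof -
    have "e1 = {}" if "e1 \<in> inner W D" "e1 \<in> inner W' D'" for e1
    proof (rule equals0I)
      fix x assume "x \<in> e1"
      then have "lab x \<in> lab ` D \<inter> lab ` D'" using that by (auto simp: inner_def)
      then show False using disj by simp
    qed
    moreover have "{} \<notin> inner W D" using \<open>W \<subseteq> E\<close> edgeD[of "{}"] by (auto simp: inner_def)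
    ultimately show ?thesis by blast
  qed
  have claimed: "inner (E - U) (D \<union> D') \<subseteq> insert e A"
  proof -
    have "cross (E - U) D D' = {}"
    proof (rule ccontr)
      assume "cross (E - U) D D' \<noteq> {}"
      then obtain u w where uw: "u \<in> D" "w \<in> D'" "{lab u, lab w} \<in> E - U" by (auto simp: cross_def)
      then obtain Z where Z: "Z \<in> \<pi>" "{lab u, lab w} \<subseteq> Z" using claimed_in_block by blast
      then have "Z \<subseteq> lab ` D" using uw pieceD(6)[OF p(1) Z(1)] by auto
      then have "lab w \<in> lab ` D \<inter> lab ` D'" using uw Z by auto
      then show False using disj by simp
    qed
    then show ?thesis
      using Un[of "E - U"] pieceD(8)[OF p(1)] pieceD(8)[OF p(2)] by auto
  qed
  have free: "inner U (D \<union> D') \<subseteq> insert e A \<union> (F - {e})"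
    using Un[OF UE] pieceD(9)[OF p(1)] pieceD(9)[OF p(2)] cF by auto
  have e_in: "e \<in> inner U (D \<union> D')"
    using Un[OF UE] D(4) by auto
  have count: "card (blocks (D \<union> D')) \<le> card (inner U (D \<union> D') \<inter> insert e A) + 1"
  proof -
    have "card (blocks (D \<union> D')) \<le> card (blocks D) + card (blocks D')"
      unfolding bl by (rule card_Un_le)
    moreover have "card (blocks D) + card (blocks D') \<le> card (inner U D \<inter> A) + card (inner U D' \<inter> A) + 2"
      using pieceD(10)[OF p(1)] pieceD(10)[OF p(2)] by simp
    moreover have "card (inner U D \<inter> A) + card (inner U D' \<inter> A) =
        card ((inner U D \<inter> A) \<union> (inner U D' \<inter> A))"
      using sep[OF UE] fin by (intro card_Un_disjoint[symmetric]) auto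
    moreover have "card ((inner U D \<inter> A) \<union> (inner U D' \<inter> A)) + 1 =
        card (insert e ((inner U D \<inter> A) \<union> (inner U D' \<inter> A)))"
      using eA fin by (subst card_insert_disjoint) auto
    moreover have "card (insert e ((inner U D \<inter> A) \<union> (inner U D' \<inter> A))) \<le>
        card (inner U (D \<union> D') \<inter> insert e A)"
      using fin e_in Un[OF UE] by (intro card_mono) auto
    ultimately show ?thesis by linarith
  qed
  \<comment> \<open>The two pieces are generalized here because the claim is applied in both
    orders.\<close>
  have conn: "\<exists>Z'\<in>blocks (D \<union> D'). Z' \<noteq> Z \<and> links U Z Z' \<noteq> {}"
    if Z: "Z \<in> blocks D" and p: "piece A F D" "piece A F D'" and ee: "e \<in> cross U D D'"
      and disj: "lab ` D \<inter> lab ` D' = {}" for Z D D'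
  proof (cases "lab ` D = Z")
    case False
    then obtain Z' where "Z' \<in> blocks D" "Z' \<noteq> Z" "links U Z Z' \<noteq> {}"
      using pieceD(11)[OF p(1) Z] by metis
    then show ?thesis by (intro bexI[of _ Z']) (auto simp: blocks_def)
  next
    case True
    obtain u w where uw: "u \<in> D" "w \<in> D'" "{lab u, lab w} \<in> U" using ee by (auto simp: cross_def)
    have "lab w \<in> V" using uw pieceD(5)[OF p(2)] by auto
    then obtain Z' where Z': "Z' \<in> \<pi>" "lab w \<in> Z'"
      using part by (auto simp: partition_on_def)
    then have "Z' \<subseteq> lab ` D'" using pieceD(6)[OF p(2) Z'(1)] uw by blast
    then have "Z' \<in> blocks (D \<union> D')" using Z' by (auto simp: blocks_def)
    moreover have "Z' \<noteq> Z" using Z' True disj \<open>Z' \<subseteq> lab ` D'\<close> by blast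
    moreover have "{lab u, lab w} \<in> links U Z Z'" using uw Z' True by (auto simp: links_def)
    ultimately show ?thesis by blast
  qed
  have "\<exists>Z'\<in>blocks (D \<union> D'). Z' \<noteq> Z \<and> links U Z Z' \<noteq> {}" if "Z \<in> blocks (D \<union> D')" for Z
  proof (cases "Z \<in> blocks D")
    case True
    then show ?thesis using conn[OF _ p D(4) disj] by blast
  next
    case False
    then have "Z \<in> blocks D'" using that bl by blast
    moreover have "e \<in> cross U D' D" "lab ` D' \<inter> lab ` D = {}"
      using D(4) disj cross_commute by (blast, blast)
    ultimately show ?thesis using conn[OF _ p(2,1)] by (simp add: Un_commute)
  qed
  moreover have "D \<union> D' \<noteq> {}" "D \<union> D' \<subseteq> {..<n}" "lab ` (D \<union> D') \<subseteq> V"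
    using pieceD(1,2,5)[OF p(1)] pieceD(2,5)[OF p(2)] by auto
  moreover have "inner U (D \<union> D') \<inter> insert e A \<noteq> {}" using e_in by blast
  ultimately show ?thesis
    unfolding piece_def using inj sat claimed free count by (intro conjI ballI impI) simp_all
qed

text \<open>The union is a new set, so no pair of \<open>L'\<close> contains it. Whatever is
  compatible with it is therefore in no conflict with it, nor with \<open>D\<close> or
  \<open>D'\<close>, and the edges in question were free before.\<close>

lemma valid_merge:
  assumes v: "valid DD L A F" and D: "D \<in> DD" "D' \<in> DD" "compat L D D'" "e \<in> cross U D D'"
  defines "DD' \<equiv> insert (D \<union> D') (DD - {D, D'})"
    and "L' \<equiv> {(P, Q) \<in> L. P \<noteq> D \<and> P \<noteq> D' \<and> Q \<noteq> D \<and> Q \<noteq> D'}"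
  shows "valid DD' L' (insert e A) (F - {e})"
proof -
  have ne: "D \<noteq> {}" "D' \<noteq> {}" "D \<noteq> D'"
    using v D compat_ne by (auto simp: valid_def piece_def)
  have notin: "D \<union> D' \<notin> DD"
    using valid_disj[OF v, of "D \<union> D'" D] valid_disj[OF v, of "D \<union> D'" D'] D ne by blast
  have disj': "P \<inter> Q = {}" if "P \<in> DD'" "Q \<in> DD'" "P \<noteq> Q" for P Q
    using that valid_disj[OF v] D unfolding DD'_def by auto
  have comp_new: "compat L D P \<and> compat L D' P" if "compat L' (D \<union> D') P" for P
  proof -
    have "\<not> conflict (D \<union> D') P"
      using that notin validD(6)[OF v] unfolding compat_def L'_def by auto
    then have "\<not> conflict D P" "\<not> conflict D' P" unfolding conflict_def by blast+
    moreover have "lab ` D \<inter> lab ` P = {}" "lab ` D' \<inter> lab ` P = {}"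
      using that by (auto simp: compat_def image_Un Int_Un_distrib2)
    ultimately show ?thesis by (simp add: compat_def)
  qed
  have LL: "compat L P Q" if "compat L' P Q" for P Q
    using that unfolding compat_def L'_def by auto
  have new: "cross U (D \<union> D') P \<subseteq> F - {e}" if "P \<in> DD" "P \<noteq> D" "P \<noteq> D'" "compat L' (D \<union> D') P" for P
  proof -
    have "cross U (D \<union> D') P \<subseteq> F"
      using comp_new[OF that(4)] that D validD(5)[OF v]
      unfolding cross_Un_left connecting_def by auto
    moreover have "e \<notin> cross U (D \<union> D') P"
    proof
      assume "e \<in> cross U (D \<union> D') P"
      then have "e \<inter> P \<noteq> {}" by (rule crossD)
      then show False
        using crossD(1)[OF D(4)] valid_disj[OF v that(1) D(1)] valid_disj[OF v that(1) D(2)] that by blast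
    qed
    ultimately show ?thesis by blast
  qed
  have old: "cross U P Q \<subseteq> F - {e}"
    if "P \<in> DD" "P \<noteq> D" "P \<noteq> D'" "Q \<in> DD" "Q \<noteq> D" "Q \<noteq> D'" "compat L' P Q" for P Q
  proof -
    have "cross U P Q \<subseteq> F"
      using LL[OF that(7)] that validD(5)[OF v] unfolding connecting_def by auto
    moreover have "e \<notin> cross U P Q"
    proof
      assume "e \<in> cross U P Q"
      then have "e \<inter> P \<noteq> {}" by (rule crossD)
      then show False
        using crossD(1)[OF D(4)] valid_disj[OF v that(1) D(1)] valid_disj[OF v that(1) D(2)] that by blast
    qed
    ultimately show ?thesis by blast
  qed
  have self: "\<not> compat L' P P" if "P \<noteq> {}" for P using that by (auto simp: compat_def)
  have "connecting DD' L' \<subseteq> F - {e}"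
  proof
    fix x assume "x \<in> connecting DD' L'"
    then obtain P Q where PQ: "P \<in> DD'" "Q \<in> DD'" "compat L' P Q" "x \<in> cross U P Q"
      by (auto simp: connecting_def)
    consider "P = D \<union> D'" "Q = D \<union> D'" | "P = D \<union> D'" "Q \<in> DD - {D, D'}"
      | "P \<in> DD - {D, D'}" "Q = D \<union> D'" | "P \<in> DD - {D, D'}" "Q \<in> DD - {D, D'}"
      using PQ(1,2) unfolding DD'_def by blast
    then show "x \<in> F - {e}"
    proof cases
      case 1
      then show ?thesis using self[of "D \<union> D'"] PQ ne by auto
    next
      case 2
      then show ?thesis using new[of Q] PQ by auto
    next
      case 3
      then show ?thesis using new[of P] PQ cross_commute[of U P Q] compat_sym[of L' P Q] by auto
    next
      case 4
      then show ?thesis using old[of P Q] PQ by auto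
    qed
  qed
  moreover have "\<exists>P\<in>DD'. D0 \<subseteq> P" if "D0 \<in> DD0" for D0
  proof -
    obtain P where "P \<in> DD" "D0 \<subseteq> P" using v \<open>D0 \<in> DD0\<close> unfolding valid_def by blast
    then show ?thesis unfolding DD'_def by (cases "P = D \<or> P = D'") auto
  qed
  moreover have "L' \<subseteq> (X1 \<inter> DD') \<times> (Y1 \<inter> DD')"
    using validD(6)[OF v] unfolding L'_def DD'_def by auto
  moreover have "piece (insert e A) (F - {e}) P" if "P \<in> DD'" for P
  proof (cases "P \<in> DD")
    case True
    then show ?thesis using v by (intro piece_claim) (auto simp: valid_def)
  next
    case False
    then show ?thesis using that piece_merge[OF v D] by (auto simp: DD'_def)
  qed
  moreover have "disjoint DD'" using disj' by (auto simp: disjoint_def)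
  ultimately show ?thesis
    using v unfolding valid_def by auto
qed

text \<open>Each of the two merged pieces can be the first or the second member of at most
  \<open>n\<close> pairs.\<close>

lemma card_Pairs_le:
  assumes v: "valid DD L A F"
  shows "card {(P, Q) \<in> L. P = D \<or> P = D' \<or> Q = D \<or> Q = D'} \<le> 4 * n"
proof -
  have c: "card X1 \<le> n" "card Y1 \<le> n" "finite X1" "finite Y1"
  proof -
    have dd: "\<Union>DD0 \<subseteq> {..<n}" "disjoint DD0" using pos by (auto simp: position_def)
    have "finite DD0" using dd(1) by (metis finite_UnionD finite_lessThan finite_subset)
    then have "card X1 \<le> cnt DD0 X" "card Y1 \<le> cnt DD0 Y" "finite X1" "finite Y1"
      using X1 Y1 unfolding cnt_def by (auto intro!: card_mono intro: finite_subset)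
    then show "card X1 \<le> n" "card Y1 \<le> n" "finite X1" "finite Y1"
      using cnt_le[OF dd] block_ne XY by (meson order_trans)+
  qed
  have "{(P, Q) \<in> L. P = D \<or> P = D' \<or> Q = D \<or> Q = D'} \<subseteq> {D, D'} \<times> Y1 \<union> X1 \<times> {D, D'}"
    using validD(6)[OF v] by auto
  then have "card {(P, Q) \<in> L. P = D \<or> P = D' \<or> Q = D \<or> Q = D'} \<le> card ({D, D'} \<times> Y1 \<union> X1 \<times> {D, D'})"
    using c by (intro card_mono) auto
  also have "\<dots> \<le> card ({D, D'} \<times> Y1) + card (X1 \<times> {D, D'})" by (rule card_Un_le)
  also have "\<dots> \<le> 2 * n + n * 2"
    unfolding card_cartesian_product
    using c by (intro add_mono mult_mono) (auto intro: order_trans[OF card_insert_le_m1])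
  finally show ?thesis by simp
qed

lemma finite_L:
  assumes v: "valid DD L A F"
  shows "finite L"
proof -
  have "finite DD0" using pos unfolding position_def by (metis finite_UnionD finite_lessThan finite_subset)
  then have "finite X1" "finite Y1" using X1 Y1 by (auto intro: finite_subset)
  then show ?thesis using validD(6)[OF v] by (auto intro: finite_subset)
qed

lemma card_merge_pairs:
  assumes v: "valid DD L A F"
  shows "card L \<le> card {(P, Q) \<in> L. P \<noteq> D \<and> P \<noteq> D' \<and> Q \<noteq> D \<and> Q \<noteq> D'} + 4 * n"
proof -
  have "L = {(P, Q) \<in> L. P \<noteq> D \<and> P \<noteq> D' \<and> Q \<noteq> D \<and> Q \<noteq> D'} \<union>
      {(P, Q) \<in> L. P = D \<or> P = D' \<or> Q = D \<or> Q = D'}" by auto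
  then have "card L \<le> card {(P, Q) \<in> L. P \<noteq> D \<and> P \<noteq> D' \<and> Q \<noteq> D \<and> Q \<noteq> D'} +
      card {(P, Q) \<in> L. P = D \<or> P = D' \<or> Q = D \<or> Q = D'}"
    by (metis (lifting) card_Un_le)
  then show ?thesis using card_Pairs_le[OF v, of D D'] by linarith
qed

section \<open>Waiting moves of Enforcer\<close>

definition junk :: "nat set set \<Rightarrow> (nat set \<times> nat set) set \<Rightarrow> nat set set \<Rightarrow> nat set set" where
  "junk DD L F = F - good DD L"

lemma pairD:
  assumes "valid DD L A F" and "(P, Q) \<in> L"
  shows "P \<in> DD" "Q \<in> DD" "lab ` P = X" "lab ` Q = Y" "P \<noteq> Q" "compat L P Q" "conflict P Q"
    "(Q, P) \<notin> L"
proof -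
  have PQ: "P \<in> X1" "P \<in> DD" "Q \<in> Y1" "Q \<in> DD" using validD(6)[OF assms(1)] assms(2) by auto
  then show l: "P \<in> DD" "Q \<in> DD" "lab ` P = X" "lab ` Q = Y" using X1 Y1 by auto
  then show "P \<noteq> Q" using XY by auto
  have "P \<noteq> {}" "Q \<noteq> {}" using l block_ne XY by auto
  then show "conflict P Q" using PQ by (auto simp: conflict_def)
  then show "compat L P Q" using assms(2) l block_disj[OF XY] by (auto simp: compat_def)
  show "(Q, P) \<notin> L"
  proof
    assume "(Q, P) \<in> L"
    then have "Q \<in> X1" using validD(6)[OF assms(1)] by auto
    then show False using l X1 XY by auto
  qed
qed

lemma cross_unique:
  assumes v: "valid DD L A F" and DD: "P \<in> DD" "Q \<in> DD" "P' \<in> DD" "Q' \<in> DD" "P \<noteq> Q"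
    and e: "e \<in> cross U P Q" "e \<in> cross U P' Q'"
  shows "P = P' \<and> Q = Q' \<or> P = Q' \<and> Q = P'"
proof -
  have "P \<inter> P' \<noteq> {} \<or> P \<inter> Q' \<noteq> {}" using crossD(2)[OF e(1)] crossD(1)[OF e(2)] by blast
  then have P: "P = P' \<or> P = Q'" using valid_disj[OF v DD(1,3)] valid_disj[OF v DD(1,4)] by blast
  have "Q \<inter> P' \<noteq> {} \<or> Q \<inter> Q' \<noteq> {}" using crossD(3)[OF e(1)] crossD(1)[OF e(2)] by blast
  then have "Q = P' \<or> Q = Q'" using valid_disj[OF v DD(2,3)] valid_disj[OF v DD(2,4)] by blast
  then show ?thesis using P DD(5) by blast
qed

lemma cross_not_inner:
  assumes v: "valid DD L A F" and DD: "P \<in> DD" "Q \<in> DD" "D \<in> DD" "P \<noteq> Q"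
    and e: "e \<in> cross U P Q" "e \<in> inner U D"
  shows False
proof -
  have "e \<subseteq> D" using e(2) by (simp add: inner_def)
  then have "P \<inter> D \<noteq> {}" "Q \<inter> D \<noteq> {}" using crossD(2,3)[OF e(1)] by auto
  then have "P = D" "Q = D" using valid_disj[OF v DD(1,3)] valid_disj[OF v DD(2,3)] by blast+
  then show False using DD(4) by simp
qed

lemma compat_mono: "compat L' P Q \<Longrightarrow> L' \<subseteq> L \<Longrightarrow> compat L P Q"
  by (auto simp: compat_def)

lemma connecting_mono:
  assumes "L' \<subseteq> L"
  shows "connecting DD L' \<subseteq> connecting DD L"
proof
  fix e assume "e \<in> connecting DD L'"
  then obtain P Q where PQ: "P \<in> DD" "Q \<in> DD" "compat L' P Q" "e \<in> cross U P Q"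
    by (auto simp: connecting_def)
  then show "e \<in> connecting DD L"
    using compat_mono[OF PQ(3) assms] unfolding connecting_def by blast
qed

lemma good_mono: "L' \<subseteq> L \<Longrightarrow> good DD L' \<subseteq> good DD L"
  using connecting_mono[of L' L DD] by (auto simp: good_def)

text \<open>Pieces are disjoint, so an edge determines the pair it connects, and distinct pairs of
  \<open>L\<close> own disjoint bundles of equal size.\<close>

lemma bundles:
  assumes v: "valid DD L A F" and S: "S \<subseteq> L"
  shows "card (\<Union>(P, Q)\<in>S. cross U P Q) = card (links U X Y) * card S"
proof -
  have fin: "finite S" using S finite_L[OF v] finite_subset by blast
  have fc: "finite (cross U P Q)" if "(P, Q) \<in> S" for P Q
  proof -
    have "cross U P Q \<subseteq> F"
      using pairD[OF v, of P Q] that S validD(5)[OF v] unfolding connecting_def by blast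
    then show ?thesis using validD(2)[OF v] finite_subset by blast
  qed
  have c: "card (cross U P Q) = card (links U X Y)" if "(P, Q) \<in> S" for P Q
  proof -
    have "(P, Q) \<in> L" using that S by blast
    note PQ = pairD(1-4)[OF v this]
    have "inj_on lab P" "inj_on lab Q"
      using pieceD(3)[OF validD(4)[OF v PQ(1)]] pieceD(3)[OF validD(4)[OF v PQ(2)]] by simp_all
    then show ?thesis
      using card_cross[of P Q U] PQ block_disj[OF XY] UE by simp
  qed
  have d: "cross U P Q \<inter> cross U P' Q' = {}" if "(P, Q) \<in> S" "(P', Q') \<in> S" "(P, Q) \<noteq> (P', Q')" for P Q P' Q'
  proof (rule ccontr)
    assume "cross U P Q \<inter> cross U P' Q' \<noteq> {}"
    then obtain e where e: "e \<in> cross U P Q" "e \<in> cross U P' Q'" by blast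
    have L: "(P, Q) \<in> L" "(P', Q') \<in> L" using that S by auto
    have "P = P' \<and> Q = Q' \<or> P = Q' \<and> Q = P'"
      using cross_unique[OF v pairD(1,2)[OF v L(1)] pairD(1,2)[OF v L(2)] pairD(5)[OF v L(1)] e] .
    then show False using that(3) pairD(8)[OF v L(1)] L(2) by auto
  qed
  have "card (\<Union>x\<in>S. cross U (fst x) (snd x)) = (\<Sum>x\<in>S. card (cross U (fst x) (snd x)))"
  proof (rule card_UN_disjoint[OF fin])
    show "\<forall>x\<in>S. finite (cross U (fst x) (snd x))" using fc by auto
    show "\<forall>x\<in>S. \<forall>y\<in>S. x \<noteq> y \<longrightarrow> cross U (fst x) (snd x) \<inter> cross U (fst y) (snd y) = {}"
      using d by (metis prod.collapse)
  qed
  also have "\<dots> = (\<Sum>x\<in>S. card (links U X Y))" using c by (intro sum.cong) auto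
  finally show ?thesis by (simp add: case_prod_beta' mult.commute)
qed

text \<open>An edge of a given-up bundle cannot be good for another reason: it joins two different
  pieces, so it lies inside none, and these pieces determine the pair. Hence the whole bundle
  becomes junk and nothing else does.\<close>

lemma card_junk_remove:
  assumes v: "valid DD L A F" and L': "L' \<subseteq> L"
  shows "card (junk DD L' F) = card (junk DD L F) + card (links U X Y) * card (L - L')"
proof -
  define B where "B = (\<Union>(P, Q)\<in>L - L'. cross U P Q)"
  have BF: "B \<subseteq> F" and Bg: "B \<subseteq> good DD L"
  proof -
    have "cross U P Q \<subseteq> connecting DD L" if "(P, Q) \<in> L" for P Q
      using pairD[OF v that] unfolding connecting_def by blast
    then have "B \<subseteq> connecting DD L" unfolding B_def by blast
    then show "B \<subseteq> F" "B \<subseteq> good DD L" using validD(5)[OF v] by (auto simp: good_def)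
  qed
  have sub: "good DD L - good DD L' \<subseteq> B"
  proof
    fix e assume e: "e \<in> good DD L - good DD L'"
    then have "e \<in> connecting DD L" by (auto simp: good_def)
    then obtain P Q where PQ: "P \<in> DD" "Q \<in> DD" "compat L P Q" "e \<in> cross U P Q"
      by (auto simp: connecting_def)
    then have "\<not> compat L' P Q" using e unfolding good_def connecting_def by blast
    then have "(P, Q) \<in> L - L' \<or> (Q, P) \<in> L - L'" using PQ(3) unfolding compat_def by blast
    then show "e \<in> B" using PQ(4) cross_commute[of U P Q] unfolding B_def by blast
  qed
  have dis: "B \<inter> good DD L' = {}"
  proof (rule ccontr)
    assume "B \<inter> good DD L' \<noteq> {}"
    then obtain e P Q where e: "(P, Q) \<in> L" "(P, Q) \<notin> L'" "e \<in> cross U P Q" "e \<in> good DD L'"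
      unfolding B_def by blast
    note PQ = pairD[OF v e(1)]
    have "e \<notin> inner U D" if "D \<in> DD" for D
      using cross_not_inner[OF v PQ(1,2) that PQ(5) e(3)] by blast
    then have "e \<in> connecting DD L'" using e(4) by (auto simp: good_def)
    then obtain P' Q' where PQ': "P' \<in> DD" "Q' \<in> DD" "compat L' P' Q'" "e \<in> cross U P' Q'"
      by (auto simp: connecting_def)
    have "P = P' \<and> Q = Q' \<or> P = Q' \<and> Q = P'"
      using cross_unique[OF v PQ(1,2) PQ'(1,2) PQ(5) e(3) PQ'(4)] .
    then have "compat L' P Q" using PQ'(3) compat_sym by blast
    then have "(P, Q) \<in> L' \<or> (Q, P) \<in> L'" using PQ(7) by (simp add: compat_def)
    then show False using e(2) PQ(8) L' by blast
  qed
  have "junk DD L' F = junk DD L F \<union> B"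
    using BF sub dis good_mono[OF L', of DD] unfolding junk_def by blast
  moreover have "junk DD L F \<inter> B = {}" using Bg by (auto simp: junk_def)
  moreover have "finite (junk DD L F)" "finite B"
    using validD(2)[OF v] BF finite_subset by (auto simp: junk_def)
  moreover have "card B = card (links U X Y) * card (L - L')"
    unfolding B_def by (rule bundles[OF v]) auto
  ultimately show ?thesis by (simp add: card_Un_disjoint)
qed

lemma piece_shrink: "piece A F D \<Longrightarrow> inner U D \<subseteq> A \<union> F' \<Longrightarrow> piece A F' D"
  by (simp add: piece_def)

lemma valid_burn:
  assumes v: "valid DD L A F" and L': "L' \<subseteq> L" and B: "B \<subseteq> junk DD L' F"
  shows "valid DD L' A (F - B)"
proof -
  have B': "B \<inter> good DD L' = {}" using B by (auto simp: junk_def)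
  have "piece A (F - B) D" if "D \<in> DD" for D
  proof -
    have p: "piece A F D" using v that by (auto simp: valid_def)
    have "inner U D \<inter> B = {}" using B' that by (auto simp: good_def)
    then show ?thesis using pieceD(9)[OF p] by (intro piece_shrink[OF p]) blast
  qed
  moreover have "connecting DD L' \<subseteq> F - B"
    using B' validD(5)[OF v] connecting_mono[OF L', of DD] unfolding good_def by blast
  moreover have "L' \<subseteq> (X1 \<inter> DD) \<times> (Y1 \<inter> DD)" using validD(6)[OF v] L' by blast
  ultimately show ?thesis using v unfolding valid_def by (intro conjI ballI) auto
qed

text \<open>When the junk is too small, Enforcer gives up just enough pairs of \<open>L\<close>.
  Bundles come in units of \<open>t\<close>, and since \<open>t\<close> divides \<open>b\<close>,
  burning leaves precisely the old junk modulo \<open>t\<close>.\<close>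

lemma enforcer_reply:
  assumes v: "valid DD L A F" and t: "t = card (links U X Y)" "0 < t" "t dvd b" and b: "b \<le> card L"
  shows "\<exists>B L'. B \<subseteq> F \<and> card B = b \<and> valid DD L' A (F - B) \<and>
    (if b \<le> card (junk DD L F) then L' = L \<and> card (junk DD L' (F - B)) = card (junk DD L F) - b
     else card L \<le> card L' + b \<and> card (junk DD L' (F - B)) = card (junk DD L F) mod t)"
proof (cases "b \<le> card (junk DD L F)")
  case True
  then obtain B where B: "B \<subseteq> junk DD L F" "card B = b" using obtain_subset_with_card_n by metis
  have "junk DD L (F - B) = junk DD L F - B" by (auto simp: junk_def)
  moreover have "finite B" using B(1) validD(2)[OF v] finite_subset by (auto simp: junk_def)
  ultimately have "card (junk DD L (F - B)) = card (junk DD L F) - b"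
    using B by (simp add: card_Diff_subset)
  then show ?thesis
    using True B valid_burn[OF v order_refl B(1)]
    by (intro exI[of _ B] exI[of _ L]) (simp, simp add: junk_def, blast)
next
  case False
  define j where "j = card (junk DD L F)"
  \<comment> \<open>Releasing \<open>q\<close> bundles raises the junk from \<open>j\<close> to
    \<open>b + j mod t\<close>.\<close>
  define q where "q = b div t - j div t"
  have jb: "j < b" using False by (simp add: j_def)
  have tq: "j + t * q = b + j mod t"
  proof -
    have "t * (b div t) = b" using t by simp
    then have "t * q = b - t * (j div t)" by (simp add: q_def diff_mult_distrib2)
    moreover have "t * (j div t) + j mod t = j" by simp
    ultimately show ?thesis using jb by linarith
  qed
  have "q \<le> b" unfolding q_def by (meson diff_le_self div_le_dividend order_trans)
  then obtain S where S: "S \<subseteq> L" "card S = q" using b obtain_subset_with_card_n by (metis order_trans)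
  define L' where "L' = L - S"
  have LL': "L - L' = S" "L' \<subseteq> L" using S by (auto simp: L'_def)
  have cj: "card (junk DD L' F) = b + j mod t"
    using card_junk_remove[OF v LL'(2)] tq S by (simp add: LL' t j_def)
  then obtain B where B: "B \<subseteq> junk DD L' F" "card B = b"
    using obtain_subset_with_card_n[of b "junk DD L' F"] by auto
  have "junk DD L' (F - B) = junk DD L' F - B" by (auto simp: junk_def)
  moreover have "finite B" using B(1) validD(2)[OF v] finite_subset by (auto simp: junk_def)
  ultimately have "card (junk DD L' (F - B)) = j mod t"
    using B cj by (simp add: card_Diff_subset)
  moreover have "card L \<le> card L' + b"
    using S finite_L[OF v] \<open>q \<le> b\<close> by (simp add: L'_def card_Diff_subset finite_subset)
  ultimately show ?thesis
    using False B valid_burn[OF v LL'(2) B(1)]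
    by (intro exI[of _ B] exI[of _ L']) (simp add: j_def, simp add: junk_def, blast)
qed

section \<open>Progress forced upon Avoider\<close>

definition gained :: "nat set set \<Rightarrow> nat set set \<Rightarrow> nat set set" where
  "gained DD A = A \<inter> (\<Union>D\<in>DD. inner U D)"

definition touched :: "nat set set \<Rightarrow> nat set set \<Rightarrow> 'a set \<Rightarrow> nat set set" where
  "touched DD A Z = {D \<in> DD. Z \<subseteq> lab ` D \<and> inner U D \<inter> A \<noteq> {}}"

lemma finite_DD: "valid DD L A F \<Longrightarrow> finite DD"
proof -
  assume v: "valid DD L A F"
  have "\<Union>DD \<subseteq> {..<n}" using pieceD(2)[OF validD(4)[OF v]] by auto
  then show ?thesis by (metis finite_UnionD finite_lessThan finite_subset)
qed

text \<open>A good edge lies inside one piece or fuses two into one, so it counts as a new gain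
  while at most one further piece becomes touched. Only a merge costs pairs, namely those that
  involve the merged pieces.\<close>

lemma avoider_move:
  assumes v: "valid DD L A F" and e: "e \<in> F"
  shows "\<exists>DD' L'. valid DD' L' (insert e A) (F - {e}) \<and>
    card (gained DD A) \<le> card (gained DD' (insert e A)) \<and>
    (\<forall>Z. card (touched DD' (insert e A) Z) \<le> card (touched DD A Z) + 1) \<and>
    (if e \<in> good DD L then card (gained DD A) < card (gained DD' (insert e A)) \<and> card L \<le> card L' + 4 * n
     else DD' = DD \<and> L' = L \<and> card (junk DD L F) = card (junk DD L (F - {e})) + 1)"
proof -
  have eA: "e \<notin> A" and fin: "finite A" "finite DD" using e validD(1,3)[OF v] finite_DD[OF v] by auto
  have fT: "finite (touched DD A Z)" for Z using fin by (simp add: touched_def)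
  have more: "card (gained DD A) < card (gained DD' (insert e A))"
    if "gained DD A \<subseteq> gained DD' (insert e A)" "e \<in> gained DD' (insert e A)" for DD'
  proof (rule psubset_card_mono)
    show "finite (gained DD' (insert e A))" using fin by (simp add: gained_def)
    show "gained DD A \<subset> gained DD' (insert e A)" using that eA by (auto simp: gained_def)
  qed
  have T: "card (touched DD' (insert e A) Z) \<le> card (touched DD A Z) + 1"
    if "touched DD' (insert e A) Z \<subseteq> insert D (touched DD A Z)" for DD' D Z
  proof -
    have "card (touched DD' (insert e A) Z) \<le> card (insert D (touched DD A Z))"
      using that fT by (intro card_mono) auto
    then show ?thesis using card_insert_le_m1[of "card (touched DD A Z) + 1" "touched DD A Z" D] by simp
  qed
  consider "e \<notin> good DD L" | D where "D \<in> DD" "e \<in> inner U D"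
    | "e \<in> connecting DD L"
    by (auto simp: good_def)
  then show ?thesis
  proof cases
    case 1
    then have nc: "e \<notin> connecting DD L" "\<And>D. D \<in> DD \<Longrightarrow> e \<notin> inner U D" by (auto simp: good_def)
    have v': "valid DD L (insert e A) (F - {e})" using valid_claim[OF v e nc(1)] .
    have "gained DD (insert e A) = gained DD A" using nc(2) by (auto simp: gained_def)
    moreover have "touched DD (insert e A) Z = touched DD A Z" for Z using nc(2) by (auto simp: touched_def)
    moreover have "card (junk DD L F) = card (junk DD L (F - {e})) + 1"
    proof -
      have "junk DD L F = insert e (junk DD L (F - {e}))" "e \<notin> junk DD L (F - {e})"
        using e 1 by (auto simp: junk_def)
      then show ?thesis using validD(2)[OF v] by (simp add: junk_def)
    qed
    ultimately show ?thesis using v' 1 by (intro exI[of _ DD] exI[of _ L]) simp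
  next
    case 2
    have nc: "e \<notin> connecting DD L"
    proof
      assume "e \<in> connecting DD L"
      then obtain P Q where PQ: "P \<in> DD" "Q \<in> DD" "compat L P Q" "e \<in> cross U P Q"
        by (auto simp: connecting_def)
      have "P \<noteq> Q" using PQ(3) compat_ne pieceD(1)[OF validD(4)[OF v PQ(1)]] by blast
      then show False using cross_not_inner[OF v PQ(1,2) 2(1) _ PQ(4) 2(2)] by blast
    qed
    have v': "valid DD L (insert e A) (F - {e})" using valid_claim[OF v e nc] .
    have "e \<in> good DD L" using 2 by (auto simp: good_def)
    moreover have "card (gained DD A) < card (gained DD (insert e A))"
      using 2 by (intro more) (auto simp: gained_def)
    moreover have "touched DD (insert e A) Z \<subseteq> insert D (touched DD A Z)" for Z
    proof
      fix P assume P: "P \<in> touched DD (insert e A) Z"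
      then have "P = D" if "e \<in> inner U P"
      proof -
        have "e \<noteq> {}" using 2(2) UE edgeD[of "{}"] by (auto simp: inner_def)
        then have "P \<inter> D \<noteq> {}" using that 2(2) by (auto simp: inner_def)
        then show ?thesis using P 2(1) valid_disj[OF v] by (auto simp: touched_def)
      qed
      then show "P \<in> insert D (touched DD A Z)" using P by (auto simp: touched_def)
    qed
    then have "\<forall>Z. card (touched DD (insert e A) Z) \<le> card (touched DD A Z) + 1"
      by (intro allI T[of DD _ D])
    ultimately show ?thesis using v' by (intro exI[of _ DD] exI[of _ L]) (simp add: less_imp_le)
  next
    case 3
    then obtain D D' where D: "D \<in> DD" "D' \<in> DD" "compat L D D'" "e \<in> cross U D D'"
      by (auto simp: connecting_def)
    define DD' where "DD' = insert (D \<union> D') (DD - {D, D'})"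
    define L' where "L' = {(P, Q) \<in> L. P \<noteq> D \<and> P \<noteq> D' \<and> Q \<noteq> D \<and> Q \<noteq> D'}"
    have v': "valid DD' L' (insert e A) (F - {e})"
      unfolding DD'_def L'_def by (rule valid_merge[OF v D])
    have "inj_on lab (D \<union> D')" using pieceD(3)[OF validD(4)[OF v']] by (auto simp: DD'_def)
    then have Un: "inner U (D \<union> D') = inner U D \<union> inner U D' \<union> cross U D D'"
      using inner_Un UE by blast
    have g: "e \<in> good DD L" using 3 by (auto simp: good_def)
    have sub: "(\<Union>P\<in>DD. inner U P) \<subseteq> (\<Union>P\<in>DD'. inner U P)"
    proof
      fix x assume "x \<in> (\<Union>P\<in>DD. inner U P)"
      then obtain P where P: "P \<in> DD" "x \<in> inner U P" by blast
      then show "x \<in> (\<Union>P\<in>DD'. inner U P)"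
        unfolding DD'_def using Un by (cases "P = D \<or> P = D'") auto
    qed
    have "card (gained DD A) < card (gained DD' (insert e A))"
    proof (rule more)
      show "gained DD A \<subseteq> gained DD' (insert e A)" using sub unfolding gained_def by blast
      show "e \<in> gained DD' (insert e A)" using D(4) Un by (auto simp: gained_def DD'_def)
    qed
    moreover have "touched DD' (insert e A) Z \<subseteq> insert (D \<union> D') (touched DD A Z)" for Z
    proof
      fix P assume P: "P \<in> touched DD' (insert e A) Z"
      have "e \<notin> inner U P" if "P \<in> DD" "P \<noteq> D"
      proof
        assume "e \<in> inner U P"
        then have "D \<inter> P \<noteq> {}" using crossD(2)[OF D(4)] by (auto simp: inner_def)
        then show False using valid_disj[OF v D(1) that(1)] that(2) by blast
      qed
      then show "P \<in> insert (D \<union> D') (touched DD A Z)" using P by (auto simp: touched_def DD'_def)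
    qed
    then have "\<forall>Z. card (touched DD' (insert e A) Z) \<le> card (touched DD A Z) + 1"
      by (intro allI T[of DD' _ "D \<union> D'"])
    moreover have "card L \<le> card L' + 4 * n"
      unfolding L'_def by (rule card_merge_pairs[OF v])
    ultimately show ?thesis using v' g by (intro exI[of _ DD'] exI[of _ L']) (simp add: less_imp_le)
  qed
qed

definition slack :: "nat \<Rightarrow> nat \<Rightarrow> nat" where
  "slack t j = (if j < t then t - j else 0)"

text \<open>A phase ends once Avoider has gained \<open>M\<close> edges or an eighth of some kind of
  pieces has been touched. The last clause keeps most pieces of every block intact; its
  \<open>+ 8\<close> accounts for the piece touched by the final move.\<close>

definition stopped :: "nat \<Rightarrow> nat set set \<Rightarrow> nat set set \<Rightarrow> bool" where
  "stopped M DD A \<longleftrightarrow> (M \<le> card (gained DD A) \<or> (\<exists>Z\<in>\<pi>. cnt DD0 Z \<le> 8 * card (touched DD A Z))) \<and>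
     (\<forall>Z\<in>\<pi>. 8 * card (touched DD A Z) \<le> cnt DD0 Z + 8)"

text \<open>Waiting moves destroy pairs of \<open>L\<close> only when the junk is exhausted. As \<open>t\<close> divides the bias,
  the number of junk edges that are left then only drops until Avoider has to make a good move,
  which the slack accounts for.\<close>

lemma forces_stopped:
  assumes t: "t = card (links U X Y)" "0 < t" "t \<le> 2" "t dvd b" and b: "4 * n \<le> b" "0 < b"
    and L0: "(4 * M + 8) * b \<le> L0"
  shows "valid DD L A F \<Longrightarrow> card (gained DD A) < M \<Longrightarrow> (\<forall>Z\<in>\<pi>. 8 * card (touched DD A Z) \<le> cnt DD0 Z) \<Longrightarrow>
    L0 \<le> card L + (4 * card (gained DD A) + slack t (card (junk DD L F))) * b \<Longrightarrow>
    forces b (\<lambda>A F. \<exists>DD L. valid DD L A F \<and> stopped M DD A) A F"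
proof (induction "card F" arbitrary: DD L A F rule: less_induct)
  case less
  note v = less.prems(1)
  let ?Q = "\<lambda>A F. \<exists>DD L. valid DD L A F \<and> stopped M DD A"
  define m where "m = card (gained DD A)"
  define j where "j = card (junk DD L F)"
  have finF: "finite F" using validD(2)[OF v] .
  have sl: "slack t i \<le> 2" for i using t(3) by (auto simp: slack_def)
  have "(4 * m + slack t j + 2) * b \<le> (4 * M + 8) * b"
    using sl[of j] less.prems(2) by (intro mult_right_mono) (auto simp: m_def)
  then have "(4 * m + slack t j) * b + 2 * b \<le> L0" using L0 by (simp add: add_mult_distrib)
  \<comment> \<open>A round can cost \<open>2 * b\<close> pairs, \<open>4 * n \<le> b\<close> by a
    merge and \<open>b\<close> by the answer.\<close>
  then have cL: "2 * b \<le> card L" using less.prems(4) by (simp add: m_def j_def)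
  have "F \<noteq> {}"
  proof
    assume "F = {}"
    obtain P Q where PQ: "(P, Q) \<in> L" using cL b by (cases "L = {}") auto
    have "cross U P Q \<subseteq> F"
      using pairD(1,2,6)[OF v PQ] validD(5)[OF v] unfolding connecting_def by blast
    moreover have "card (\<Union>(P, Q)\<in>{(P, Q)}. cross U P Q) = card (links U X Y) * card {(P, Q)}"
      using PQ by (intro bundles[OF v]) auto
    ultimately show False using \<open>F = {}\<close> t by simp
  qed
  then show ?case
  proof (rule forces.round)
    fix e assume e: "e \<in> F"
    obtain DD' L' where v': "valid DD' L' (insert e A) (F - {e})"
      and m': "card (gained DD A) \<le> card (gained DD' (insert e A))"
      and T': "\<forall>Z. card (touched DD' (insert e A) Z) \<le> card (touched DD A Z) + 1"
      and mv: "if e \<in> good DD L then card (gained DD A) < card (gained DD' (insert e A)) \<and> card L \<le> card L' + 4 * n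
        else DD' = DD \<and> L' = L \<and> card (junk DD L F) = card (junk DD L (F - {e})) + 1"
      using avoider_move[OF v e] by (elim exE conjE) (rule that)
    have cL': "card L \<le> card L' + b" using mv b by (auto split: if_splits)
    then have bL: "b \<le> card L'" using cL by simp
    obtain B L'' where B: "B \<subseteq> F - {e}" "card B = b" and v'': "valid DD' L'' (insert e A) (F - {e} - B)"
      and re: "if b \<le> card (junk DD' L' (F - {e}))
        then L'' = L' \<and> card (junk DD' L'' (F - {e} - B)) = card (junk DD' L' (F - {e})) - b
        else card L' \<le> card L'' + b \<and> card (junk DD' L'' (F - {e} - B)) = card (junk DD' L' (F - {e})) mod t"
      using enforcer_reply[OF v' t(1,2,4) bL] by (elim exE conjE) (rule that)
    define m2 where "m2 = card (gained DD' (insert e A))"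
    define j2 where "j2 = card (junk DD' L'' (F - {e} - B))"
    have tb: "t \<le> b" using t b by (simp add: dvd_imp_le)
    \<comment> \<open>This potential never decreases. The weight 4 of a good move covers the
      \<open>2 * b\<close> pairs that the round may cost and a drop of the slack by at most
      2.\<close>
    have "(4 * m + slack t j) * b + card L \<le> (4 * m2 + slack t j2) * b + card L''"
    proof (cases "e \<in> good DD L")
      case True
      then have "m + 1 \<le> m2" using mv by (simp add: m_def m2_def)
      then have "(4 * m + slack t j + 2) * b \<le> (4 * m2 + slack t j2) * b"
        using sl[of j] by (intro mult_right_mono) auto
      moreover have "card L \<le> card L'' + 2 * b" using cL' re by (auto split: if_splits)
      ultimately show ?thesis by (simp add: add_mult_distrib)
    next
      case False
      then have eq: "DD' = DD" "L' = L" "j = card (junk DD L (F - {e})) + 1" using mv by (auto simp: j_def)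
      have mm: "m \<le> m2" using m' by (simp add: m_def m2_def)
      show ?thesis
      proof (cases "b \<le> card (junk DD' L' (F - {e}))")
        case True
        then have "slack t j = 0" using eq tb by (simp add: slack_def)
        then have "(4 * m + slack t j) * b \<le> (4 * m2 + slack t j2) * b"
          using mm by (intro mult_right_mono) auto
        then show ?thesis using True re eq by simp
      next
        case False
        then have j2: "j2 = (j - 1) mod t" using re eq by (simp add: j2_def)
        \<comment> \<open>Either the junk was below \<open>t\<close> and Avoider took one edge of
          it, or the slack was zero and becomes positive. This pays for the at most \<open>b\<close>
          pairs given up.\<close>
        have "slack t j + 1 \<le> slack t j2"
        proof (cases "j < t")
          case True
          then have "j2 = j - 1" "1 \<le> j" using j2 eq by auto
          then show ?thesis using True unfolding slack_def by auto
        next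
          case False
          have "j2 < t" using j2 t(2) by simp
          then show ?thesis using False unfolding slack_def by auto
        qed
        then have "(4 * m + slack t j + 1) * b \<le> (4 * m2 + slack t j2) * b"
          using mm by (intro mult_right_mono) auto
        then show ?thesis using False re eq by (simp add: add_mult_distrib)
      qed
    qed
    then have budget: "L0 \<le> card L'' + (4 * m2 + slack t j2) * b"
      using less.prems(4) by (simp add: m_def j_def)
    have smaller: "card (F - {e} - B) < card F"
      using e finF by (intro psubset_card_mono) auto
    have "forces b ?Q (insert e A) (F - {e} - B)"
    proof (cases "m2 < M \<and> (\<forall>Z\<in>\<pi>. 8 * card (touched DD' (insert e A) Z) \<le> cnt DD0 Z)")
      case True
      then show ?thesis
        using less.hyps[OF smaller v''] budget by (simp add: m2_def j2_def)
    next
      case False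
      moreover have "8 * card (touched DD' (insert e A) Z) \<le> cnt DD0 Z + 8" if "Z \<in> \<pi>" for Z
        using less.prems(3) that T'[rule_format, of Z] by fastforce
      ultimately have "stopped M DD' (insert e A)"
        unfolding stopped_def m2_def by (auto simp: not_less not_le intro: less_imp_le)
      then show ?thesis using v'' by (intro forces.now) blast
    qed
    then show "\<exists>B\<subseteq>F - {e}. card B = b \<and> forces b ?Q (insert e A) (F - {e} - B)"
      using B by blast
  qed
qed

end

section \<open>Selecting the pieces to keep after a phase\<close>

lemma forces_mono:
  assumes "forces b Q A F" and "\<And>A F. Q A F \<Longrightarrow> Q' A F"
  shows "forces b Q' A F"
  using assms(1)
proof induction
  case (now A F)
  then show ?case using assms(2) by (intro forces.now)
next
  case (round F A)
  then show ?case by (intro forces.round) auto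
qed

lemma large_fibre:
  assumes "finite S" "S \<noteq> {}" "finite K" "f ` S \<subseteq> K"
  shows "\<exists>x\<in>S. card S \<le> card K * card {y \<in> S. f y = f x}"
proof (rule ccontr)
  assume neg: "\<not> ?thesis"
  have K: "0 < card K" using assms by (metis card_gt_0_iff empty_subsetI image_is_empty subset_antisym)
  have "card K * card S = card K * (\<Sum>z\<in>f ` S. card {y \<in> S. f y = z})"
    using sum.image_gen[OF assms(1), of "\<lambda>_. 1::nat" f] by simp
  also have "\<dots> = (\<Sum>z\<in>f ` S. card K * card {y \<in> S. f y = z})" by (rule sum_distrib_left)
  also have "\<dots> < (\<Sum>z\<in>f ` S. card S)"
    using neg assms by (intro sum_strict_mono) auto
  also have "\<dots> \<le> card K * card S"
    using card_mono[OF assms(3,4)] by simp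
  finally show False by simp
qed

context board
begin

text \<open>A type is a label set together with the edges of \<open>H\<close> acquired in the phase.
  The factor 8 comes from the stopping rule, \<open>card E + 1\<close> from the fact that one piece
  gains at most \<open>card E\<close> edges.\<close>

definition types :: nat where
  "types = 8 * (card E + 1) * (2 ^ card V * 2 ^ card E)"

text \<open>\<open>CC\<close> consists of the blocks fused into one. It is a singleton if the chosen
  pieces have only acquired an edge inside a block, that is, have closed a cycle. The clause on
  links is vacuous exactly then.\<close>

definition phase_result ::
    "nat \<Rightarrow> 'a set set \<Rightarrow> 'a set set \<Rightarrow> nat set set \<Rightarrow> nat set set \<Rightarrow> nat set set \<Rightarrow>
      'a set set \<Rightarrow> 'a set set \<Rightarrow> nat set set \<Rightarrow> bool" where
  "phase_result M \<pi> U DD A F CC U' DD' \<longleftrightarrow>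
     CC \<subseteq> \<pi> \<and> CC \<noteq> {} \<and> U' \<subset> U \<and> position (insert (\<Union>CC) (\<pi> - CC)) U' DD' A F \<and>
     card (E - U) + card \<pi> \<le> card (E - U') + card (insert (\<Union>CC) (\<pi> - CC)) \<and>
     (\<forall>Z\<in>CC. CC \<noteq> {Z} \<longrightarrow> (\<exists>Z'\<in>CC. Z' \<noteq> Z \<and> links U Z Z' \<noteq> {})) \<and>
     (\<forall>Z\<in>\<pi> - CC. cnt DD Z \<le> 4 * cnt DD' Z) \<and>
     (M \<le> types * cnt DD' (\<Union>CC) \<or> (\<exists>Z\<in>CC. cnt DD Z \<le> types * cnt DD' (\<Union>CC)))"

end

context phase
begin

lemma card_gained_le:
  assumes v: "valid DD L A F"
  shows "card (gained DD A) \<le> card {D \<in> DD. inner U D \<inter> A \<noteq> {}} * card E"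
proof -
  let ?S = "{D \<in> DD. inner U D \<inter> A \<noteq> {}}"
  have fin: "finite ?S" using finite_DD[OF v] by simp
  have "gained DD A \<subseteq> (\<Union>D\<in>?S. inner U D)" by (auto simp: gained_def)
  then have "card (gained DD A) \<le> card (\<Union>D\<in>?S. inner U D)"
    using fin finite_inner pieceD(4)[OF validD(4)[OF v]] by (intro card_mono) auto
  also have "\<dots> \<le> (\<Sum>D\<in>?S. card (inner U D))" by (rule card_UN_le[OF fin])
  also have "\<dots> \<le> (\<Sum>D\<in>?S. card E)"
  proof (rule sum_mono)
    fix D assume "D \<in> ?S"
    then have inj: "inj_on lab D" using pieceD(3)[OF validD(4)[OF v]] by auto
    have "inj_on ((`) lab) (inner U D)"
      using inj_on_image_Pow[OF inj] by (rule inj_on_subset) (auto simp: inner_def)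
    then show "card (inner U D) \<le> card E"
      using UE finite_E by (intro card_inj_on_le[of "(`) lab"]) (auto simp: inner_def)
  qed
  finally show ?thesis by simp
qed

text \<open>Labels are injective on a piece, so it absorbs at most one original piece with label set
  \<open>Z\<close>.\<close>

lemma cnt_le_containing:
  assumes v: "valid DD L A F" and Z: "Z \<in> \<pi>"
  shows "cnt DD0 Z \<le> card {D \<in> DD. Z \<subseteq> lab ` D}"
proof -
  let ?S = "{D0 \<in> DD0. lab ` D0 = Z}"
  have "\<forall>D0\<in>?S. \<exists>D\<in>DD. D0 \<subseteq> D" using v by (auto simp: valid_def)
  then obtain f where f: "\<And>D0. D0 \<in> ?S \<Longrightarrow> f D0 \<in> DD \<and> D0 \<subseteq> f D0" by metis
  have "inj_on f ?S"
  proof (rule inj_onI)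
    fix P Q assume PQ: "P \<in> ?S" "Q \<in> ?S" "f P = f Q"
    have inj: "inj_on lab (f P)" using pieceD(3)[OF validD(4)[OF v]] f[OF PQ(1)] by blast
    have "lab ` P = lab ` Q" using PQ by simp
    then show "P = Q"
      using f[OF PQ(1)] f[OF PQ(2)] PQ(3) inj_on_image_eq_iff[OF inj, of P Q] by simp
  qed
  then show ?thesis
    unfolding cnt_def using f finite_DD[OF v] by (intro card_inj_on_le[of f]) auto
qed

text \<open>By pigeonhole many touched pieces have the same type; all other touched pieces are
  dropped, as are untouched ones inside \<open>C\<close> or belonging to \<open>X1\<close> or
  \<open>Y1\<close>. Any conflict left would be between two pieces with label set \<open>C\<close>,
  so all edges between differently labelled survivors are still free.\<close>

lemma stopped_position:
  assumes v: "valid DD L A F" and st: "stopped M DD A" and big: "\<forall>Z\<in>\<pi>. 16 \<le> cnt DD0 Z"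
    and M: "0 < M" and half: "2 * card X1 \<le> cnt DD0 X" "2 * card Y1 \<le> cnt DD0 Y"
  shows "\<exists>CC U' DD'. phase_result M \<pi> U DD0 A F CC U' DD'"
proof -
  have fDD: "finite DD" using finite_DD[OF v] .
  define cl where "cl D = (`) lab ` (inner U D \<inter> A)" for D
  define tau where "tau D = (lab ` D, cl D)" for D
  define K where "K = Pow V \<times> Pow E"
  have K: "finite K" "card K = 2 ^ card V * 2 ^ card E"
    using finite_V finite_E by (auto simp: K_def card_cartesian_product card_Pow)
  define TS where "TS = {D \<in> DD. inner U D \<inter> A \<noteq> {}}"
  have TS: "finite TS" using fDD by (simp add: TS_def)
  have tauK: "tau ` TS \<subseteq> K"
    using pieceD(5)[OF validD(4)[OF v]] UE by (auto simp: K_def tau_def cl_def TS_def inner_def)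
  have "\<exists>S\<subseteq>TS. S \<noteq> {} \<and> (M \<le> 8 * (card E + 1) * card S \<or>
      (\<exists>Z\<in>\<pi>. (\<forall>D\<in>S. Z \<subseteq> lab ` D) \<and> cnt DD0 Z \<le> 8 * (card E + 1) * card S))"
  proof (cases "M \<le> card (gained DD A)")
    case True
    then have "M \<le> card TS * card E" using card_gained_le[OF v] by (simp add: TS_def)
    moreover have "TS \<noteq> {}" using calculation M by auto
    moreover have "card TS * card E \<le> 8 * (card E + 1) * card TS" by simp
    ultimately have "M \<le> 8 * (card E + 1) * card TS" by linarith
    then show ?thesis using \<open>TS \<noteq> {}\<close> by blast
  next
    case False
    then obtain Z where Z: "Z \<in> \<pi>" "cnt DD0 Z \<le> 8 * card (touched DD A Z)"
      using st by (auto simp: stopped_def)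
    have "16 \<le> cnt DD0 Z" using big Z(1) by blast
    then have "card (touched DD A Z) \<noteq> 0" using Z(2) by linarith
    then have "touched DD A Z \<noteq> {}" by auto
    moreover have "8 * card (touched DD A Z) \<le> 8 * (card E + 1) * card (touched DD A Z)" by simp
    then have "cnt DD0 Z \<le> 8 * (card E + 1) * card (touched DD A Z)" using Z(2) by linarith
    moreover have "touched DD A Z \<subseteq> TS" "\<forall>D\<in>touched DD A Z. Z \<subseteq> lab ` D"
      by (auto simp: touched_def TS_def)
    ultimately show ?thesis using Z(1) by blast
  qed
  then obtain S where S: "S \<subseteq> TS" "S \<noteq> {}"
    and S8: "M \<le> 8 * (card E + 1) * card S \<or>
      (\<exists>Z\<in>\<pi>. (\<forall>D\<in>S. Z \<subseteq> lab ` D) \<and> cnt DD0 Z \<le> 8 * (card E + 1) * card S)" by blast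
  have fS: "finite S" using S TS finite_subset by blast
  have "tau ` S \<subseteq> K" using tauK S by blast
  then obtain D1 where D1: "D1 \<in> S" "card S \<le> card K * card {D \<in> S. tau D = tau D1}"
    using large_fibre[OF fS S(2) K(1)] by blast
  have D1': "D1 \<in> DD" "inner U D1 \<inter> A \<noteq> {}" using D1(1) S(1) by (auto simp: TS_def)
  note p1 = validD(4)[OF v D1'(1)]
  define C where "C = lab ` D1"
  define Ls where "Ls = cl D1"
  define CC where "CC = blocks D1"
  have CV: "C \<subseteq> V" "C \<noteq> {}" using pieceD(1,5)[OF p1] by (auto simp: C_def)
  have sat: "Z \<subseteq> C \<or> Z \<inter> C = {}" if "Z \<in> \<pi>" for Z using pieceD(6)[OF p1 that] by (simp add: C_def)
  have CC: "CC = {Z \<in> \<pi>. Z \<subseteq> C}" by (simp add: CC_def blocks_def C_def)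
  have UC: "\<Union>CC = C"
  proof
    show "C \<subseteq> \<Union>CC"
    proof
      fix x assume x: "x \<in> C"
      then obtain Z where "Z \<in> \<pi>" "x \<in> Z" using CV part by (auto simp: partition_on_def)
      then show "x \<in> \<Union>CC" using sat[of Z] x CC by blast
    qed
  qed (auto simp: CC)
  have CCne: "CC \<noteq> {}" using UC CV by auto
  have outside: "Z \<inter> C = {}" if "Z \<in> \<pi> - CC" for Z using that sat[of Z] by (auto simp: CC)
  have C_notin: "C \<notin> \<pi> - CC" using outside[of C] CV by auto
  have Ls: "Ls \<subseteq> U" "Ls \<noteq> {}" using D1' by (auto simp: Ls_def cl_def inner_def)
  have LsC: "g \<subseteq> C" if "g \<in> Ls" for g using that by (auto simp: Ls_def cl_def inner_def C_def)
  define U' where "U' = U - Ls"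
  have U': "U' \<subset> U" using Ls by (auto simp: U'_def)
  have EU': "E - U' = (E - U) \<union> Ls" using Ls UE by (auto simp: U'_def)
  define \<pi>' where "\<pi>' = insert C (\<pi> - CC)"
  have part': "partition_on V \<pi>'"
    unfolding partition_on_def
  proof (intro conjI)
    have "\<Union>\<pi>' = \<Union>CC \<union> \<Union>(\<pi> - CC)" by (simp add: \<pi>'_def UC)
    also have "\<dots> = \<Union>\<pi>" using CC by auto
    finally show "\<Union>\<pi>' = V" using part by (simp add: partition_on_def)
    show "disjoint \<pi>'"
      using outside block_disj unfolding disjoint_def \<pi>'_def by (auto simp: Int_commute)
    show "{} \<notin> \<pi>'" using CV part by (auto simp: \<pi>'_def partition_on_def)
  qed
  have card_CC: "card CC \<le> card Ls + 1"
  proof -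
    have "inj_on ((`) lab) (inner U D1 \<inter> A)"
      using inj_on_image_Pow[OF pieceD(3)[OF p1]] by (rule inj_on_subset) (auto simp: inner_def)
    then have "card Ls = card (inner U D1 \<inter> A)" by (simp add: Ls_def cl_def card_image)
    then show ?thesis using pieceD(10)[OF p1] by (simp add: CC_def)
  qed
  have cardE: "card (E - U') = card (E - U) + card Ls"
    unfolding EU' using finite_E Ls(1) UE by (intro card_Un_disjoint) (auto intro: finite_subset)
  have "card \<pi>' = card (\<pi> - CC) + 1" using finite_pi C_notin by (simp add: \<pi>'_def)
  moreover have "card (\<pi> - CC) + card CC = card \<pi>"
    using finite_pi CC by (metis (no_types, lifting) add.commute card_Diff_subset card_mono finite_subset
        le_add_diff_inverse mem_Collect_eq subsetI)
  ultimately have count: "card (E - U) + card \<pi> \<le> card (E - U') + card \<pi>'"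
    using card_CC cardE by linarith
  define DC where "DC = {D \<in> DD. tau D = tau D1}"
  define DU where "DU = {D \<in> DD. inner U D \<inter> A = {} \<and> lab ` D \<inter> C = {} \<and> D \<notin> X1 \<and> D \<notin> Y1}"
  have DC: "D \<in> DD" "lab ` D = C" "cl D = Ls" if "D \<in> DC" for D
    using that by (auto simp: DC_def tau_def C_def Ls_def)
  have DU: "D \<in> DD" "D \<in> DD0" "lab ` D \<in> \<pi>" "lab ` D \<in> \<pi> - CC" if "D \<in> DU" for D
  proof -
    show d: "D \<in> DD" "D \<in> DD0" using that pieceD(7)[OF validD(4)[OF v]] by (auto simp: DU_def)
    then show "lab ` D \<in> \<pi>" using pos by (auto simp: position_def)
    moreover have "lab ` D \<noteq> {}" using base_ne[OF d(2)] by simp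
    ultimately show "lab ` D \<in> \<pi> - CC" using that by (auto simp: DU_def CC)
  qed
  define DD' where "DD' = DC \<union> DU"
  have DD'_sub: "DD' \<subseteq> DD" by (auto simp: DD'_def DC_def DU_def)
  have lab_pi': "lab ` D \<in> \<pi>'" if "D \<in> DD'" for D
    using that DC(2)[of D] DU(4)[of D] by (auto simp: DD'_def \<pi>'_def)
  have inC: "inner (E - U') D \<subseteq> A \<and> inner U' D \<subseteq> F" if D: "D \<in> DC" for D
  proof -
    note p = validD(4)[OF v DC(1)[OF D]]
    have "e \<in> A" if "e \<in> inner (E - U') D" for e
    proof (cases "lab ` e \<in> Ls")
      case True
      then obtain e' where e': "e' \<in> inner U D \<inter> A" "lab ` e = lab ` e'"
        using DC(3)[OF D] by (auto simp: cl_def)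
      then have "e = e'"
        using that inj_on_image_eq_iff[OF pieceD(3)[OF p], of e e'] by (auto simp: inner_def)
      then show ?thesis using e' by simp
    next
      case False
      then have "e \<in> inner (E - U) D" using that EU' by (auto simp: inner_def)
      then show ?thesis using pieceD(8)[OF p] by blast
    qed
    moreover have "e \<in> F" if "e \<in> inner U' D" for e
    proof -
      have e: "e \<in> inner U D" "lab ` e \<notin> Ls" using that by (auto simp: inner_def U'_def)
      then have "e \<notin> A" using DC(3)[OF D] by (auto simp: cl_def)
      then show ?thesis using pieceD(9)[OF p] e(1) by blast
    qed
    ultimately show ?thesis by blast
  qed
  have inU: "inner (E - U') D \<subseteq> A \<and> inner U' D \<subseteq> F" if D: "D \<in> DU" for D
  proof -
    note p = validD(4)[OF v DU(1)[OF D]]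
    have d: "inner U D \<inter> A = {}" "lab ` D \<inter> C = {}" using D by (auto simp: DU_def)
    have "e \<in> A" if "e \<in> inner (E - U') D" for e
    proof -
      have e: "lab ` e \<in> E - U'" "e \<subseteq> D" using that by (auto simp: inner_def)
      then have "lab ` e \<noteq> {}" using edgeD[of "lab ` e"] by auto
      then have "lab ` e \<notin> Ls" using LsC[of "lab ` e"] e(2) d(2) by blast
      then have "e \<in> inner (E - U) D" using that EU' by (auto simp: inner_def)
      then show ?thesis using pieceD(8)[OF p] by blast
    qed
    moreover have "inner U' D \<subseteq> F"
      using pieceD(9)[OF p] d(1) U' unfolding inner_def by blast
    ultimately show ?thesis by blast
  qed
  have avoid: "D \<in> DC" if DW: "D \<in> DD'" "D \<inter> \<Union>W \<noteq> {}" "W = X1 \<or> W = Y1" for D W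
  proof (rule ccontr)
    assume "D \<notin> DC"
    then have D: "D \<in> DU" using DW by (auto simp: DD'_def)
    obtain P where P: "P \<in> W" "D \<inter> P \<noteq> {}" using DW(2) by blast
    have "P \<in> DD0" using P(1) DW(3) X1 Y1 by auto
    then have "D = P" using base_disj[OF DU(2)[OF D]] P(2) by blast
    then show False using D P(1) DW(3) by (auto simp: DU_def)
  qed
  have cr: "cross U' D D' \<subseteq> F" if DD: "D \<in> DD'" "D' \<in> DD'" "lab ` D \<noteq> lab ` D'" for D D'
  proof -
    have "lab ` D \<inter> lab ` D' = {}"
      using part' lab_pi'[OF DD(1)] lab_pi'[OF DD(2)] DD(3) by (auto simp: partition_on_def disjoint_def)
    moreover have "\<not> conflict D D'"
    proof
      assume "conflict D D'"
      then have "D \<in> DC" "D' \<in> DC" using avoid[OF DD(1)] avoid[OF DD(2)] unfolding conflict_def by metis+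
      then show False using DC(2) DD(3) by simp
    qed
    ultimately have "compat L D D'" by (simp add: compat_def)
    then have "cross U D D' \<subseteq> F"
      using validD(5)[OF v] DD DD'_sub unfolding connecting_def by blast
    moreover have "cross U' D D' \<subseteq> cross U D D'" using U' by (auto simp: cross_def)
    ultimately show ?thesis by blast
  qed
  have pos': "position \<pi>' U' DD' A F"
    unfolding position_def
  proof (intro conjI ballI impI)
    show "U' \<subseteq> E" using U' UE by auto
    show "\<exists>Z\<in>\<pi>'. g \<subseteq> Z" if g: "g \<in> E - U'" for g
    proof (cases "g \<in> Ls")
      case True
      then show ?thesis using LsC by (auto simp: \<pi>'_def)
    next
      case False
      then obtain Z where Z: "Z \<in> \<pi>" "g \<subseteq> Z" using claimed_in_block[of g] g EU' by auto
      then show ?thesis by (cases "Z \<in> CC") (auto simp: \<pi>'_def CC)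
    qed
    show "card V \<le> card (E - U') + card \<pi>'" using count pos by (auto simp: position_def)
    show "\<Union>DD' \<subseteq> {..<n}" using DD'_sub pieceD(2)[OF validD(4)[OF v]] by blast
    show "disjoint DD'"
      unfolding disjoint_def using valid_disj[OF v] DD'_sub by (meson subsetD)
    show "inj_on lab D" "lab ` D \<in> \<pi>'" "inner (E - U') D \<subseteq> A" "inner U' D \<subseteq> F" if "D \<in> DD'" for D
    proof -
      have "D \<in> DD" using that DD'_sub by blast
      then show "inj_on lab D" by (rule pieceD(3)[OF validD(4)[OF v]])
      show "lab ` D \<in> \<pi>'" by (rule lab_pi'[OF that])
      have "inner (E - U') D \<subseteq> A \<and> inner U' D \<subseteq> F"
        using that inC[of D] inU[of D] unfolding DD'_def by blast
      then show "inner (E - U') D \<subseteq> A" "inner U' D \<subseteq> F" by simp_all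
    qed
  qed (use part' validD(1,2,3)[OF v] cr in auto)
  have fDD': "finite DD'" using DD'_sub fDD finite_subset by blast
  have "card {D \<in> S. tau D = tau D1} \<le> cnt DD' C"
    unfolding cnt_def using S fDD' by (intro card_mono) (auto simp: TS_def DD'_def DC_def tau_def C_def)
  then have "card S \<le> card K * cnt DD' C" using D1(2) by (meson le_trans mult_le_mono2)
  then have "8 * (card E + 1) * card S \<le> types * cnt DD' C"
    unfolding types_def K(2) mult.assoc by (intro mult_le_mono2) (simp only: mult.assoc)
  note S_le = this
  have res: "M \<le> types * cnt DD' C \<or> (\<exists>Z\<in>CC. cnt DD0 Z \<le> types * cnt DD' C)"
    using S8
  proof
    assume "\<exists>Z\<in>\<pi>. (\<forall>D\<in>S. Z \<subseteq> lab ` D) \<and> cnt DD0 Z \<le> 8 * (card E + 1) * card S"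
    then obtain Z where Z: "Z \<in> \<pi>" "\<forall>D\<in>S. Z \<subseteq> lab ` D" "cnt DD0 Z \<le> 8 * (card E + 1) * card S"
      by blast
    have "Z \<in> CC" using Z(1,2) D1(1) by (simp add: CC C_def)
    moreover have "cnt DD0 Z \<le> types * cnt DD' C"
      using Z(3) S_le by (rule order_trans)
    ultimately show ?thesis by blast
  qed (use S_le in linarith)
  \<comment> \<open>At most an eighth of the pieces plus one were touched and at most half lay in
    \<open>X1\<close> or \<open>Y1\<close>. What remains is at least 3/8 minus one, which is at
    least a quarter since the count is at least 16.\<close>
  have keep: "cnt DD0 Z \<le> 4 * cnt DD' Z" if Z: "Z \<in> \<pi> - CC" for Z
  proof -
    have ZC: "Z \<inter> C = {}" "Z \<in> \<pi>" using outside[OF Z] Z by auto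
    define N where "N = {D \<in> DD. lab ` D = Z \<and> inner U D \<inter> A = {}}"
    have "{D \<in> DD. Z \<subseteq> lab ` D} \<subseteq> touched DD A Z \<union> N"
    proof
      fix D assume D: "D \<in> {D \<in> DD. Z \<subseteq> lab ` D}"
      show "D \<in> touched DD A Z \<union> N"
      proof (cases "inner U D \<inter> A = {}")
        case True
        have "piece A F D" using D validD(4)[OF v] by simp
        then have "D \<in> DD0" using True pieceD(7) by blast
        then have "lab ` D \<in> \<pi>" using pos by (auto simp: position_def)
        then have "lab ` D = Z" using D ZC(2) block_disj[of "lab ` D" Z] block_ne[of Z] by blast
        then show ?thesis using D True by (auto simp: N_def)
      qed (use D in \<open>auto simp: touched_def\<close>)
    qed
    then have "card {D \<in> DD. Z \<subseteq> lab ` D} \<le> card (touched DD A Z \<union> N)"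
      using fDD by (intro card_mono) (auto simp: touched_def N_def)
    also have "\<dots> \<le> card (touched DD A Z) + card N" by (rule card_Un_le)
    finally have "cnt DD0 Z \<le> card (touched DD A Z) + card N"
      using cnt_le_containing[OF v ZC(2)] by linarith
    moreover have "card N \<le> cnt DD' Z + cnt DD0 Z div 2"
    proof -
      define W where "W = (if Z = X then X1 else if Z = Y then Y1 else {})"
      have fW: "finite W"
        using X1 Y1 fDD pos finite_UnionD[of DD0] finite_subset[of "\<Union>DD0" "{..<n}"]
        unfolding W_def position_def by (auto intro: finite_subset)
      have "N \<subseteq> {D \<in> DD'. lab ` D = Z} \<union> W"
        using ZC(1) X1 Y1 XY(3) by (auto simp: N_def DD'_def DU_def W_def)
      then have "card N \<le> card ({D \<in> DD'. lab ` D = Z} \<union> W)"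
        using fDD' fW by (intro card_mono) auto
      also have "\<dots> \<le> cnt DD' Z + card W" unfolding cnt_def by (rule card_Un_le)
      also have "card W \<le> cnt DD0 Z div 2" using half unfolding W_def by auto
      finally show ?thesis by simp
    qed
    moreover have "8 * card (touched DD A Z) \<le> cnt DD0 Z + 8" using st ZC(2) by (auto simp: stopped_def)
    moreover have "16 \<le> cnt DD0 Z" using big ZC(2) by blast
    ultimately show ?thesis by linarith
  qed
  have conn: "\<exists>Z'\<in>CC. Z' \<noteq> Z \<and> links U Z Z' \<noteq> {}" if Z: "Z \<in> CC" "CC \<noteq> {Z}" for Z
  proof -
    have "lab ` D1 \<noteq> Z"
    proof
      assume "lab ` D1 = Z"
      then have "W = Z" if "W \<in> CC" for W
        using that Z(1) block_disj[of W Z] block_ne[of W] by (auto simp: CC C_def)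
      then show False using Z by blast
    qed
    then show ?thesis using pieceD(11)[OF p1] Z(1) by (simp add: CC_def)
  qed
  have "phase_result M \<pi> U DD0 A F CC U' DD'"
    unfolding phase_result_def UC
    using CCne U' pos' count res keep conn by (auto simp: \<pi>'_def CC)
  then show ?thesis by blast
qed

end

context board
begin

lemma phase_round:
  assumes pos: "position \<pi> U DD A F" and XY: "X \<in> \<pi>" "Y \<in> \<pi>" "X \<noteq> Y"
    and t: "0 < card (links U X Y)" "card (links U X Y) \<le> 2" "card (links U X Y) dvd b"
    and b: "4 * n \<le> b" "0 < b" and big: "\<forall>Z\<in>\<pi>. 16 \<le> cnt DD Z"
    and M: "0 < M" "108 * M * b \<le> cnt DD X * cnt DD Y"
  shows "forces b (\<lambda>A F. \<exists>CC U' DD'. phase_result M \<pi> U DD A F CC U' DD') A F"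
proof -
  have "finite DD" using pos unfolding position_def by (metis finite_UnionD finite_lessThan finite_subset)
  obtain X1 where x1: "X1 \<subseteq> {D \<in> DD. lab ` D = X}" "card X1 = cnt DD X div 2"
    by (rule obtain_subset_with_card_n[of "cnt DD X div 2" "{D \<in> DD. lab ` D = X}"])
      (simp_all add: cnt_def)
  obtain Y1 where y1: "Y1 \<subseteq> {D \<in> DD. lab ` D = Y}" "card Y1 = cnt DD Y div 2"
    by (rule obtain_subset_with_card_n[of "cnt DD Y div 2" "{D \<in> DD. lab ` D = Y}"])
      (simp_all add: cnt_def)
  interpret phase V E n lab \<pi> U DD X1 Y1 A F X Y
    using pos XY x1 y1 by unfold_locales auto
  have no: "inner U D \<inter> A = {}" if "D \<in> DD" for D
  proof -
    have "inner U D \<subseteq> F" "A \<inter> F = {}" using pos that by (auto simp: position_def)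
    then show ?thesis by blast
  qed
  have g: "gained DD A = {}" using no by (auto simp: gained_def)
  have tc: "touched DD A Z = {}" for Z using no by (auto simp: touched_def)
  have "16 \<le> cnt DD X" "16 \<le> cnt DD Y" using big XY by auto
  \<comment> \<open>Halving with rounding costs at most a factor 3 on each side. So 108 = 9 * 12
    provides \<open>12 * M * b\<close> pairs, which covers the required
    \<open>(4 * M + 8) * b\<close>.\<close>
  then have "cnt DD X \<le> 3 * card X1" "cnt DD Y \<le> 3 * card Y1" using x1(2) y1(2) by linarith+
  then have "cnt DD X * cnt DD Y \<le> (3 * card X1) * (3 * card Y1)" by (intro mult_le_mono)
  then have "108 * M * b \<le> 9 * (card X1 * card Y1)" using M(2) by simp
  moreover have "(4 * M + 8) * b \<le> 12 * M * b" using M(1) by (intro mult_right_mono) auto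
  ultimately have L0: "(4 * M + 8) * b \<le> card (X1 \<times> Y1)"
    unfolding card_cartesian_product by linarith
  have "forces b (\<lambda>A F. \<exists>DD' L. valid DD' L A F \<and> stopped M DD' A) A F"
    by (rule forces_stopped[OF refl t b L0 valid_start]) (use M(1) in \<open>simp_all add: g tc\<close>)
  then show ?thesis
    by (rule forces_mono) (elim exE conjE, rule stopped_position[OF _ _ big M(1)], use x1(2) y1(2) in simp_all)
qed

section \<open>Counting blocks\<close>

lemma positionD:
  assumes "position \<pi> U DD A F"
  shows "partition_on V \<pi>" "U \<subseteq> E" "g \<in> E - U \<Longrightarrow> \<exists>Z\<in>\<pi>. g \<subseteq> Z"
    "card V \<le> card (E - U) + card \<pi>" "finite A" "finite F" "A \<inter> F = {}" "\<Union>DD \<subseteq> {..<n}" "disjoint DD"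
    "D \<in> DD \<Longrightarrow> inj_on lab D" "D \<in> DD \<Longrightarrow> lab ` D \<in> \<pi>" "D \<in> DD \<Longrightarrow> inner (E - U) D \<subseteq> A"
    "D \<in> DD \<Longrightarrow> inner U D \<subseteq> F"
    "D \<in> DD \<Longrightarrow> D' \<in> DD \<Longrightarrow> lab ` D \<noteq> lab ` D' \<Longrightarrow> cross U D D' \<subseteq> F"
  using assms unfolding position_def by auto

lemma blockD:
  assumes "partition_on V \<pi>"
  shows "Z \<in> \<pi> \<Longrightarrow> Z \<noteq> {}" "Z \<in> \<pi> \<Longrightarrow> Z \<subseteq> V" "Z \<in> \<pi> \<Longrightarrow> Z' \<in> \<pi> \<Longrightarrow> Z \<noteq> Z' \<Longrightarrow> Z \<inter> Z' = {}"
    "finite \<pi>" "Z \<in> \<pi> \<Longrightarrow> finite Z" "x \<in> V \<Longrightarrow> \<exists>Z\<in>\<pi>. x \<in> Z"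
  using assms finite_V finite_elements[OF finite_V assms]
  by (auto simp: partition_on_def disjoint_def intro: finite_subset)

text \<open>Some edge of \<open>H\<close> leaves the union of \<open>CC\<close>. It is contained in
  no block, so no piece can have acquired it.\<close>

lemma linked_blocks:
  assumes con: "connected_graph V E" and pos: "position \<pi> U DD A F"
    and CC: "CC \<subseteq> \<pi>" "CC \<noteq> {}" "CC \<noteq> \<pi>"
  shows "\<exists>Y\<in>CC. \<exists>W\<in>\<pi> - CC. links U Y W \<noteq> {}"
proof -
  note part = positionD(1)[OF pos]
  obtain Y0 W0 where YW: "Y0 \<in> CC" "W0 \<in> \<pi>" "W0 \<notin> CC" using CC by blast
  then obtain s t where st: "s \<in> Y0" "t \<in> W0" using blockD(1)[OF part] CC(1) by blast
  have "t \<notin> \<Union>CC"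
  proof
    assume "t \<in> \<Union>CC"
    then obtain Z where "Z \<in> CC" "t \<in> Z" by blast
    then show False using blockD(3)[OF part, of Z W0] YW CC(1) st by blast
  qed
  moreover have "s \<in> \<Union>CC" "s \<in> V" "t \<in> V"
    using st YW CC(1) blockD(2)[OF part, of Y0] blockD(2)[OF part, of W0] by auto
  ultimately obtain x y where xy: "x \<in> \<Union>CC" "y \<notin> \<Union>CC" "{x, y} \<in> E"
    using connected_boundary[OF con] by metis
  obtain Y where Y: "Y \<in> CC" "x \<in> Y" using xy by blast
  have "y \<in> V" using edgeD[OF xy(3)] by simp
  then obtain W where W: "W \<in> \<pi>" "y \<in> W" using blockD(6)[OF part] by blast
  have "W \<notin> CC" using W xy by blast
  have "{x, y} \<in> U"
  proof (rule ccontr)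
    assume "{x, y} \<notin> U"
    then obtain Z where Z: "Z \<in> \<pi>" "{x, y} \<subseteq> Z" using positionD(3)[OF pos] xy(3) by blast
    then have "Z = Y" using blockD(3)[OF part, of Z Y] Y CC(1) by blast
    then show False using Z Y xy by blast
  qed
  then have "{x, y} \<in> links U Y W" using Y W by (simp add: links_def)
  then show ?thesis using Y(1) W(1) \<open>W \<notin> CC\<close> by blast
qed

text \<open>Contracting the blocks gives a connected graph \<open>Q\<close>, and each of its edges
  comes from an edge of \<open>U0\<close>. The subset \<open>U0\<close> allows parallel edges to be
  thinned out first.\<close>

lemma block_count:
  assumes con: "connected_graph V E" and pos: "position \<pi> U DD A F" and U0: "U0 \<subseteq> U"
    and l: "\<And>Z Z'. Z \<in> \<pi> \<Longrightarrow> Z' \<in> \<pi> \<Longrightarrow> Z \<noteq> Z' \<Longrightarrow> links U Z Z' \<noteq> {} \<Longrightarrow> links U0 Z Z' \<noteq> {}"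
  shows "card \<pi> \<le> card U0 + 1"
proof -
  note part = positionD(1)[OF pos]
  have fU: "finite U0" using U0 positionD(2)[OF pos] finite_E by (meson finite_subset)
  define h where "h g = {Z \<in> \<pi>. Z \<inter> g \<noteq> {}}" for g
  define Q where "Q = {{Z, Z'} | Z Z'. Z \<in> \<pi> \<and> Z' \<in> \<pi> \<and> Z \<noteq> Z' \<and> links U0 Z Z' \<noteq> {}}"
  have QU: "Q \<subseteq> h ` U0"
  proof
    fix q assume "q \<in> Q"
    then obtain Z Z' g where q: "q = {Z, Z'}" "Z \<in> \<pi>" "Z' \<in> \<pi>" "Z \<noteq> Z'" "g \<in> links U0 Z Z'"
      by (auto simp: Q_def)
    obtain x y where xy: "x \<in> g" "x \<in> Z" "y \<in> g" "y \<in> Z'" "g \<in> U0" using q(5) by (auto simp: links_def)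
    have "x \<noteq> y" using blockD(3)[OF part q(2,3,4)] xy by blast
    moreover have "card g = 2" using xy(5) U0 positionD(2)[OF pos] edgeD[of g] by blast
    ultimately have g: "g = {x, y}" using xy by (auto simp: card_2_iff)
    have "W = Z \<or> W = Z'" if "W \<in> \<pi>" "W \<inter> g \<noteq> {}" for W
      using that g xy blockD(3)[OF part that(1) q(2)] blockD(3)[OF part that(1) q(3)] by blast
    then have "h g = q" using q g xy by (auto simp: h_def)
    then show "q \<in> h ` U0" using xy by blast
  qed
  then have fQ: "finite Q" "card Q \<le> card U0"
    using fU finite_subset by (blast, meson QU card_image_le card_mono finite_imageI fU order_trans)
  have conQ: "connected_graph \<pi> Q"
    unfolding connected_graph_def
  proof (intro conjI ballI)
    show "\<pi> \<noteq> {}" using part con by (auto simp: partition_on_def connected_graph_def)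
    fix Z0 W0 assume ZW: "Z0 \<in> \<pi>" "W0 \<in> \<pi>"
    define R where "R = {W \<in> \<pi>. (Z0, W) \<in> {(x, y). {x, y} \<in> Q}\<^sup>*}"
    have "R = \<pi>"
    proof (rule ccontr)
      assume "R \<noteq> \<pi>"
      moreover have "R \<subseteq> \<pi>" "R \<noteq> {}" using ZW by (auto simp: R_def)
      ultimately obtain Y W where YW: "Y \<in> R" "W \<in> \<pi> - R" "links U Y W \<noteq> {}"
        using linked_blocks[OF con pos] by metis
      then have "{Y, W} \<in> Q" using l[of Y W] unfolding Q_def R_def by blast
      then have "(Z0, W) \<in> {(x, y). {x, y} \<in> Q}\<^sup>*"
        using YW(1) unfolding R_def by (auto intro: rtrancl_into_rtrancl)
      then show False using YW(2) by (auto simp: R_def)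
    qed
    then show "(Z0, W0) \<in> {(x, y). {x, y} \<in> Q}\<^sup>*" using ZW by (auto simp: R_def)
  qed
  have "card \<pi> \<le> card Q + 1"
    using connected_edge_count[OF blockD(4)[OF part] fQ(1) conQ] by (auto simp: Q_def)
  then show ?thesis using fQ by simp
qed

text \<open>Only one of the parallel edges between \<open>X\<close> and \<open>Y\<close> is needed
  to keep the contracted graph connected. Together with the counting clause of
  \<open>position\<close> this caps them at one for trees and at two for unicyclic graphs, which
  yields the bound \<open>t \<le> 2\<close> of a phase.\<close>

lemma block_count_parallel:
  assumes con: "connected_graph V E" and pos: "position \<pi> U DD A F" and XY: "X \<in> \<pi>" "Y \<in> \<pi>" "X \<noteq> Y"
  shows "card \<pi> + card (links U X Y) \<le> card U + 2"
proof (cases "links U X Y = {}")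
  case True
  then show ?thesis using block_count[OF con pos order_refl] by simp
next
  case False
  then obtain g where g: "g \<in> links U X Y" by blast
  have part: "partition_on V \<pi>" using positionD(1)[OF pos] .
  have fU: "finite U" using positionD(2)[OF pos] finite_E by (meson finite_subset)
  define U0 where "U0 = U - (links U X Y - {g})"
  have "links U0 Z Z' \<noteq> {}" if Z: "Z \<in> \<pi>" "Z' \<in> \<pi>" "Z \<noteq> Z'" "links U Z Z' \<noteq> {}" for Z Z'
  proof -
    obtain g' where g': "g' \<in> links U Z Z'" using Z(4) by blast
    show ?thesis
    proof (cases "g' \<in> links U X Y")
      case False
      then have "g' \<in> links U0 Z Z'" using g' by (auto simp: U0_def links_def)
      then show ?thesis by blast
    next
      case True
      obtain x y where xy: "x \<in> g'" "x \<in> X" "y \<in> g'" "y \<in> Y" using True by (auto simp: links_def)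
      have "x \<noteq> y" using blockD(3)[OF part XY] xy by blast
      moreover have "card g' = 2"
        using g' positionD(2)[OF pos] edgeD[of g'] by (auto simp: links_def)
      ultimately have g'': "g' = {x, y}" using xy by (auto simp: card_2_iff)
      have "Z \<inter> {x, y} \<noteq> {}" "Z' \<inter> {x, y} \<noteq> {}" using g' g'' by (auto simp: links_def)
      then have "Z = X \<or> Z = Y" "Z' = X \<or> Z' = Y"
        using xy Z(1,2) XY blockD(3)[OF part Z(1) XY(1)] blockD(3)[OF part Z(1) XY(2)]
          blockD(3)[OF part Z(2) XY(1)] blockD(3)[OF part Z(2) XY(2)] by blast+
      then have "g \<in> links U Z Z'" using g Z(3) links_commute[of U X Y] by auto
      then have "g \<in> links U0 Z Z'" using g by (auto simp: U0_def links_def)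
      then show ?thesis by blast
    qed
  qed
  then have "card \<pi> \<le> card U0 + 1" using block_count[OF con pos, of U0] by (auto simp: U0_def)
  moreover have "card U0 + (card (links U X Y) - 1) = card U"
  proof -
    have "links U X Y \<subseteq> U" by (auto simp: links_def)
    then have fl: "finite (links U X Y)" using fU finite_subset by blast
    have "card (links U X Y - {g}) = card (links U X Y) - 1" using g fl by simp
    moreover have "card U0 = card U - card (links U X Y - {g})"
      unfolding U0_def using fl \<open>links U X Y \<subseteq> U\<close> by (intro card_Diff_subset) auto
    moreover have "card (links U X Y - {g}) \<le> card U"
      using \<open>links U X Y \<subseteq> U\<close> fU by (intro card_mono) auto
    ultimately show ?thesis by simp
  qed
  moreover have "0 < card (links U X Y)"
    using g fU by (metis (no_types, lifting) card_gt_0_iff empty_iff finite_subset links_def mem_Collect_eq subsetI)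
  ultimately show ?thesis by linarith
qed

section \<open>The end of the game\<close>

abbreviation has_copy :: "nat set set \<Rightarrow> bool" where
  "has_copy A \<equiv> contains_copy {..<n} A V E"

lemma mono_copy: "mono has_copy"
  unfolding contains_copy_def by (intro monoI le_boolI) (meson subsetD)

text \<open>The embedding of \<open>H\<close> is the inverse of the labelling on
  \<open>D\<close>.\<close>

lemma has_copyI:
  assumes "D \<subseteq> {..<n}" "inj_on lab D" "lab ` D = V" "inner E D \<subseteq> A"
  shows "has_copy A"
  unfolding contains_copy_def
proof (intro exI[of _ "inv_into D lab"] conjI ballI)
  show "inj_on (inv_into D lab) V" using assms(3) by (metis inj_on_inv_into order_refl)
  show "inv_into D lab ` V \<subseteq> {..<n}" using assms(1,3) by (metis image_subset_iff inv_into_into subsetD)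
  fix g assume "g \<in> E"
  then have g: "g \<subseteq> lab ` D" using edgeD assms(3) by blast
  then have "lab ` inv_into D lab ` g = g" by (rule image_inv_into_cancel[OF refl])
  moreover have "inv_into D lab ` g \<subseteq> D" using g by (auto intro: inv_into_into)
  ultimately have "inv_into D lab ` g \<in> inner E D" using \<open>g \<in> E\<close> by (simp add: inner_def)
  then show "inv_into D lab ` g \<in> A" using assms(4) by blast
qed

lemma wins_by_family:
  assumes I: "inj_on f I" "f ` I \<subseteq> F" "\<And>i. i \<in> I \<Longrightarrow> has_copy (insert (f i) A)"
    and F: "finite F" "card F mod Suc b = r mod Suc b" and r: "0 < r" "r \<le> card I"
  shows "wins b has_copy A F"
proof -
  obtain J where J: "J \<subseteq> I" "card J = r" using r(2) obtain_subset_with_card_n by metis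
  define T where "T = f ` J"
  have T: "card T = r" "T \<subseteq> F"
    using J I by (auto simp: T_def card_image inj_on_subset)
  then have le: "r \<le> card F" using F(1) card_mono by blast
  then have "(card F - r) mod Suc b = 0"
    using F(2) by (simp add: mod_eq_dvd_iff_nat mod_0_imp_dvd dvd_imp_mod_0 del: mod_Suc_eq)
  then obtain j where "card F - r = Suc b * j" by auto
  then have "card F = j * Suc b + card T" using le T by (simp add: mult.commute)
  moreover have "T \<noteq> {}" using T r by auto
  ultimately show ?thesis
    using T I(3) J by (intro wins_by_threats[OF mono_copy F(1)]) (auto simp: T_def)
qed

lemma wins_all_claimed:
  assumes con: "connected_graph V E" and pos: "position \<pi> {} DD A F" and c: "\<And>Z. Z \<in> \<pi> \<Longrightarrow> 0 < cnt DD Z"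
  shows "wins b has_copy A F"
proof -
  note part = positionD(1)[OF pos]
  have "V \<noteq> {}" using con by (simp add: connected_graph_def)
  then obtain Z where Z: "Z \<in> \<pi>" using part by (auto simp: partition_on_def)
  have "\<pi> = {Z}"
  proof (rule ccontr)
    assume "\<pi> \<noteq> {Z}"
    then show False using linked_blocks[OF con pos, of "{Z}"] Z by (auto simp: links_def)
  qed
  then have "Z = V" using part by (auto simp: partition_on_def)
  obtain D where D: "D \<in> DD" "lab ` D = Z"
    using c[OF Z] unfolding cnt_def card_gt_0_iff by blast
  have "inner E D \<subseteq> A" using positionD(12)[OF pos D(1)] by simp
  then have "has_copy A"
    using D positionD(8)[OF pos] positionD(10)[OF pos D(1)] \<open>Z = V\<close> by (intro has_copyI[of D]) auto
  then show ?thesis by (rule wins.now)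
qed

text \<open>The missing edge lies inside the only block, so a threat needs a single piece. There are
  only as many threats as pieces, in contrast to the bridge below, where every pair of pieces offers
  one.\<close>

lemma wins_loop_left:
  assumes pos: "position {V} {g} DD A F" and r: "0 < r" "r \<le> cnt DD V"
    and F: "card F mod Suc b = r mod Suc b"
  shows "wins b has_copy A F"
proof -
  let ?I = "{D \<in> DD. lab ` D = V}"
  have g: "g \<in> E" using positionD(2)[OF pos] by simp
  define f where "f D = inv_into D lab ` g" for D
  have f: "f D \<subseteq> D" "lab ` f D = g" "f D \<noteq> {}" if "D \<in> ?I" for D
  proof -
    have "g \<subseteq> lab ` D" using that edgeD[OF g] by auto
    then show "f D \<subseteq> D" "lab ` f D = g"
      unfolding f_def by (auto intro: inv_into_into simp: image_inv_into_cancel)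
    then show "f D \<noteq> {}" using edgeD[OF g] by auto
  qed
  have fi: "f D \<in> inner {g} D" if "D \<in> ?I" for D using f[OF that] by (simp add: inner_def)
  show ?thesis
  proof (rule wins_by_family[OF _ _ _ positionD(6)[OF pos] F r(1)])
    show "inj_on f ?I"
    proof (rule inj_onI)
      fix D D' assume D: "D \<in> ?I" "D' \<in> ?I" "f D = f D'"
      then have "D \<inter> D' \<noteq> {}" using f(1,3)[OF D(1)] f(1)[OF D(2)] by auto
      then show "D = D'" using D positionD(9)[OF pos] by (auto simp: disjoint_def)
    qed
    show "f ` ?I \<subseteq> F" using fi positionD(13)[OF pos] by blast
    show "has_copy (insert (f D) A)" if D: "D \<in> ?I" for D
    proof (rule has_copyI)
      have inj: "inj_on lab D" using positionD(10)[OF pos] D by simp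
      then show "inj_on lab D" .
      show "D \<subseteq> {..<n}" "lab ` D = V" using positionD(8)[OF pos] D by auto
      show "inner E D \<subseteq> insert (f D) A"
      proof
        fix e assume e: "e \<in> inner E D"
        show "e \<in> insert (f D) A"
        proof (cases "lab ` e = g")
          case True
          then have "e = f D"
            using e f[OF D] inj_on_image_eq_iff[OF inj, of e "f D"] by (simp add: inner_def)
          then show ?thesis by simp
        next
          case False
          then have "e \<in> inner (E - {g}) D" using e by (simp add: inner_def)
          then show ?thesis using positionD(12)[OF pos, of D] D by blast
        qed
      qed
    qed
    show "r \<le> card ?I" using r(2) by (simp add: cnt_def)
  qed
qed

lemma wins_bridge_left:
  assumes con: "connected_graph V E" and pos: "position {X, Y} {g} DD A F" and XY: "X \<noteq> Y"
    and r: "0 < r" "r \<le> cnt DD X * cnt DD Y" and F: "card F mod Suc b = r mod Suc b"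
  shows "wins b has_copy A F"
proof -
  note part = positionD(1)[OF pos]
  have XYd: "X \<inter> Y = {}" "X \<union> Y = V" using blockD(3)[OF part, of X Y] XY part by (auto simp: partition_on_def)
  have gE: "g \<in> E" using positionD(2)[OF pos] by simp
  have gl: "g \<in> links {g} X Y"
    using linked_blocks[OF con pos, of "{X}"] XY by (auto simp: links_def)
  let ?I = "{D \<in> DD. lab ` D = X} \<times> {D \<in> DD. lab ` D = Y}"
  have one: "card (cross {g} D D') = 1" if "(D, D') \<in> ?I" for D D'
  proof -
    have "links {g} X Y = {g}" using gl by (auto simp: links_def)
    then show ?thesis
      using card_cross[of D D' "{g}"] that positionD(10)[OF pos] XYd gE by auto
  qed
  define f where "f p = the_elem (cross {g} (fst p) (snd p))" for p
  have f: "cross {g} (fst p) (snd p) = {f p}" if p: "p \<in> ?I" for p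
  proof -
    have "card (cross {g} (fst p) (snd p)) = 1" using p by (intro one) simp
    then show ?thesis unfolding f_def by (metis card_1_singletonE the_elem_eq)
  qed
  show ?thesis
  proof (rule wins_by_family[OF _ _ _ positionD(6)[OF pos] F r(1)])
    show "inj_on f ?I"
    proof (rule inj_onI)
      fix p q assume pq: "p \<in> ?I" "q \<in> ?I" "f p = f q"
      have e: "f p \<in> cross {g} (fst p) (snd p)" "f p \<in> cross {g} (fst q) (snd q)"
        using f[OF pq(1)] f[OF pq(2)] pq(3) by simp_all
      have lab: "lab ` fst p = X" "lab ` snd p = Y" "lab ` fst q = X" "lab ` snd q = Y" using pq by auto
      have ne: "P \<inter> Q = {}" if "lab ` P = X" "lab ` Q = Y" for P Q
        using that XYd(1) by blast
      have "fst p \<inter> fst q \<noteq> {}"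
        using crossD(1,2)[OF e(1)] crossD(1)[OF e(2)] ne[OF lab(1) lab(4)] by blast
      moreover have "snd p \<inter> snd q \<noteq> {}"
        using crossD(3)[OF e(1)] crossD(1)[OF e(2)] ne[OF lab(3) lab(2)] by blast
      moreover have "fst p \<in> DD" "fst q \<in> DD" "snd p \<in> DD" "snd q \<in> DD" using pq(1,2) by auto
      ultimately have "fst p = fst q" "snd p = snd q"
        using positionD(9)[OF pos] unfolding disjoint_def by blast+
      then show "p = q" by (rule prod_eqI)
    qed
    show "f ` ?I \<subseteq> F"
    proof
      fix e assume "e \<in> f ` ?I"
      then obtain p where p: "p \<in> ?I" "e = f p" by blast
      have "fst p \<in> DD" "snd p \<in> DD" "lab ` fst p = X" "lab ` snd p = Y" using p(1) by auto
      then have "cross {g} (fst p) (snd p) \<subseteq> F"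
        using positionD(14)[OF pos, of "fst p" "snd p"] XY by simp
      then show "e \<in> F" using f[OF p(1)] p(2) by simp
    qed
    show "has_copy (insert (f p) A)" if p: "p \<in> ?I" for p
    proof -
      obtain D D' where D: "p = (D, D')" "D \<in> DD" "D' \<in> DD" "lab ` D = X" "lab ` D' = Y" using p by auto
      have inj: "inj_on lab (D \<union> D')"
        using disjoint_Un_labels[OF positionD(10)[OF pos D(2)] positionD(10)[OF pos D(3)]] D XYd by simp
      have un: "inner E (D \<union> D') = inner E D \<union> inner E D' \<union> cross E D D'"
        by (rule inner_Un[OF inj order_refl])
      have side: "inner E P \<subseteq> A" if "P \<in> DD" "lab ` P = X \<or> lab ` P = Y" for P
      proof
        fix e assume e: "e \<in> inner E P"
        have "g \<inter> X \<noteq> {}" "g \<inter> Y \<noteq> {}" using gl by (auto simp: links_def)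
        then have "lab ` e \<noteq> g" using e that(2) XYd(1) unfolding inner_def by blast
        then have "e \<in> inner (E - {g}) P" using e by (simp add: inner_def)
        then show "e \<in> A" using positionD(12)[OF pos that(1)] by blast
      qed
      have "cross E D D' \<subseteq> cross {g} D D'"
      proof
        fix e assume "e \<in> cross E D D'"
        then obtain u w where uw: "e = {u, w}" "u \<in> D" "w \<in> D'" "{lab u, lab w} \<in> E"
          by (auto simp: cross_def)
        have "lab u \<in> X" "lab w \<in> Y" using uw D by auto
        then have "{lab u, lab w} = g"
          using positionD(3)[OF pos, of "{lab u, lab w}"] uw(4) XYd(1) by blast
        then show "e \<in> cross {g} D D'" using uw by (auto simp: cross_def)
      qed
      then have "cross E D D' \<subseteq> {f p}" using f[OF p] D(1) by simp
      then have "inner E (D \<union> D') \<subseteq> insert (f p) A" using un side[of D] side[of D'] D by auto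
      then show ?thesis
        using inj D positionD(8)[OF pos] XYd by (intro has_copyI[of "D \<union> D'"]) auto
    qed
    show "r \<le> card ?I" using r(2) by (simp add: cnt_def card_cartesian_product)
  qed
qed

end

section \<open>Iterating the phases\<close>

text \<open>Here \<open>x\<close> and \<open>y\<close> count pieces of two blocks and
  \<open>z\<close> those of the new one: exponents of \<open>R\<close> add up and one factor
  \<open>b\<close> cancels. The bound \<open>\<delta>\<close> need not contain \<open>b\<close>, so
  it also fits a block that is rarer than usual.\<close>

lemma pair_bound:
  fixes x y z b T R :: real
  assumes "\<gamma> * b \<le> x * R ^ i" "\<delta> \<le> y * R ^ j" "x * y \<le> T * b * z" "i + j \<le> k"
    and "1 \<le> R" "0 < T" "0 < b" "0 \<le> \<gamma>" "0 \<le> \<delta>" "0 \<le> x" "0 \<le> z"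
  shows "\<gamma> * \<delta> / T \<le> z * R ^ k"
proof -
  have "(\<gamma> * b) * \<delta> \<le> (x * R ^ i) * (y * R ^ j)"
    by (rule mult_mono[OF assms(1,2)]) (use assms in auto)
  also have "\<dots> = (x * y) * R ^ (i + j)" by (simp add: power_add)
  also have "\<dots> \<le> (T * b * z) * R ^ (i + j)" using assms by (intro mult_right_mono) auto
  also have "\<dots> \<le> (T * b * z) * R ^ k"
    using assms by (intro mult_left_mono power_increasing) auto
  finally have "b * (\<gamma> * \<delta>) \<le> b * (T * (z * R ^ k))" by (simp add: mult_ac)
  then have "\<gamma> * \<delta> \<le> T * (z * R ^ k)" using assms by simp
  then show ?thesis using assms by (simp add: divide_le_eq mult.commute)
qed

lemma single_bound:
  fixes x z T R :: real
  assumes "\<delta> \<le> x * R ^ i" "x \<le> T * z" "i \<le> k" "1 \<le> R" "0 < T" "0 \<le> z"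
  shows "\<delta> / T \<le> z * R ^ k"
proof -
  have "\<delta> \<le> (T * z) * R ^ i" using assms by (meson mult_right_mono order_trans zero_le_one zero_le_power)
  also have "\<dots> \<le> (T * z) * R ^ k" using assms by (intro mult_left_mono power_increasing) auto
  finally show ?thesis using assms by (simp add: divide_le_eq mult_ac)
qed

lemma cancel_power:
  fixes x R K :: real
  assumes "K * R ^ m \<le> x * R ^ i" "i \<le> m" "1 \<le> R" "0 \<le> x"
  shows "K \<le> x"
proof -
  have "x * R ^ i \<le> x * R ^ m" using assms by (intro mult_left_mono power_increasing) auto
  then show ?thesis using assms by (metis mult_le_cancel_right_pos order_less_le_trans order_trans zero_less_one zero_less_power)
qed

text \<open>The pieces of a block of \<open>s\<close> vertices number at least about \<open>b / R\<^sup>s\<close>, \<open>R = b / n\<close>. The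
  constants below absorb the loss in each of the at most \<open>u\<close> remaining phases.\<close>

fun loop_const :: "real \<Rightarrow> real \<Rightarrow> nat \<Rightarrow> real" where
  "loop_const T \<gamma> 0 = 1 / \<gamma>"
| "loop_const T \<gamma> (Suc u) = T * (loop_const T (\<gamma>\<^sup>2 / T) u + 1) / \<gamma>\<^sup>2"

fun start_const :: "real \<Rightarrow> real \<Rightarrow> nat \<Rightarrow> real" where
  "start_const T \<gamma> 0 = 1 / \<gamma>\<^sup>2"
| "start_const T \<gamma> (Suc u) = T * (start_const T (\<gamma>\<^sup>2 / T) u + loop_const T (\<gamma>\<^sup>2 / T) u + 1) / \<gamma>\<^sup>2"

lemma shrunk_const:
  fixes \<gamma> T :: real
  assumes "0 < \<gamma>" "\<gamma> \<le> 1" "4 \<le> T"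
  shows "0 < \<gamma>\<^sup>2 / T" "\<gamma>\<^sup>2 / T \<le> 1" "\<gamma>\<^sup>2 / T \<le> \<gamma> / T" "\<gamma>\<^sup>2 / T \<le> \<gamma> / 4"
proof -
  show "0 < \<gamma>\<^sup>2 / T" using assms by simp
  have sq: "\<gamma>\<^sup>2 \<le> \<gamma>" using assms by (simp add: power2_eq_square mult_left_le)
  then show "\<gamma>\<^sup>2 / T \<le> \<gamma> / T" using assms by (simp add: divide_right_mono)
  also have "\<gamma> / T \<le> \<gamma> / 4" using assms by (intro divide_left_mono) auto
  finally show "\<gamma>\<^sup>2 / T \<le> \<gamma> / 4" .
  then show "\<gamma>\<^sup>2 / T \<le> 1" using assms(2) by linarith
qed

lemma loop_const_ge:
  assumes "0 < \<gamma>" "\<gamma> \<le> 1" "4 \<le> T"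
  shows "1 / \<gamma> \<le> loop_const T \<gamma> u"
  using assms
proof (induction u arbitrary: \<gamma>)
  case (Suc u)
  note s = shrunk_const[OF Suc.prems]
  have "0 \<le> loop_const T (\<gamma>\<^sup>2 / T) u"
    using Suc.IH[OF s(1,2) Suc.prems(3)] s(1) by (meson order_trans less_imp_le zero_less_divide_1_iff)
  then have "1 \<le> T * (loop_const T (\<gamma>\<^sup>2 / T) u + 1)"
    using mult_mono[of 1 T 1 "loop_const T (\<gamma>\<^sup>2 / T) u + 1"] Suc.prems(3) by simp
  then have "1 / \<gamma>\<^sup>2 \<le> loop_const T \<gamma> (Suc u)" using Suc.prems by (simp add: divide_right_mono)
  moreover have "1 / \<gamma> \<le> 1 / \<gamma>\<^sup>2"
    using Suc.prems by (intro divide_left_mono) (auto simp: power2_eq_square mult_left_le)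
  ultimately show ?case by linarith
qed simp

lemma start_const_ge:
  assumes "0 < \<gamma>" "\<gamma> \<le> 1" "4 \<le> T"
  shows "1 / \<gamma>\<^sup>2 \<le> start_const T \<gamma> u"
  using assms
proof (induction u arbitrary: \<gamma>)
  case (Suc u)
  note s = shrunk_const[OF Suc.prems]
  have "0 \<le> start_const T (\<gamma>\<^sup>2 / T) u"
    using Suc.IH[OF s(1,2) Suc.prems(3)] by (meson order_trans zero_le_divide_1_iff zero_le_power2)
  moreover have "0 \<le> loop_const T (\<gamma>\<^sup>2 / T) u"
    using loop_const_ge[OF s(1,2) Suc.prems(3)] s(1) by (meson order_trans less_imp_le zero_less_divide_1_iff)
  ultimately have "1 \<le> T * (start_const T (\<gamma>\<^sup>2 / T) u + loop_const T (\<gamma>\<^sup>2 / T) u + 1)"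
    using mult_mono[of 1 T 1 "start_const T (\<gamma>\<^sup>2 / T) u + loop_const T (\<gamma>\<^sup>2 / T) u + 1"]
      Suc.prems(3) by simp
  then show ?case using Suc.prems by (simp add: divide_right_mono)
qed simp

text \<open>The constants are built so that \<open>K * \<gamma>\<^sup>2\<close> exceeds
  \<open>T * K' + T\<close>. The first summand leaves \<open>K'\<close> for the rest of the game,
  the second keeps all counts and products large enough for the next phase.\<close>

lemma round_const:
  fixes \<gamma> T K K' :: real
  assumes "T * (K' + 1) / \<gamma>\<^sup>2 \<le> K" and "0 \<le> K'" "0 < \<gamma>" "\<gamma> \<le> 1" "216 \<le> T"
  shows "T * K' \<le> K * \<gamma>\<^sup>2" "T \<le> K * \<gamma>\<^sup>2" "K * \<gamma>\<^sup>2 \<le> K * \<gamma>" "K * \<gamma> \<le> K" "K' \<le> K" "216 \<le> K * \<gamma>\<^sup>2"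
proof -
  have *: "T * K' + T \<le> K * \<gamma>\<^sup>2"
    using assms by (simp add: divide_le_eq distrib_left)
  have "0 \<le> T * K'" using assms by simp
  then show 1: "T * K' \<le> K * \<gamma>\<^sup>2" "T \<le> K * \<gamma>\<^sup>2" using * assms by linarith+
  then show "216 \<le> K * \<gamma>\<^sup>2" using assms by linarith
  then have "0 < K" using assms by (metis mult_nonpos_nonneg not_le order_less_le_trans zero_le_power2 zero_less_numeral)
  then show 2: "K * \<gamma>\<^sup>2 \<le> K * \<gamma>" "K * \<gamma> \<le> K"
    using assms by (auto simp: power2_eq_square mult_left_le)
  have "1 * K' \<le> T * K'" using assms by (intro mult_right_mono) auto
  then show "K' \<le> K" using 1 2 by linarith
qed

section \<open>Induction on the edges of H not yet acquired\<close>

locale biased = board +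
  fixes b r :: nat and R :: real
  assumes con: "connected_graph V E" and R1: "1 \<le> R" and b4: "4 * n \<le> b" and b0: "0 < b" and r0: "0 < r"
begin

definition T :: real where "T = 216 * real types"

lemma T216: "216 \<le> T"
proof -
  have "1 \<le> types" by (simp add: types_def)
  then show ?thesis by (simp add: T_def)
qed

text \<open>Here \<open>z\<close> is the count of the new block. The first alternative speaks of all
  linked pairs, whether merged or not, and this is what makes the later case distinctions
  work.\<close>

definition growth ::
    "'a set set \<Rightarrow> 'a set set \<Rightarrow> nat set set \<Rightarrow> 'a set set \<Rightarrow> real \<Rightarrow> bool" where
  "growth \<pi> U DD CC z \<longleftrightarrow>
     (\<forall>Z\<in>\<pi>. \<forall>W\<in>\<pi>. Z \<noteq> W \<longrightarrow> links U Z W \<noteq> {} \<longrightarrow> real (cnt DD Z) * real (cnt DD W) \<le> T * b * z) \<or>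
     (\<exists>Z\<in>CC. real (cnt DD Z) \<le> T * z)"

lemma growth_cases [consumes 1, case_names pair single]:
  assumes "growth \<pi> U DD CC z"
  obtains "\<And>Z W. Z \<in> \<pi> \<Longrightarrow> W \<in> \<pi> \<Longrightarrow> Z \<noteq> W \<Longrightarrow> links U Z W \<noteq> {} \<Longrightarrow>
      real (cnt DD Z) * real (cnt DD W) \<le> T * b * z"
    | Z where "Z \<in> CC" "real (cnt DD Z) \<le> T * z"
  using assms unfolding growth_def by (elim disjE bexE) simp_all

lemma card_Union_blocks:
  assumes part: "partition_on V \<pi>" and CC: "CC \<subseteq> \<pi>"
  shows "card (\<Union>CC) = (\<Sum>Z\<in>CC. card Z)" "card (\<Union>CC) \<le> card V"
proof -
  show "card (\<Union>CC) = (\<Sum>Z\<in>CC. card Z)"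
    using CC blockD(3,5)[OF part] unfolding pairwise_def disjnt_def
    by (intro card_Union_disjoint) (auto simp: pairwise_def disjnt_def subset_iff)
  show "card (\<Union>CC) \<le> card V"
    using CC blockD(2)[OF part] finite_V by (intro card_mono) auto
qed

lemma two_blocks:
  assumes "partition_on V \<pi>" "CC \<subseteq> \<pi>" "Z \<in> CC" "W \<in> CC" "Z \<noteq> W"
  shows "card Z + card W \<le> card (\<Union>CC)"
proof -
  have "(\<Sum>Z\<in>{Z, W}. card Z) \<le> (\<Sum>Z\<in>CC. card Z)"
    using assms blockD(4)[OF assms(1)] by (intro sum_mono2) (auto intro: finite_subset)
  then show ?thesis using card_Union_blocks(1)[OF assms(1,2)] assms(5) by simp
qed

lemma one_block:
  assumes "partition_on V \<pi>" "CC \<subseteq> \<pi>" "Z \<in> CC"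
  shows "card Z \<le> card (\<Union>CC)"
  using card_mono[of "\<Union>CC" Z] assms blockD(2)[OF assms(1)] finite_V
  by (meson Sup_upper Union_least finite_subset subset_iff)

text \<open>Enforcer waits between the linked pair whose product of counts is largest. The number of
  gains that he enforces is therefore of the order of that maximum divided by \<open>b\<close>, and
  bounds every other linked pair too, no matter what Avoider merges.\<close>

lemma round_wins:
  assumes pos: "position \<pi> U DD A F" and XY: "X \<in> \<pi>" "Y \<in> \<pi>" "X \<noteq> Y" "links U X Y \<noteq> {}"
    and ok: "\<And>Z W. Z \<in> \<pi> \<Longrightarrow> W \<in> \<pi> \<Longrightarrow> Z \<noteq> W \<Longrightarrow> links U Z W \<noteq> {} \<Longrightarrow>
      card (links U Z W) \<le> 2 \<and> card (links U Z W) dvd b"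
    and big: "\<And>Z. Z \<in> \<pi> \<Longrightarrow> 16 \<le> real (cnt DD Z)"
    and prod: "108 * real b \<le> real (cnt DD X) * real (cnt DD Y)"
    and next_wins: "\<And>CC U' DD' A F'. CC \<subseteq> \<pi> \<Longrightarrow> CC \<noteq> {} \<Longrightarrow> U' \<subset> U \<Longrightarrow>
      position (insert (\<Union>CC) (\<pi> - CC)) U' DD' A F' \<Longrightarrow>
      card (E - U) + card \<pi> \<le> card (E - U') + card (insert (\<Union>CC) (\<pi> - CC)) \<Longrightarrow>
      (\<And>Z. Z \<in> CC \<Longrightarrow> CC \<noteq> {Z} \<Longrightarrow> \<exists>Z'\<in>CC. Z' \<noteq> Z \<and> links U Z Z' \<noteq> {}) \<Longrightarrow>
      (\<And>Z. Z \<in> \<pi> - CC \<Longrightarrow> real (cnt DD Z) \<le> 4 * real (cnt DD' Z)) \<Longrightarrow>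
      growth \<pi> U DD CC (real (cnt DD' (\<Union>CC))) \<Longrightarrow>
      card F' mod Suc b = card F mod Suc b \<Longrightarrow> wins b has_copy A F'"
  shows "wins b has_copy A F"
proof -
  note part = positionD(1)[OF pos]
  define PP where "PP = {(Z, W). Z \<in> \<pi> \<and> W \<in> \<pi> \<and> Z \<noteq> W \<and> links U Z W \<noteq> {}}"
  have "finite PP"
    using blockD(4)[OF part] by (intro finite_subset[of PP "\<pi> \<times> \<pi>"]) (auto simp: PP_def)
  define S where "S = Max ((\<lambda>(Z, W). cnt DD Z * cnt DD W) ` PP)"
  have "(X, Y) \<in> PP" using XY by (simp add: PP_def)
  then have "S \<in> (\<lambda>(Z, W). cnt DD Z * cnt DD W) ` PP"
    unfolding S_def using \<open>finite PP\<close> by (intro Max_in) auto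
  then obtain P Q where PQ: "(P, Q) \<in> PP" "S = cnt DD P * cnt DD Q" by auto
  have max: "cnt DD Z * cnt DD W \<le> S" if "(Z, W) \<in> PP" for Z W
    unfolding S_def using that \<open>finite PP\<close> by (intro Max_ge) force+
  have "real (108 * b) \<le> real (cnt DD X * cnt DD Y)" using prod by simp
  then have S108: "108 * b \<le> S" using max[OF \<open>(X, Y) \<in> PP\<close>] by linarith
  define M where "M = S div (108 * b)"
  have M0: "0 < M" using S108 b0 by (simp add: M_def div_greater_zero_iff)
  have M1: "108 * M * b \<le> cnt DD P * cnt DD Q"
    using PQ(2) by (simp add: M_def) (metis div_times_less_eq_dividend mult.commute mult.left_commute)
  \<comment> \<open>As the quotient is at least 1, rounding it down loses at most a factor 2, so 108
    becomes 216.\<close>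
  have M2: "S \<le> 216 * b * M"
  proof -
    have "S < 108 * b * (M + 1)"
      using dividend_less_times_div[of "108 * b" S] b0 by (simp add: M_def)
    also have "\<dots> \<le> 108 * b * (2 * M)" using M0 by (intro mult_le_mono2) simp
    finally show ?thesis by simp
  qed
  have P: "P \<in> \<pi>" "Q \<in> \<pi>" "P \<noteq> Q" "links U P Q \<noteq> {}" using PQ(1) by (auto simp: PP_def)
  have "finite (links U P Q)"
    using positionD(2)[OF pos] finite_E by (intro finite_subset[of "links U P Q" E]) (auto simp: links_def)
  then have l0: "0 < card (links U P Q)" using P(4) by (simp add: card_gt_0_iff)
  have big': "\<forall>Z\<in>\<pi>. 16 \<le> cnt DD Z" using big by fastforce
  have f: "forces b (\<lambda>A F. \<exists>CC U' DD'. phase_result M \<pi> U DD A F CC U' DD') A F"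
    using phase_round[OF pos P(1-3) l0 _ _ b4 b0 big' M0 M1] ok[OF P] by blast
  show ?thesis
  proof (rule forces_wins[OF f positionD(6)[OF pos]])
    fix A' F' assume "\<exists>CC U' DD'. phase_result M \<pi> U DD A' F' CC U' DD'"
      and F': "card F' mod Suc b = card F mod Suc b"
    then obtain CC U' DD' where res: "phase_result M \<pi> U DD A' F' CC U' DD'" by blast
    then have 1: "CC \<subseteq> \<pi>" "CC \<noteq> {}" "U' \<subset> U" "position (insert (\<Union>CC) (\<pi> - CC)) U' DD' A' F'"
      "card (E - U) + card \<pi> \<le> card (E - U') + card (insert (\<Union>CC) (\<pi> - CC))"
      and 2: "\<And>Z. Z \<in> CC \<Longrightarrow> CC \<noteq> {Z} \<Longrightarrow> \<exists>Z'\<in>CC. Z' \<noteq> Z \<and> links U Z Z' \<noteq> {}"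
      and 3: "\<And>Z. Z \<in> \<pi> - CC \<Longrightarrow> cnt DD Z \<le> 4 * cnt DD' Z"
      and 4: "M \<le> types * cnt DD' (\<Union>CC) \<or> (\<exists>Z\<in>CC. cnt DD Z \<le> types * cnt DD' (\<Union>CC))"
      unfolding phase_result_def by (elim conjE; blast)+
    show "wins b has_copy A' F'"
    proof (rule next_wins[OF 1 2 _ _ F'])
      show "real (cnt DD Z) \<le> 4 * real (cnt DD' Z)" if "Z \<in> \<pi> - CC" for Z
        using 3[OF that] by linarith
      show "growth \<pi> U DD CC (real (cnt DD' (\<Union>CC)))"
        using 4
      proof
        assume M: "M \<le> types * cnt DD' (\<Union>CC)"
        have "real (cnt DD Z) * real (cnt DD W) \<le> T * real b * real (cnt DD' (\<Union>CC))"
          if "Z \<in> \<pi>" "W \<in> \<pi>" "Z \<noteq> W" "links U Z W \<noteq> {}" for Z W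
        proof -
          have "cnt DD Z * cnt DD W \<le> 216 * b * M"
            using max[of Z W] M2 that by (auto simp: PP_def)
          also have "\<dots> \<le> 216 * b * (types * cnt DD' (\<Union>CC))" using M by (intro mult_le_mono2)
          finally have "real (cnt DD Z * cnt DD W) \<le> real (216 * b * (types * cnt DD' (\<Union>CC)))"
            by (rule of_nat_mono)
          then show ?thesis by (simp add: T_def mult_ac)
        qed
        then show ?thesis unfolding growth_def by blast
      next
        assume "\<exists>Z\<in>CC. cnt DD Z \<le> types * cnt DD' (\<Union>CC)"
        then obtain Z where Z: "Z \<in> CC" "cnt DD Z \<le> types * cnt DD' (\<Union>CC)" by blast
        have "real (cnt DD Z) \<le> real (types * cnt DD' (\<Union>CC))" using Z(2) by (rule of_nat_mono)
        also have "\<dots> \<le> T * real (cnt DD' (\<Union>CC))" by (simp add: T_def)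
        finally show ?thesis using Z(1) unfolding growth_def by blast
      qed
    qed
  qed
qed

lemma prod_bound:
  fixes x y \<gamma> \<delta> :: real
  assumes "\<gamma> * b \<le> x * R ^ i" "\<delta> * R ^ m \<le> y * R ^ j" "i + j \<le> m" "0 \<le> \<gamma>" "0 \<le> \<delta>" "0 \<le> x" "0 \<le> y"
  shows "\<gamma> * \<delta> * b \<le> x * y"
proof (rule cancel_power[OF _ assms(3) R1])
  have "(\<gamma> * b) * (\<delta> * R ^ m) \<le> (x * R ^ i) * (y * R ^ j)"
    by (rule mult_mono[OF assms(1,2)]) (use assms R1 in auto)
  then show "\<gamma> * \<delta> * b * R ^ m \<le> x * y * R ^ (i + j)" by (simp add: power_add mult_ac)
qed (use assms in simp)

lemma kept_bound:
  fixes \<gamma> x y :: real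
  assumes "\<gamma> * b \<le> x * R ^ k" "x \<le> 4 * y" "0 \<le> y" "\<gamma>' \<le> \<gamma> / 4"
  shows "\<gamma>' * b \<le> y * R ^ k"
proof -
  have "\<gamma> * b / 4 \<le> y * R ^ k" using single_bound[OF assms(1,2) order_refl R1 _ assms(3)] by simp
  moreover have "\<gamma>' * b \<le> \<gamma> / 4 * b" using assms(4) by (intro mult_right_mono) auto
  ultimately show ?thesis by simp
qed

text \<open>Two linked blocks inside \<open>CC\<close> already give the estimate, since their sizes
  add up to at most that of the union and \<open>1 \<le> R\<close>. In the other alternative the new
  count is a constant fraction of an old one.\<close>

lemma merged_bound:
  fixes \<gamma> z :: real
  assumes \<gamma>: "0 < \<gamma>" "\<gamma> \<le> 1" and part: "partition_on V \<pi>" and CC: "CC \<subseteq> \<pi>"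
    and PQ: "P \<in> CC" "Q \<in> CC" "Q \<noteq> P" "links U P Q \<noteq> {}"
    and inv: "\<And>Z. Z \<in> CC \<Longrightarrow> \<gamma> * b \<le> cnt DD Z * R ^ card Z"
    and res: "growth \<pi> U DD CC z" and z: "0 \<le> z"
  shows "\<gamma>\<^sup>2 / T * b \<le> z * R ^ card (\<Union>CC)"
proof -
  have T0: "0 < T" "4 \<le> T" using T216 by simp_all
  show ?thesis
    using res
  proof (cases rule: growth_cases)
    case pair
    have "\<gamma> * (\<gamma> * b) / T \<le> z * R ^ card (\<Union>CC)"
    proof (rule pair_bound[where b = "real b", OF inv[OF PQ(1)] inv[OF PQ(2)]])
      show "real (cnt DD P) * real (cnt DD Q) \<le> T * real b * z" using pair[of P Q] PQ CC by blast
      show "card P + card Q \<le> card (\<Union>CC)" using two_blocks[OF part CC PQ(1,2)] PQ(3) by metis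
    qed (use R1 T0 b0 \<gamma> z in auto)
    then show ?thesis by (simp add: power2_eq_square)
  next
    case (single Z)
    have "\<gamma> * b / T \<le> z * R ^ card (\<Union>CC)"
      using single_bound[OF inv[OF single(1)] single(2) one_block[OF part CC single(1)] R1 T0(1) z] .
    moreover have "\<gamma>\<^sup>2 / T * b \<le> \<gamma> / T * b" using shrunk_const(3)[OF \<gamma> T0(2)] by (intro mult_right_mono) auto
    ultimately show ?thesis by simp
  qed
qed

lemma end_game:
  assumes pos: "position \<pi> U DD A F" and U: "card U \<le> 1" and F: "card F mod Suc b = r mod Suc b"
    and c: "\<And>Z. Z \<in> \<pi> \<Longrightarrow> 0 < cnt DD Z" and one: "U \<noteq> {} \<Longrightarrow> \<pi> = {V} \<Longrightarrow> r \<le> cnt DD V"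
    and two: "\<And>X Y. \<pi> = {X, Y} \<Longrightarrow> X \<noteq> Y \<Longrightarrow> r \<le> cnt DD X * cnt DD Y"
  shows "wins b has_copy A F"
proof (cases "U = {}")
  case True
  then show ?thesis using wins_all_claimed[OF con _ c] pos by simp
next
  case False
  note part = positionD(1)[OF pos]
  have fU: "finite U" using positionD(2)[OF pos] finite_E by (meson finite_subset)
  then have "card U = 1" using U False by (simp add: le_antisym Suc_le_eq card_gt_0_iff)
  then obtain g where g: "U = {g}" by (auto simp: card_1_singleton_iff)
  have "card \<pi> \<le> 2" using block_count[OF con pos order_refl] g by simp
  moreover have "\<pi> \<noteq> {}" using part con by (auto simp: partition_on_def connected_graph_def)
  then have "0 < card \<pi>" using blockD(4)[OF part] by (simp add: card_gt_0_iff)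
  ultimately consider "card \<pi> = 1" | "card \<pi> = 2" by linarith
  then show ?thesis
  proof cases
    case 1
    then obtain Z where "\<pi> = {Z}" by (auto simp: card_1_singleton_iff)
    then have V: "\<pi> = {V}" using part by (auto simp: partition_on_def)
    then show ?thesis using wins_loop_left[of g DD A F r b] pos g one[OF False] F r0 by simp
  next
    case 2
    then obtain X Y where "\<pi> = {X, Y}" "X \<noteq> Y" by (auto simp: card_2_iff)
    then show ?thesis using wins_bridge_left[OF con, of X Y g DD A F r b] pos g two F r0 by simp
  qed
qed

lemma card_EU: "U \<subseteq> E \<Longrightarrow> card (E - U) + card U = card E"
  using finite_E by (metis card_Diff_subset card_mono finite_subset le_add_diff_inverse2)

text \<open>By \<open>loop\<close> the missing edges form a tree on the blocks, so a last missing
  edge must be a bridge. One piece of the rare block \<open>X0\<close> then suffices, because the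
  other block alone supplies \<open>r\<close> threats.\<close>

lemma looped_end:
  fixes \<gamma> K :: real
  assumes "0 < \<gamma>" and K: "1 / \<gamma> \<le> K" and pos: "position \<pi> U DD A F"
    and F: "card F mod Suc b = r mod Suc b" and loop: "card V + 1 \<le> card (E - U) + card \<pi>"
    and E: "card E \<le> card V" and U: "card U \<le> 1" and b: "K * r * R ^ card V \<le> b" and X0: "X0 \<in> \<pi>"
    and inv: "\<And>Z. Z \<in> \<pi> \<Longrightarrow> Z \<noteq> X0 \<Longrightarrow> \<gamma> * b \<le> cnt DD Z * R ^ card Z"
    and inv0: "K * R ^ card V \<le> cnt DD X0 * R ^ k"
  shows "wins b has_copy A F"
proof (rule end_game[OF pos U F])
  note part = positionD(1)[OF pos]
  have g1: "1 \<le> \<gamma> * K" using K assms(1) by (simp add: divide_le_eq mult.commute)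
  have K0: "0 < K" using K assms(1) by (meson less_le_trans zero_less_divide_1_iff)
  have Rp: "0 < R ^ i" for i using R1 by simp
  show c: "0 < cnt DD Z" if "Z \<in> \<pi>" for Z
  proof (rule ccontr)
    assume "\<not> 0 < cnt DD Z"
    then have z: "cnt DD Z = 0" by simp
    show False
    proof (cases "Z = X0")
      case True
      have "0 < K * R ^ card V" using K0 Rp by simp
      then show False using inv0 z True by simp
    next
      case False
      have "0 < \<gamma> * b" using assms(1) b0 by simp
      then show False using inv[OF that False] z by simp
    qed
  qed
  show "r \<le> cnt DD V" if "U \<noteq> {}" "\<pi> = {V}"
  proof -
    have "card V \<le> card (E - U)" using loop that by simp
    moreover have "0 < card U"
      using that positionD(2)[OF pos] finite_E by (meson card_gt_0_iff finite_subset)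
    ultimately show ?thesis using E card_EU[OF positionD(2)[OF pos]] by linarith
  qed
  have rZ: "r \<le> cnt DD Z" if "Z \<in> \<pi>" "Z \<noteq> X0" for Z
  proof -
    have "\<gamma> * (K * r * R ^ card V) \<le> \<gamma> * b" using b assms(1) by (intro mult_left_mono) auto
    then have "(\<gamma> * K * r) * R ^ card V \<le> cnt DD Z * R ^ card Z"
      using inv[OF that] by (simp add: mult_ac)
    moreover have "card Z \<le> card V" using card_mono[OF finite_V blockD(2)[OF part that(1)]] .
    ultimately have "\<gamma> * K * r \<le> cnt DD Z" using cancel_power[OF _ _ R1] by simp
    moreover have "1 * real r \<le> \<gamma> * K * r" using g1 by (intro mult_right_mono) auto
    ultimately show ?thesis by simp
  qed
  show "r \<le> cnt DD X * cnt DD Y" if "\<pi> = {X, Y}" "X \<noteq> Y" for X Y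
  proof (cases "X = X0")
    case True
    then have "r \<le> cnt DD Y" "1 \<le> cnt DD X" using rZ[of Y] c[of X] that by auto
    then show ?thesis using mult_le_mono[of 1 "cnt DD X" r "cnt DD Y"] by simp
  next
    case False
    then have "r \<le> cnt DD X" "1 \<le> cnt DD Y" using rZ[of X] c[of Y] that by auto
    then show ?thesis using mult_le_mono[of r "cnt DD X" 1 "cnt DD Y"] by simp
  qed
qed

lemma three_blocks:
  assumes "partition_on V \<pi>" "X \<in> \<pi>" "Y \<in> \<pi>" "Z \<in> \<pi>" "X \<noteq> Y" "X \<noteq> Z" "Y \<noteq> Z"
  shows "card X + card Y + card Z \<le> card V"
  using card_Union_blocks[OF assms(1), of "{X, Y, Z}"] assms by simp

lemma two_blocks_V:
  assumes "partition_on V \<pi>" "X \<in> \<pi>" "Y \<in> \<pi>" "X \<noteq> Y"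
  shows "card X + card Y \<le> card V"
  using card_Union_blocks[OF assms(1), of "{X, Y}"] assms by simp

text \<open>Once the cycle of \<open>H\<close> has been closed inside the pieces of a block \<open>X0\<close>, those pieces may be
  rare. It suffices that \<open>X0\<close> together with one further block \<open>Zs\<close> is as large as usual.\<close>

lemma wins_looped:
  fixes \<gamma> K :: real
  assumes "0 < \<gamma>" "\<gamma> \<le> 1" and "position \<pi> U DD A F"
    and "card F mod Suc b = r mod Suc b" and "card V + 1 \<le> card (E - U) + card \<pi>"
    and E: "card E \<le> card V" and "card U \<le> u" and "loop_const T \<gamma> u \<le> K"
    and "K * r * R ^ card V \<le> b" and "X0 \<in> \<pi>"
    and "\<And>Z. Z \<in> \<pi> \<Longrightarrow> Z \<noteq> X0 \<Longrightarrow> \<gamma> * b \<le> cnt DD Z * R ^ card Z"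
    and "Zs \<in> insert {} (\<pi> - {X0})" and "K * R ^ card V \<le> cnt DD X0 * R ^ (card X0 + card Zs)"
  shows "wins b has_copy A F"
  using assms(1-5,7-)
proof (induction u arbitrary: \<gamma> K \<pi> U DD A F X0 Zs)
  case 0
  then show ?case
    by (intro looped_end[of \<gamma> K \<pi> U DD A F X0 "card X0 + card Zs"] E) auto
next
  case (Suc u)
  note pos = Suc.prems(3) and X0 = Suc.prems(9) and inv = Suc.prems(10)
  note part = positionD(1)[OF pos]
  show ?case
  proof (cases "card U \<le> 1")
    case True
    have "1 / \<gamma> \<le> K" using loop_const_ge[of \<gamma> T "Suc u"] Suc.prems(1,2,7) T216 by linarith
    then show ?thesis
      using looped_end[OF Suc.prems(1) _ pos Suc.prems(4,5) E True Suc.prems(8) X0 inv Suc.prems(12)] by blast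
  next
    case False
    have fU: "finite U" using positionD(2)[OF pos] finite_E by (meson finite_subset)
    have beta: "card U + 1 \<le> card \<pi>"
      using Suc.prems(5) E card_EU[OF positionD(2)[OF pos]] by linarith
    \<comment> \<open>With the cycle closed, the missing edges form a tree on the blocks, so no
      parallel links remain and divisibility is trivial.\<close>
    have ok: "card (links U Z W) \<le> 2 \<and> card (links U Z W) dvd b"
      if "Z \<in> \<pi>" "W \<in> \<pi>" "Z \<noteq> W" "links U Z W \<noteq> {}" for Z W
    proof -
      have "card (links U Z W) \<le> 1" using block_count_parallel[OF con pos that(1-3)] beta by linarith
      moreover have "finite (links U Z W)" using fU by (simp add: links_def)
      then have "0 < card (links U Z W)" using that(4) by (simp add: card_gt_0_iff)
      ultimately have "card (links U Z W) = 1" by linarith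
      then show ?thesis by simp
    qed
    define \<gamma>' where "\<gamma>' = \<gamma>\<^sup>2 / T"
    define K' where "K' = loop_const T \<gamma>' u"
    have T4: "4 \<le> T" using T216 by simp
    note s = shrunk_const[OF Suc.prems(1,2) T4, folded \<gamma>'_def]
    have K'0: "0 \<le> K'"
      using loop_const_ge[OF s(1,2) T4, of u] s(1) unfolding K'_def
      by (meson less_imp_le order_trans zero_less_divide_1_iff)
    have "T * (K' + 1) / \<gamma>\<^sup>2 \<le> K" using Suc.prems(7) by (simp add: K'_def \<gamma>'_def)
    note Kc = round_const[OF this K'0 Suc.prems(1,2) T216]
    have K0: "0 \<le> K" using Kc by linarith
    have Rp: "0 < R ^ i" for i using R1 by simp
    have bK: "K * R ^ card V \<le> b"
    proof -
      have "K * R ^ card V * 1 \<le> K * R ^ card V * r"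
        using r0 K0 Rp[of "card V"] by (intro mult_left_mono) auto
      then show ?thesis using Suc.prems(8) by (simp add: mult_ac)
    qed
    have gK: "\<gamma> * K * R ^ card V \<le> \<gamma> * b" using bK Suc.prems(1) by (simp add: mult.assoc)
    have gZ: "\<gamma> * K * R ^ card V \<le> cnt DD Z * R ^ card Z" if "Z \<in> \<pi>" "Z \<noteq> X0" for Z
      using gK inv[OF that] by linarith
    have cV: "card Z \<le> card V" if "Z \<in> \<pi>" for Z
      using blockD(2)[OF part that] finite_V by (rule card_mono[rotated])
    \<comment> \<open>An empty companion may be replaced by any other block, as a larger exponent
      only weakens the bound.\<close>
    obtain Z1 where Z1: "Z1 \<in> \<pi>" "Z1 \<noteq> X0" "K * R ^ card V \<le> cnt DD X0 * R ^ (card X0 + card Z1)"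
    proof (cases "Zs = {}")
      case True
      have "\<not> \<pi> \<subseteq> {X0}" using beta False card_mono[of "{X0}" \<pi>] by auto
      then obtain Z where Z: "Z \<in> \<pi>" "Z \<noteq> X0" by blast
      have "cnt DD X0 * R ^ (card X0 + card Zs) \<le> cnt DD X0 * R ^ (card X0 + card Z)"
        using True R1 by (intro mult_left_mono power_increasing) auto
      then show ?thesis using Suc.prems(12) by (intro that[OF Z]) linarith
    next
      case False
      then show ?thesis using Suc.prems(11,12) by (intro that[of Zs]) simp_all
    qed
    have x0K: "K \<le> cnt DD X0"
      using Z1 two_blocks_V[OF part X0 Z1(1)] R1 by (intro cancel_power[OF Z1(3)]) auto
    have big: "16 \<le> real (cnt DD Z)" if "Z \<in> \<pi>" for Z
    proof (cases "Z = X0")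
      case True
      have "16 \<le> real (cnt DD X0)" using x0K Kc(3,4,6) by linarith
      then show ?thesis using True by simp
    next
      case False
      have "\<gamma> * K \<le> cnt DD Z" using cV[OF that] R1 by (intro cancel_power[OF gZ[OF that False]]) auto
      then show ?thesis using Kc(3,6) mult.commute[of \<gamma> K] by linarith
    qed
    have "card {X0, Z1} \<le> 2" using card_insert_le_m1[of 2 "{Z1}" X0] by simp
    then have "{X0, Z1} \<noteq> \<pi>" using beta False by auto
    moreover have "{X0, Z1} \<subseteq> \<pi>" using X0 Z1(1) by simp
    ultimately have "\<exists>Y\<in>{X0, Z1}. \<exists>W\<in>\<pi> - {X0, Z1}. links U Y W \<noteq> {}"
      by (intro linked_blocks[OF con pos]) simp_all
    then obtain Y W where YW: "Y \<in> {X0, Z1}" "W \<in> \<pi>" "W \<notin> {X0, Z1}" "links U Y W \<noteq> {}"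
      by (elim bexE DiffE) (rule that)
    have Y: "Y \<in> \<pi>" using \<open>{X0, Z1} \<subseteq> \<pi>\<close> YW(1) by (rule subsetD)
    have Wne: "W \<noteq> X0" "W \<noteq> Z1" using YW(3) by simp_all
    have YneW: "Y \<noteq> W" using YW(1,3) by metis
    \<comment> \<open>The bound for \<open>X0\<close> already spends the exponent of
      \<open>Z1\<close>. Since \<open>W\<close> avoids both blocks, the three sizes still add up to
      at most \<open>card V\<close>.\<close>
    have prod: "K * \<gamma>\<^sup>2 * b \<le> real (cnt DD Y) * real (cnt DD W)"
    proof (cases "Y = X0")
      case True
      have "card W + (card X0 + card Z1) \<le> card V"
        using three_blocks[OF part X0 Z1(1) YW(2) Z1(2)[symmetric] Wne[symmetric]] by simp
      then have "\<gamma> * K * b \<le> cnt DD W * cnt DD X0"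
        using prod_bound[OF inv[OF YW(2) Wne(1)] Z1(3)] Suc.prems(1) K0 by simp
      moreover have "K * \<gamma>\<^sup>2 * b \<le> K * \<gamma> * b" using Kc b0 by (intro mult_right_mono) auto
      ultimately show ?thesis using True by (simp add: mult_ac)
    next
      case F: False
      then have Y1: "Y = Z1" using YW(1) by blast
      have "card W + card Z1 \<le> card V" using two_blocks_V[OF part YW(2) Z1(1) Wne(2)] .
      then have "\<gamma> * (\<gamma> * K) * b \<le> cnt DD W * cnt DD Z1"
        using prod_bound[OF inv[OF YW(2) Wne(1)] gZ[OF Z1(1,2)]] Suc.prems(1) K0 by simp
      then show ?thesis using Y1 by (simp add: mult_ac power2_eq_square)
    qed
    have "108 * real b \<le> K * \<gamma>\<^sup>2 * b" using Kc by (intro mult_right_mono) auto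
    then have prod108: "108 * real b \<le> real (cnt DD Y) * real (cnt DD W)" using prod by linarith
    show ?thesis
    proof (rule round_wins[OF pos Y YW(2) YneW YW(4) ok big prod108])
      fix CC U' DD' A' F'
      let ?C = "\<Union>CC" and ?\<pi> = "insert (\<Union>CC) (\<pi> - CC)"
      assume CC: "CC \<subseteq> \<pi>" "CC \<noteq> {}" and U': "U' \<subset> U" and pos': "position ?\<pi> U' DD' A' F'"
        and count: "card (E - U) + card \<pi> \<le> card (E - U') + card ?\<pi>"
        and link: "\<And>Z. Z \<in> CC \<Longrightarrow> CC \<noteq> {Z} \<Longrightarrow> \<exists>Z'\<in>CC. Z' \<noteq> Z \<and> links U Z Z' \<noteq> {}"
        and keep: "\<And>Z. Z \<in> \<pi> - CC \<Longrightarrow> real (cnt DD Z) \<le> 4 * real (cnt DD' Z)"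
        and res: "growth \<pi> U DD CC (real (cnt DD' ?C))"
        and F': "card F' mod Suc b = card F mod Suc b"
      let ?c = "real (cnt DD' ?C)"
      have cU': "card U' \<le> u" using psubset_card_mono[OF fU U'] Suc.prems(6) by linarith
      have loop': "card V + 1 \<le> card (E - U') + card ?\<pi>" using count Suc.prems(5) by linarith
      \<comment> \<open>A phase that fuses no blocks would close a second cycle.\<close>
      have "CC \<noteq> {Z}" for Z
      proof
        assume "CC = {Z}"
        then have "?\<pi> = \<pi>" using CC(1) by auto
        then have "card \<pi> \<le> card U' + 1" using block_count[OF con pos' order_refl] by simp
        then show False using beta psubset_card_mono[OF fU U'] by linarith
      qed
      note link = link[OF _ this]
      have b': "K' * r * R ^ card V \<le> b"
      proof -
        have "K' * r * R ^ card V \<le> K * r * R ^ card V" using Kc Rp[of "card V"] by (intro mult_right_mono) auto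
        then show ?thesis using Suc.prems(8) by linarith
      qed
      have T0: "0 < T" using T216 by simp
      have out: "W \<noteq> ?C" "W \<noteq> {}" if "W \<in> \<pi> - CC" for W
      proof -
        obtain Z where Z: "Z \<in> CC" using CC(2) by blast
        then have "Z \<in> \<pi>" "W \<in> \<pi>" "W \<noteq> Z" using that CC(1) by auto
        then have "W \<inter> Z = {}" "Z \<noteq> {}" using blockD(3)[OF part, of W Z] blockD(1)[OF part] by blast+
        moreover have "Z \<subseteq> ?C" using Z by blast
        ultimately show "W \<noteq> ?C" by blast
        show "W \<noteq> {}" using that blockD(1)[OF part] by blast
      qed
      have kept: "\<gamma>' * b \<le> cnt DD' Z * R ^ card Z" if Z: "Z \<in> \<pi> - CC" "Z \<noteq> X0" for Z
        using kept_bound[OF inv keep[OF Z(1)] _ s(4)] Z by simp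
      show "wins b has_copy A' F'"
      proof (cases "X0 \<in> CC")
        case False
        obtain P where P: "P \<in> CC" using CC(2) by blast
        then obtain Q where Q: "Q \<in> CC" "Q \<noteq> P" "links U P Q \<noteq> {}" using link[OF P] by (elim bexE conjE)
        have "\<gamma> * b \<le> cnt DD Z * R ^ card Z" if "Z \<in> CC" for Z
          using inv[of Z] that CC(1) False by blast
        then have C: "\<gamma>' * b \<le> ?c * R ^ card ?C"
          unfolding \<gamma>'_def by (rule merged_bound[OF Suc.prems(1,2) part CC(1) P Q _ res]) simp_all
        \<comment> \<open>If the companion has been absorbed, the union that contains it takes its
          place.\<close>
        define Zs' where "Zs' = (if Z1 \<in> CC then ?C else Z1)"
        have X0': "X0 \<in> ?\<pi>" using X0 False by simp
        have inv': "\<gamma>' * b \<le> cnt DD' Z * R ^ card Z" if "Z \<in> ?\<pi>" "Z \<noteq> X0" for Z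
          using that C kept[of Z] by (cases "Z = ?C") simp_all
        have Zs': "Zs' \<in> insert {} (?\<pi> - {X0})"
          using Z1(1,2) out[of X0] X0 False by (simp add: Zs'_def)
        have "card Z1 \<le> card Zs'" using one_block[OF part CC(1), of Z1] by (simp add: Zs'_def)
        then have "cnt DD' X0 * R ^ (card X0 + card Z1) \<le> cnt DD' X0 * R ^ (card X0 + card Zs')"
          using R1 by (intro mult_left_mono power_increasing) auto
        moreover have "K * R ^ card V / 4 \<le> cnt DD' X0 * R ^ (card X0 + card Z1)"
          using single_bound[OF Z1(3) keep order_refl R1] X0 False by simp
        moreover have "K' * R ^ card V \<le> K / 4 * R ^ card V"
        proof (rule mult_right_mono)
          have "4 * K' \<le> T * K'" using T4 K'0 by (intro mult_right_mono) auto
          then show "K' \<le> K / 4" using Kc by linarith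
        qed (use Rp[of "card V"] in simp)
        ultimately have inv0': "K' * R ^ card V \<le> cnt DD' X0 * R ^ (card X0 + card Zs')" by simp
        show ?thesis
          by (rule Suc.IH[OF s(1,2) pos' _ loop' cU' _ b' X0' inv' Zs' inv0'])
            (use F' Suc.prems(4) K'_def in auto)
      next
        case True
        have inv': "\<gamma>' * b \<le> cnt DD' Z * R ^ card Z" if "Z \<in> ?\<pi>" "Z \<noteq> ?C" for Z
          using that kept[of Z] True by (metis DiffD2 insertE)
        have fin: "K' * R ^ card V \<le> z" if z: "\<delta> / T \<le> z" "K * \<gamma>\<^sup>2 * R ^ card V \<le> \<delta>" for \<delta> z :: real
        proof -
          have "T * K' * R ^ card V \<le> K * \<gamma>\<^sup>2 * R ^ card V" using Kc Rp[of "card V"] by (intro mult_right_mono) auto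
          also have "\<dots> \<le> \<delta>" by (rule z(2))
          also have "\<dots> \<le> T * z" using z(1) T0 by (simp add: divide_le_eq mult.commute)
          finally have "T * (K' * R ^ card V) \<le> T * z" by (simp add: mult.assoc)
          then show ?thesis using T0 by simp
        qed
        \<comment> \<open>These are the four lower bounds that the cases below feed into
          \<open>fin\<close>.\<close>
        have d1: "K * \<gamma>\<^sup>2 * R ^ card V \<le> K * R ^ card V" "K * \<gamma>\<^sup>2 * R ^ card V \<le> \<gamma> * (K * R ^ card V)"
          "K * \<gamma>\<^sup>2 * R ^ card V \<le> \<gamma> * b" "K * \<gamma>\<^sup>2 * R ^ card V \<le> \<gamma> * (\<gamma> * b)"
        proof -
          have "K * \<gamma>\<^sup>2 * R ^ card V \<le> K * \<gamma> * R ^ card V" "K * \<gamma> * R ^ card V \<le> K * R ^ card V"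
            using mult_right_mono[OF Kc(3), of "R ^ card V"] mult_right_mono[OF Kc(4), of "R ^ card V"]
              Rp[of "card V"] by simp_all
          note a = this
          show "K * \<gamma>\<^sup>2 * R ^ card V \<le> K * R ^ card V" using a by linarith
          show "K * \<gamma>\<^sup>2 * R ^ card V \<le> \<gamma> * (K * R ^ card V)" using a(1) by (simp only: mult_ac)
          have "\<gamma> * K * R ^ card V = K * \<gamma> * R ^ card V" by simp
          then show "K * \<gamma>\<^sup>2 * R ^ card V \<le> \<gamma> * b" using gK a(1) by linarith
          have "\<gamma> * (\<gamma> * K * R ^ card V) \<le> \<gamma> * (\<gamma> * b)" using gK Suc.prems(1) by (intro mult_left_mono) auto
          then show "K * \<gamma>\<^sup>2 * R ^ card V \<le> \<gamma> * (\<gamma> * b)" by (simp add: power2_eq_square mult_ac)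
        qed
        \<comment> \<open>The fused block becomes the special one and may need a companion. This is
          \<open>Z1\<close> if it survived; if \<open>Z1\<close> was absorbed, a block
          \<open>W2\<close> linked to the union serves, because \<open>growth\<close> also bounds
          pairs that were not merged. If all blocks are fused, or a usual block bounds the count,
          none is needed.\<close>
        have "\<exists>Zs'\<in>insert {} (\<pi> - CC). K' * R ^ card V \<le> ?c * R ^ (card ?C + card Zs')"
          using res
        proof (cases rule: growth_cases)
          case pair
          have withX0: "K' * R ^ card V \<le> ?c * R ^ k"
            if P: "P \<in> \<pi>" "P \<noteq> X0" "links U X0 P \<noteq> {}" "card P + (card X0 + card Z1) \<le> k" for P k
          proof (rule fin[OF pair_bound[OF inv[OF P(1,2)] Z1(3) _ P(4)] d1(2)])
            show "real (cnt DD P) * real (cnt DD X0) \<le> T * real b * ?c"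
              using pair[OF X0 P(1) P(2)[symmetric] P(3)] by (simp add: mult.commute)
          qed (use R1 T0 b0 Suc.prems(1) K0 in auto)
          show ?thesis
          proof (cases "Z1 \<in> CC")
            case False
            obtain P where P: "P \<in> CC" "P \<noteq> X0" "links U X0 P \<noteq> {}" using link[OF True] by blast
            have "card P + (card X0 + card Z1) \<le> card ?C + card Z1"
              using two_blocks[OF part CC(1) P(1) True P(2)] by simp
            then have "K' * R ^ card V \<le> ?c * R ^ (card ?C + card Z1)"
              using withX0[of P] P CC(1) by blast
            then show ?thesis using Z1(1) False by blast
          next
            case Z1C: True
            have XZ: "card X0 + card Z1 \<le> card ?C" using two_blocks[OF part CC(1) True Z1C Z1(2)[symmetric]] .
            show ?thesis
            proof (cases "CC = \<pi>")
              case True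
              then have V: "?C = V" using part by (simp add: partition_on_def)
              have "real (cnt DD Y) * real (cnt DD W) \<le> T * real b * ?c"
                by (rule pair[OF Y YW(2) YneW YW(4)])
              then have "b * (K * \<gamma>\<^sup>2) \<le> b * (T * ?c)" using prod by (simp add: mult_ac)
              then have "K * \<gamma>\<^sup>2 \<le> T * ?c" using b0 by simp
              then have "T * K' \<le> T * ?c" using Kc by linarith
              then have "K' \<le> ?c" using T0 by simp
              then have "K' * R ^ card V \<le> ?c * R ^ (card ?C + card {})"
                using Rp[of "card V"] V by simp
              then show ?thesis by blast
            next
              case False
              then obtain Y2 W2 where P: "Y2 \<in> CC" "W2 \<in> \<pi> - CC" "links U Y2 W2 \<noteq> {}"
                using linked_blocks[OF con pos CC] by blast
              have "K' * R ^ card V \<le> ?c * R ^ (card ?C + card W2)"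
              proof (cases "Y2 = X0")
                case True
                then show ?thesis using withX0[of W2 "card ?C + card W2"] P XZ \<open>X0 \<in> CC\<close> by (simp, metis)
              next
                case Y2: False
                have "Y2 \<in> \<pi>" "W2 \<in> \<pi>" "W2 \<noteq> X0" "Y2 \<noteq> W2" using P CC(1) \<open>X0 \<in> CC\<close> by blast+
                show ?thesis
                proof (rule fin[OF pair_bound[OF inv[OF \<open>Y2 \<in> \<pi>\<close> Y2] inv[OF \<open>W2 \<in> \<pi>\<close> \<open>W2 \<noteq> X0\<close>]] d1(4)])
                  show "real (cnt DD Y2) * real (cnt DD W2) \<le> T * real b * ?c"

                    by (rule pair[OF \<open>Y2 \<in> \<pi>\<close> \<open>W2 \<in> \<pi>\<close> \<open>Y2 \<noteq> W2\<close> P(3)])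
                  show "card Y2 + card W2 \<le> card ?C + card W2" using one_block[OF part CC(1) P(1)] by simp
                qed (use R1 T0 b0 Suc.prems(1) in auto)
              qed
              then show ?thesis using P(2) by blast
            qed
          qed
        next
          case Z: (single Z)
          show ?thesis
          proof (cases "Z = X0")
            case ZX: True
            have k: "K' * R ^ card V \<le> ?c * R ^ k" if "card X0 + card Z1 \<le> k" for k
              using single_bound[OF Z1(3) _ that R1 T0] Z(2) ZX by (intro fin[OF _ d1(1)]) auto
            show ?thesis
            proof (cases "Z1 \<in> CC")
              case True
              then have "card X0 + card Z1 \<le> card ?C + card {}"
                using two_blocks[OF part CC(1) \<open>X0 \<in> CC\<close> _ Z1(2)[symmetric]] by simp
              then show ?thesis using k by blast
            next
              case False
              have "card X0 + card Z1 \<le> card ?C + card Z1" using one_block[OF part CC(1) \<open>X0 \<in> CC\<close>] by simp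
              then show ?thesis using k Z1(1) False by blast
            qed
          next
            case ZX: False
            have "Z \<in> \<pi>" using Z(1) CC(1) by blast
            have "card Z \<le> card ?C + card {}" using one_block[OF part CC(1) Z(1)] by simp
            then have "K' * R ^ card V \<le> ?c * R ^ (card ?C + card {})"
              using single_bound[OF inv[OF \<open>Z \<in> \<pi>\<close> ZX] Z(2) _ R1 T0] by (intro fin[OF _ d1(3)]) auto
            then show ?thesis by blast
          qed
        qed
        then obtain Zs' where Zs0: "Zs' \<in> insert {} (\<pi> - CC)"
          and inv0': "K' * R ^ card V \<le> ?c * R ^ (card ?C + card Zs')" by blast
        have Zs': "Zs' \<in> insert {} (?\<pi> - {?C})" using Zs0 out(1)[of Zs'] by blast
        have X0': "?C \<in> ?\<pi>" by simp
        show ?thesis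
          by (rule Suc.IH[OF s(1,2) pos' _ loop' cU' _ b' X0' inv' Zs' inv0'])
            (use F' Suc.prems(4) K'_def in auto)
      qed
    qed
  qed
qed

text \<open>A missing bridge offers about \<open>b\<^sup>2 / R ^ card V\<close> threats, a missing
  edge inside \<open>V\<close> only \<open>b / R ^ card V\<close>; this is the difference between
  \<open>k2\<close> and \<open>k3\<close>. The latter case needs as many edges as vertices.\<close>

lemma unlooped_end:
  fixes \<gamma> K :: real
  assumes g: "0 < \<gamma>" "\<gamma> \<le> 1" and pos: "position \<pi> U DD A F" and F: "card F mod Suc b = r mod Suc b"
    and U: "card U \<le> 1" and E: "card E \<le> card V" and K: "1 / \<gamma>\<^sup>2 \<le> K"
    and k2: "K * r * R ^ card V \<le> real b * real b"
    and k3: "card E = card V \<Longrightarrow> K * r * R ^ card V \<le> b"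
    and inv: "\<And>Z. Z \<in> \<pi> \<Longrightarrow> \<gamma> * b \<le> cnt DD Z * R ^ card Z"
  shows "wins b has_copy A F"
proof (rule end_game[OF pos U F])
  note part = positionD(1)[OF pos]
  have g2: "1 \<le> \<gamma>\<^sup>2 * K" using K g(1) by (simp add: divide_le_eq mult.commute)
  have "1 / \<gamma> \<le> 1 / \<gamma>\<^sup>2"
    using g by (intro divide_left_mono) (auto simp: power2_eq_square mult_left_le)
  then have "1 / \<gamma> \<le> K" using K by linarith
  then have g1: "1 \<le> \<gamma> * K" using g(1) by (simp add: divide_le_eq mult.commute)
  show "0 < cnt DD Z" if "Z \<in> \<pi>" for Z
  proof (rule ccontr)
    assume "\<not> 0 < cnt DD Z"
    moreover have "0 < \<gamma> * b" using g(1) b0 by simp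
    ultimately show False using inv[OF that] by simp
  qed
  show "r \<le> cnt DD V" if "U \<noteq> {}" "\<pi> = {V}"
  proof -
    have "card V \<le> card (E - U) + 1" using positionD(4)[OF pos] that by simp
    moreover have "0 < card U"
      using that positionD(2)[OF pos] finite_E by (meson card_gt_0_iff finite_subset)
    ultimately have "card E = card V" using E card_EU[OF positionD(2)[OF pos]] by linarith
    then have "K * r * R ^ card V \<le> b" by (rule k3)
    then have "\<gamma> * (K * r * R ^ card V) \<le> \<gamma> * b" using g(1) by (intro mult_left_mono) auto
    also have "\<dots> \<le> cnt DD V * R ^ card V" using inv[of V] that by simp
    finally have "(\<gamma> * K * r) * R ^ card V \<le> cnt DD V * R ^ card V" by (simp add: mult_ac)
    then have "\<gamma> * K * r \<le> cnt DD V" using cancel_power[OF _ order_refl R1] by simp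
    moreover have "1 * real r \<le> \<gamma> * K * r" using g1 by (intro mult_right_mono) auto
    ultimately show ?thesis by simp
  qed
  show "r \<le> cnt DD X * cnt DD Y" if "\<pi> = {X, Y}" "X \<noteq> Y" for X Y
  proof -
    have XY: "X \<in> \<pi>" "Y \<in> \<pi>" using that by auto
    have "(\<gamma> * b) * (\<gamma> * b) \<le> (cnt DD X * R ^ card X) * (cnt DD Y * R ^ card Y)"
      by (rule mult_mono[OF inv[OF XY(1)] inv[OF XY(2)]]) (use g(1) R1 in auto)
    then have "\<gamma>\<^sup>2 * (real b * real b) \<le> (cnt DD X * cnt DD Y) * R ^ (card X + card Y)"
      by (simp add: power_add power2_eq_square mult_ac)
    moreover have "\<gamma>\<^sup>2 * (K * r * R ^ card V) \<le> \<gamma>\<^sup>2 * (real b * real b)"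
      using k2 by (intro mult_left_mono) auto
    moreover have "(\<gamma>\<^sup>2 * K * r) * R ^ card V = \<gamma>\<^sup>2 * (K * r * R ^ card V)" by (simp add: mult_ac)
    ultimately have "(\<gamma>\<^sup>2 * K * r) * R ^ card V \<le> (cnt DD X * cnt DD Y) * R ^ (card X + card Y)"
      by linarith
    then have "\<gamma>\<^sup>2 * K * r \<le> cnt DD X * cnt DD Y"
      by (rule cancel_power[OF _ two_blocks_V[OF part XY that(2)] R1]) simp
    moreover have "1 * real r \<le> \<gamma>\<^sup>2 * K * r" using g2 by (intro mult_right_mono) auto
    ultimately have "real r \<le> real (cnt DD X * cnt DD Y)" by linarith
    then show ?thesis by linarith
  qed
qed

text \<open>While no cycle is closed, every block has the usual number of pieces. A phase that fuses
  blocks preserves this; one that fuses none has closed the cycle of \<open>H\<close>, and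
  \<open>wins_looped\<close> takes over.\<close>

lemma wins_position:
  fixes \<gamma> K :: real
  assumes "0 < \<gamma>" "\<gamma> \<le> 1" and "position \<pi> U DD A F" and "card F mod Suc b = r mod Suc b"
    and "card U \<le> u" and "start_const T \<gamma> u \<le> K"
    and E: "card E \<le> card V" "card V \<le> card E + 1" "card E = card V \<Longrightarrow> even b"
    and "K * R ^ card E \<le> b" and "K * r * R ^ card V \<le> real b * real b"
    and "card E = card V \<Longrightarrow> K * r * R ^ card V \<le> b"
    and "\<And>Z. Z \<in> \<pi> \<Longrightarrow> \<gamma> * b \<le> cnt DD Z * R ^ card Z"
  shows "wins b has_copy A F"
  using assms(1-6,10-)
proof (induction u arbitrary: \<gamma> K \<pi> U DD A F)
  case 0
  then show ?case by (intro unlooped_end[of \<gamma> \<pi> U DD A F K] E(1)) simp_all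
next
  case (Suc u)
  note pos = Suc.prems(3) and inv = Suc.prems(10)
  note part = positionD(1)[OF pos]
  have T4: "4 \<le> T" using T216 by simp
  show ?case
  proof (cases "card U \<le> 1")
    case True
    have "1 / \<gamma>\<^sup>2 \<le> K" using start_const_ge[of \<gamma> T "Suc u"] Suc.prems(1,2,6) T4 by linarith
    then show ?thesis
      using unlooped_end[OF Suc.prems(1-4) True E(1) _ Suc.prems(8,9) inv] by blast
  next
    case False
    have fU: "finite U" using positionD(2)[OF pos] finite_E by (meson finite_subset)
    have EU: "card (E - U) + card U = card E" by (rule card_EU[OF positionD(2)[OF pos]])
    have V: "card V \<le> card (E - U) + card \<pi>" using positionD(4)[OF pos] .
    have ok: "card (links U Z W) \<le> 2 \<and> card (links U Z W) dvd b"
      if "Z \<in> \<pi>" "W \<in> \<pi>" "Z \<noteq> W" "links U Z W \<noteq> {}" for Z W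
    proof -
      have le: "card (links U Z W) + card V \<le> card E + 2"
        using block_count_parallel[OF con pos that(1-3)] EU V by linarith
      have "finite (links U Z W)" using fU by (simp add: links_def)
      then have l0: "0 < card (links U Z W)" using that(4) by (simp add: card_gt_0_iff)
      show ?thesis
      proof (cases "card E = card V")
        case True
        then have "card (links U Z W) = 1 \<or> card (links U Z W) = 2" using le l0 by linarith
        then show ?thesis using E(3)[OF True] by auto
      next
        case False
        then have "card (links U Z W) = 1" using le l0 E(1) by linarith
        then show ?thesis by simp
      qed
    qed
    define \<gamma>' where "\<gamma>' = \<gamma>\<^sup>2 / T"
    define K1 where "K1 = start_const T \<gamma>' u"
    define K2 where "K2 = loop_const T \<gamma>' u"
    \<comment> \<open>Both continuations must be affordable: \<open>K1\<close> pays if blocks are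
      fused, \<open>K2\<close> if the cycle is closed.\<close>
    define K' where "K' = K1 + K2"
    note s = shrunk_const[OF Suc.prems(1,2) T4, folded \<gamma>'_def]
    have K20: "0 \<le> K2"
      using loop_const_ge[OF s(1,2) T4, of u] s(1) unfolding K2_def
      by (meson less_imp_le order_trans zero_less_divide_1_iff)
    have K10: "0 \<le> K1"
      using start_const_ge[OF s(1,2) T4, of u] unfolding K1_def
      by (meson order_trans zero_le_divide_1_iff zero_le_power2)
    have K'0: "0 \<le> K'" using K10 K20 by (simp add: K'_def)
    have "T * (K' + 1) / \<gamma>\<^sup>2 \<le> K" using Suc.prems(6) by (simp add: K'_def K1_def K2_def \<gamma>'_def)
    note Kc = round_const[OF this K'0 Suc.prems(1,2) T216]
    have K0: "0 \<le> K" using Kc by linarith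
    have Rp: "0 < R ^ i" for i using R1 by simp
    have le1: "K1 \<le> K" "K2 \<le> K" using Kc(5) K10 K20 by (auto simp: K'_def)
    have gE: "\<gamma> * K * R ^ card E \<le> cnt DD Z * R ^ card Z" if "Z \<in> \<pi>" for Z
    proof -
      have "\<gamma> * (K * R ^ card E) \<le> \<gamma> * b" using Suc.prems(1,7) by (intro mult_left_mono) auto
      then show ?thesis using inv[OF that] by (simp add: mult.assoc)
    qed
    have beta: "2 \<le> card \<pi>" "card E \<noteq> card V \<Longrightarrow> 3 \<le> card \<pi>" using False EU V E by linarith+
    have ne: "\<exists>W\<in>\<pi>. W \<noteq> Z" for Z
    proof (rule ccontr)
      assume "\<not> ?thesis"
      then have "\<pi> \<subseteq> {Z}" by blast
      then have "card \<pi> \<le> card {Z}" by (intro card_mono) auto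
      then show False using beta by simp
    qed
    have cE: "card Z \<le> card E" if Z: "Z \<in> \<pi>" for Z
    proof -
      obtain W where W: "W \<in> \<pi>" "W \<noteq> Z" using ne by blast
      have "0 < card W" using blockD(1,5)[OF part W(1)] by (simp add: card_gt_0_iff)
      then show ?thesis using two_blocks_V[OF part Z W(1) W(2)[symmetric]] E(2) by linarith
    qed
    have big: "16 \<le> real (cnt DD Z)" if "Z \<in> \<pi>" for Z
    proof -
      have "\<gamma> * K \<le> cnt DD Z" by (rule cancel_power[OF gE[OF that] cE[OF that] R1]) simp
      then show ?thesis using Kc(3,6) mult.commute[of \<gamma> K] by linarith
    qed
    obtain X where X: "X \<in> \<pi>" using beta(1) by fastforce
    have "{X} \<noteq> \<pi>" using beta(1) by auto
    then have "\<exists>Y\<in>{X}. \<exists>W\<in>\<pi> - {X}. links U Y W \<noteq> {}"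
      using X by (intro linked_blocks[OF con pos]) simp_all
    then obtain Y where Y: "Y \<in> \<pi>" "Y \<noteq> X" "links U X Y \<noteq> {}" by blast
    \<comment> \<open>For a tree with two missing edges there is a third block, which keeps at least
      one vertex away from \<open>X\<close> and \<open>Y\<close>. This saves one factor
      \<open>R\<close> and is the source of the better exponent for trees.\<close>
    have XYE: "card X + card Y \<le> card E"
    proof (cases "card E = card V")
      case True
      then show ?thesis using two_blocks_V[OF part X Y(1) Y(2)[symmetric]] by simp
    next
      case F: False
      have "\<not> \<pi> \<subseteq> {X, Y}"
      proof
        assume "\<pi> \<subseteq> {X, Y}"
        then have "card \<pi> \<le> card {X, Y}" by (intro card_mono) auto
        also have "\<dots> \<le> 2" using card_insert_le_m1[of 2 "{Y}" X] by simp
        finally show False using beta(2)[OF F] by simp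
      qed
      then obtain W where W: "W \<in> \<pi>" "W \<noteq> X" "W \<noteq> Y" by blast
      have "0 < card W" using blockD(1,5)[OF part W(1)] by (simp add: card_gt_0_iff)
      then show ?thesis
        using three_blocks[OF part X Y(1) W(1) Y(2)[symmetric] W(2,3)[symmetric]] E(2) by linarith
    qed
    have "\<gamma> * (\<gamma> * K) * b \<le> cnt DD X * cnt DD Y"
      using prod_bound[OF inv[OF X] gE[OF Y(1)] XYE] Suc.prems(1) K0 by simp
    moreover have "\<gamma> * (\<gamma> * K) * b = K * \<gamma>\<^sup>2 * b" by (simp add: power2_eq_square)
    moreover have "108 * real b \<le> K * \<gamma>\<^sup>2 * b" using Kc by (intro mult_right_mono) auto
    ultimately have prod108: "108 * real b \<le> real (cnt DD X) * real (cnt DD Y)"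
      unfolding of_nat_mult[symmetric] by linarith
    show ?thesis
    proof (rule round_wins[OF pos X Y(1) Y(2)[symmetric] Y(3) ok big prod108])
      fix CC U' DD' A' F'
      let ?C = "\<Union>CC" and ?\<pi> = "insert (\<Union>CC) (\<pi> - CC)"
      assume CC: "CC \<subseteq> \<pi>" "CC \<noteq> {}" and U': "U' \<subset> U" and pos': "position ?\<pi> U' DD' A' F'"
        and count: "card (E - U) + card \<pi> \<le> card (E - U') + card ?\<pi>"
        and link: "\<And>Z. Z \<in> CC \<Longrightarrow> CC \<noteq> {Z} \<Longrightarrow> \<exists>Z'\<in>CC. Z' \<noteq> Z \<and> links U Z Z' \<noteq> {}"
        and keep: "\<And>Z. Z \<in> \<pi> - CC \<Longrightarrow> real (cnt DD Z) \<le> 4 * real (cnt DD' Z)"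
        and res: "growth \<pi> U DD CC (real (cnt DD' ?C))"
        and F': "card F' mod Suc b = card F mod Suc b"
      let ?c = "real (cnt DD' ?C)"
      have T0: "0 < T" using T216 by simp
      have cU': "card U' \<le> u" using psubset_card_mono[OF fU U'] Suc.prems(5) by linarith
      have F'': "card F' mod Suc b = r mod Suc b" using F' Suc.prems(4) by simp
      have kept: "\<gamma>' * b \<le> cnt DD' Z * R ^ card Z" if Z: "Z \<in> \<pi> - CC" for Z
        using kept_bound[OF inv keep[OF Z] _ s(4)] Z by simp
      have less: "k * r * R ^ card V \<le> K * r * R ^ card V" "k * R ^ card E \<le> K * R ^ card E" if "k \<le> K" for k
        using that Rp[of "card V"] Rp[of "card E"] by (auto intro!: mult_right_mono)
      show "wins b has_copy A' F'"
      proof (cases "\<exists>Z. CC = {Z}")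
        case False
        obtain P where P: "P \<in> CC" using CC(2) by blast
        have "CC \<noteq> {P}" using False by blast
        obtain Q where Q: "Q \<in> CC" "Q \<noteq> P" "links U P Q \<noteq> {}"
          using link[OF P \<open>CC \<noteq> {P}\<close>] by (elim bexE conjE)
        have "\<gamma> * b \<le> cnt DD Z * R ^ card Z" if "Z \<in> CC" for Z using inv[of Z] that CC(1) by blast
        then have C: "\<gamma>' * b \<le> ?c * R ^ card ?C"
          unfolding \<gamma>'_def by (rule merged_bound[OF Suc.prems(1,2) part CC(1) P Q _ res]) simp_all
        have inv': "\<gamma>' * b \<le> cnt DD' Z * R ^ card Z" if "Z \<in> ?\<pi>" for Z
          using that C kept[of Z] by (cases "Z = ?C") simp_all
        show ?thesis
        proof (rule Suc.IH[OF s(1,2) pos' F'' cU' _ _ _ _ inv'])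
          show "start_const T \<gamma>' u \<le> K1" by (simp add: K1_def)
          show "K1 * R ^ card E \<le> b" using less(2)[OF le1(1)] Suc.prems(7) by linarith
          show "K1 * r * R ^ card V \<le> real b * real b" using less(1)[OF le1(1)] Suc.prems(8) by linarith
          show "K1 * r * R ^ card V \<le> b" if "card E = card V"
            using less(1)[OF le1(1)] Suc.prems(9)[OF that] by linarith
        qed
      next
        case True
        then obtain X0 where X0: "CC = {X0}" by blast
        then have X0\<pi>: "X0 \<in> \<pi>" using CC(1) by simp
        have \<pi>eq: "?\<pi> = \<pi>" using X0 X0\<pi> by auto
        have Ceq: "?C = X0" using X0 by simp
        have U'E: "U' \<subseteq> E" using U' positionD(2)[OF pos] by blast
        have cc: "card (E - U') + card U' = card E" by (rule card_EU[OF U'E])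
        have loop: "card V + 1 \<le> card (E - U') + card ?\<pi>"
          using cc EU V psubset_card_mono[OF fU U'] \<pi>eq by simp
        have "card ?\<pi> \<le> card U' + 1" by (rule block_count[OF con pos' order_refl]) simp
        then have EV: "card E = card V" using loop cc E(1) by linarith
        have bR: "K2 * r * R ^ card V \<le> b" using less(1)[OF le1(2)] Suc.prems(9)[OF EV] by linarith
        have bK: "K * R ^ card V \<le> b" using Suc.prems(7) EV by simp
        have fin: "K2 * R ^ card V \<le> z" if z: "\<gamma> * (\<gamma> * b) / T \<le> z" for z :: real
        proof -
          have "T * K2 \<le> T * K'" using T0 K10 by (simp add: K'_def)
          then have "T * K2 * R ^ card V \<le> K * \<gamma>\<^sup>2 * R ^ card V"
            using Kc(1) Rp[of "card V"] by (intro mult_right_mono) auto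
          also have "\<dots> = \<gamma>\<^sup>2 * (K * R ^ card V)" by simp
          also have "\<dots> \<le> \<gamma>\<^sup>2 * b" using bK by (intro mult_left_mono) auto
          also have "\<dots> \<le> T * z" using z T0 by (simp add: divide_le_eq power2_eq_square mult_ac)
          finally have "T * (K2 * R ^ card V) \<le> T * z" by (simp add: mult.assoc)
          then show ?thesis using T0 by simp
        qed
        have "{X0} \<noteq> \<pi>" using beta(1) by auto
        then have "\<exists>Y\<in>{X0}. \<exists>W\<in>\<pi> - {X0}. links U Y W \<noteq> {}"
          using X0\<pi> by (intro linked_blocks[OF con pos]) simp_all
        then obtain W where W: "W \<in> \<pi>" "W \<noteq> X0" "links U X0 W \<noteq> {}" by blast
        \<comment> \<open>The pieces that closed the cycle are as numerous as if they had merged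
          with the linked block \<open>W\<close>, which stays separate. So \<open>W\<close> is the
          first companion of \<open>X0\<close>.\<close>
        have inv0: "K2 * R ^ card V \<le> cnt DD' X0 * R ^ (card X0 + card W)"
          using res
        proof (cases rule: growth_cases)
          case pair
          show ?thesis
          proof (rule fin[OF pair_bound[where b = "real b", OF inv[OF X0\<pi>] inv[OF W(1)] _ order_refl]])
            show "real (cnt DD X0) * real (cnt DD W) \<le> T * real b * real (cnt DD' X0)"
              using pair[OF X0\<pi> W(1) W(2)[symmetric] W(3)] Ceq by simp
          qed (use R1 T0 b0 Suc.prems(1) in auto)
        next
          case (single Z)
          then have x: "real (cnt DD X0) \<le> T * real (cnt DD' X0)" using X0 by simp
          have "\<gamma> * b / T \<le> cnt DD' X0 * R ^ (card X0 + card W)"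
            using single_bound[OF inv[OF X0\<pi>] x _ R1 T0, of "card X0 + card W"] by simp
          moreover have "\<gamma> * (\<gamma> * b) / T \<le> \<gamma> * b / T"
            using Suc.prems(1,2) T0 by (intro divide_right_mono) (auto intro: mult_left_le_one_le)
          ultimately show ?thesis by (intro fin) linarith
        qed
        show ?thesis
        proof (rule wins_looped[OF s(1,2) pos' F'' loop E(1) cU' _ bR])
          show "loop_const T \<gamma>' u \<le> K2" by (simp add: K2_def)
          show "X0 \<in> ?\<pi>" using \<pi>eq X0\<pi> by simp
          show "\<gamma>' * b \<le> cnt DD' Z * R ^ card Z" if "Z \<in> ?\<pi>" "Z \<noteq> X0" for Z
            using that \<pi>eq X0 by (intro kept) simp
          show "W \<in> insert {} (?\<pi> - {X0})" using W \<pi>eq by simp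
          show "K2 * R ^ card V \<le> cnt DD' X0 * R ^ (card X0 + card W)" by (rule inv0)
        qed
      qed
    qed
  qed
qed

end

section \<open>The threshold\<close>

text \<open>Labels are dealt out periodically, so each vertex of \<open>H\<close> labels at least
  \<open>n / (2 * card V)\<close> vertices of the board. Single vertices as pieces then satisfy the
  size invariant with \<open>R = b / n\<close> and
  \<open>\<gamma> = 1 / (2 * card V)\<close>.\<close>

lemma enforcer_wins_if:
  fixes V :: "'a set" and E :: "'a set set"
  assumes G: "simple_graph V E" and con: "connected_graph V E"
    and E: "card E \<le> card V" "card E = card V \<Longrightarrow> even b"
    and n: "2 * card V \<le> n" "4 * n \<le> b" and r: "0 < r"
    and mod: "(n choose 2) mod Suc b = r mod Suc b"
    and K: "start_const (216 * real (board.types V E)) (1 / (2 * card V)) (card E) \<le> K"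
      "K * (b / n) ^ card E \<le> b" "K * r * (b / n) ^ card V \<le> real b * real b"
      "card E = card V \<Longrightarrow> K * r * (b / n) ^ card V \<le> b"
  shows "enforcer_wins V E n b"
proof -
  have fV: "finite V" using G by (simp add: simple_graph_def)
  have v0: "0 < card V" using con fV by (auto simp: connected_graph_def card_gt_0_iff)
  then have n0: "0 < n" "0 < b" using n by auto
  obtain h where h: "bij_betw h {0..<card V} V" using ex_bij_betw_nat_finite[OF fV] by blast
  define lab where "lab w = h (w mod card V)" for w :: nat
  have R1: "1 \<le> real b / real n" using n n0 by (simp add: le_divide_eq)
  interpret biased V E n lab b r "real b / real n"
    using G con n n0 r R1 by unfold_locales auto
  define \<pi> where "\<pi> = (\<lambda>x. {x}) ` V"
  define DD where "DD = (\<lambda>w. {w}) ` {..<n}"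
  have inner_empty: "inner U {w} = {}" if "U \<subseteq> E" for U w
  proof -
    have "lab ` e \<notin> U" if "e \<subseteq> {w}" for e
    proof -
      have "card (lab ` e) \<le> card {lab w}" using that by (intro card_mono) auto
      then show ?thesis using edgeD[of "lab ` e"] \<open>U \<subseteq> E\<close> by auto
    qed
    then show ?thesis by (auto simp: inner_def)
  qed
  have labV: "lab w \<in> V" for w
    using h v0 by (auto simp: lab_def bij_betw_def)
  have pos: "position \<pi> E DD {} (complete_edges n)"
    unfolding position_def
  proof (intro conjI ballI impI)
    show "partition_on V \<pi>" by (auto simp: partition_on_def \<pi>_def disjoint_def)
    have "card \<pi> = card V" unfolding \<pi>_def by (rule card_image) simp
    then show "card V \<le> card (E - E) + card \<pi>" by simp
    show "disjoint DD" by (auto simp: DD_def disjoint_def)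
    show "cross E D D' \<subseteq> complete_edges n" if D: "D \<in> DD" "D' \<in> DD" "lab ` D \<noteq> lab ` D'" for D D'
    proof -
      obtain u w where uw: "D = {u}" "D' = {w}" "u < n" "w < n" using D(1,2) by (auto simp: DD_def)
      moreover have "u \<noteq> w" using D(3) uw by auto
      ultimately show ?thesis by (auto simp: cross_def complete_edges_def)
    qed
    show "inner (E - E) D \<subseteq> {}" "inner E D \<subseteq> complete_edges n" if "D \<in> DD" for D
      using that inner_empty by (auto simp: DD_def)
  qed (use labV finite_complete_edges in \<open>auto simp: DD_def \<pi>_def\<close>)
  have cnt: "n div card V \<le> cnt DD {x}" if "x \<in> V" for x
  proof -
    have "x \<in> h ` {0..<card V}" using h \<open>x \<in> V\<close> by (simp add: bij_betw_def)
    then obtain i where i: "i < card V" "h i = x" by auto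
    have "(\<lambda>j. {card V * j + i}) ` {..<n div card V} \<subseteq> {D \<in> DD. lab ` D = {x}}"
    proof
      fix D assume "D \<in> (\<lambda>j. {card V * j + i}) ` {..<n div card V}"
      then obtain j where j: "j < n div card V" "D = {card V * j + i}" by blast
      have "card V * j + i < card V * (j + 1)" using i by simp
      also have "\<dots> \<le> card V * (n div card V)" using j by (intro mult_le_mono2) simp
      also have "\<dots> \<le> n" by simp
      finally show "D \<in> {D \<in> DD. lab ` D = {x}}" using j i by (simp add: DD_def lab_def)
    qed
    moreover have "inj_on (\<lambda>j. {card V * j + i}) {..<n div card V}"
      using v0 by (auto simp: inj_on_def)
    ultimately show ?thesis
      unfolding cnt_def using card_inj_on_le[of "\<lambda>j. {card V * j + i}" "{..<n div card V}"]
      by (simp add: DD_def)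
  qed
  have inv: "1 / (2 * card V) * b \<le> cnt DD Z * (b / n) ^ card Z" if Z: "Z \<in> \<pi>" for Z
  proof -
    obtain x where x: "x \<in> V" "Z = {x}" using Z by (auto simp: \<pi>_def)
    have "n < card V * (n div card V) + card V"
      using dividend_less_times_div[OF v0, of n] by (simp add: add.commute)
    then have "n \<le> 2 * card V * (n div card V)" using n(1) unfolding mult.assoc by linarith
    also have "\<dots> \<le> 2 * card V * cnt DD {x}" using cnt[OF x(1)] by (intro mult_le_mono2)
    finally have "real n \<le> real (2 * card V * cnt DD {x})" by (rule of_nat_mono)
    then have "real n / (2 * card V) \<le> cnt DD {x}" using v0 by (simp add: divide_le_eq mult_ac)
    then have "real n / (2 * card V) * (b / n) \<le> cnt DD {x} * (b / n)" by (rule mult_right_mono) simp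
    then show ?thesis using x n0 by simp
  qed
  have "card V \<le> card E + 1"
    by (rule connected_edge_count[OF fV finite_E con]) (use edgeD in blast)
  moreover have "0 < 1 / (2 * real (card V))" "1 / (2 * real (card V)) \<le> 1" using v0 by auto
  moreover have "card (complete_edges n) mod Suc b = r mod Suc b"
    using mod by (simp add: complete_edges_def n_subsets)
  moreover have "start_const T (1 / (2 * card V)) (card E) \<le> K" using K(1) by (simp add: T_def)
  ultimately have "wins b has_copy {} (complete_edges n)"
    using wins_position[of "1 / (2 * card V)" \<pi> E DD "{}" "complete_edges n" "card E" K] pos E K(2-4) inv by simp
  then show ?thesis by (rule enforcer_winsI)
qed

lemma threshold_ge:
  fixes V :: "'a set" and E :: "'a set set"
  assumes "simple_graph V E" and "connected_graph V E" and "3 \<le> card E" and "card E \<le> card V"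
  shows "\<exists>K\<ge>1. \<forall>n b r. 2 * card V \<le> n \<longrightarrow> 4 * n \<le> b \<longrightarrow> 0 < r \<longrightarrow>
    (n choose 2) mod Suc b = r mod Suc b \<longrightarrow> even b \<longrightarrow>
    K * (real b / real n) ^ card E \<le> b \<longrightarrow> K * real r * (real b / real n) ^ card V \<le> real b * real b \<longrightarrow>
    (card E = card V \<longrightarrow> K * real r * (real b / real n) ^ card V \<le> b) \<longrightarrow> b \<le> upper_threshold V E n"
proof -
  define K0 where "K0 = start_const (216 * real (board.types V E)) (1 / (2 * card V)) (card E)"
  define K where "K = max 1 K0"
  have v: "0 < card V" using assms(3,4) by linarith
  show ?thesis
  proof (intro exI[of _ K] conjI allI impI)
    show "1 \<le> K" by (simp add: K_def)
    fix n b r :: nat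
    assume n: "2 * card V \<le> n" "4 * n \<le> b" and *: "0 < r" "(n choose 2) mod Suc b = r mod Suc b" "even b"
      "K * (real b / real n) ^ card E \<le> b" "K * real r * (real b / real n) ^ card V \<le> real b * real b"
      "card E = card V \<longrightarrow> K * real r * (real b / real n) ^ card V \<le> b"
    have "enforcer_wins V E n b"
      by (rule enforcer_wins_if[where K = K and r = r]) (use assms n * in \<open>auto simp: K_def K0_def\<close>)
    moreover have "0 < b" using n v by linarith
    ultimately show "b \<le> upper_threshold V E n"
      using upper_threshold_greatest(3)[OF assms(1)] assms(3) by simp
  qed
qed

text \<open>Replacing \<open>n\<close> and \<open>n - 1\<close> by \<open>n + x\<close> and \<open>n - 1 - x\<close> keeps the sum, so the product only
  drops by \<open>x (x + 1)\<close>.\<close>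

lemma small_remainder:
  assumes a: "odd a" and n: "4 * a + 4 \<le> n"
  shows "\<exists>b r. even b \<and> 0 < r \<and> r \<le> 3 * a\<^sup>2 \<and> (n choose 2) mod Suc b = r mod Suc b \<and>
    a * n \<le> 4 * b \<and> b \<le> a * n"
proof -
  have a0: "0 < a" using a by (simp add: odd_pos)
  \<comment> \<open>Choosing \<open>x\<close> between 1 and \<open>2 * a\<close>, not 0, makes the
    remainder positive. Rounding to a multiple of \<open>2 * a\<close> also makes
    \<open>n + x\<close> even, hence \<open>y\<close> and \<open>q\<close> odd and the bias
    \<open>q - 1\<close> even.\<close>
  define x where "x = 2 * a - n mod (2 * a)"
  have "n mod (2 * a) < 2 * a" using a0 by simp
  then have x: "0 < x" "x \<le> 2 * a" "x + n mod (2 * a) = 2 * a" by (auto simp: x_def)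
  define k where "k = n div (2 * a) + 1"
  have k: "n + x = 2 * a * k"
  proof -
    have "n + x = 2 * a * (n div (2 * a)) + (x + n mod (2 * a))" by simp
    then show ?thesis using x(3) by (simp add: k_def)
  qed
  define y where "y = n - x - 1"
  have y: "n = y + x + 1" using x n by (simp add: y_def)
  define q where "q = a * y"
  define r where "r = x * (x + 1) div 2"
  have r2: "2 * r = x * (x + 1)" by (simp add: r_def)
  have "2 * (k * q + r) = (n + x) * y + x * (x + 1)" using k r2 by (simp add: q_def algebra_simps)
  also have "\<dots> = n * (n - 1)" unfolding y by (simp add: algebra_simps)
  finally have "n choose 2 = k * q + r" by (simp add: choose_two)
  moreover have "0 < y" using n x y by linarith
  then have q0: "0 < q" using a0 by (simp add: q_def)
  ultimately have mod: "(n choose 2) mod Suc (q - 1) = r mod Suc (q - 1)" by simp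
  have "even (n + x)" using k by simp
  then have "odd y" using y by presburger
  then have "odd q" using a by (simp add: q_def)
  then have "even (q - 1)" using q0 by simp
  moreover have "0 < r" using x(1) r2 by (cases r) auto
  moreover have "r \<le> 3 * a\<^sup>2"
  proof -
    have "2 * r \<le> 2 * a * (2 * a + 1)" unfolding r2 using x by (intro mult_le_mono) auto
    also have "\<dots> \<le> 2 * a * (3 * a)" using a0 by (intro mult_le_mono2) simp
    finally show ?thesis by (simp add: power2_eq_square)
  qed
  moreover have "a * n \<le> 4 * (q - 1)"
  proof -
    have "n + 4 \<le> 4 * y" using n x y by linarith
    then have "a * (n + 4) \<le> a * (4 * y)" by (rule mult_le_mono2)
    then have "a * n + 4 * a \<le> 4 * q" by (simp add: q_def algebra_simps)
    then show ?thesis using a0 by linarith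
  qed
  moreover have "q - 1 \<le> a * n"
  proof -
    have "q \<le> a * n" unfolding q_def using y by (intro mult_le_mono2) simp
    then show ?thesis by simp
  qed
  ultimately show ?thesis using mod by blast
qed

section \<open>From single biases to asymptotic bounds\<close>

lemma bigomega_from_steps:
  fixes f :: "nat \<Rightarrow> nat" and C :: real and m :: nat
  assumes C: "0 < C" and m: "0 < m"
    and step: "\<And>n a. odd a \<Longrightarrow> A0 \<le> a \<Longrightarrow> C * real a ^ m \<le> n \<Longrightarrow> a * n \<le> 4 * f n"
  shows "(\<lambda>n. real (f n)) \<in> \<Omega>(\<lambda>n. real n powr (1 + 1 / m))"
proof -
  define s where "s n = (real n / C) powr (1 / m)" for n :: nat
  \<comment> \<open>The largest odd \<open>a\<close> below \<open>s n\<close> exceeds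
    \<open>s n - 2\<close>. Once \<open>s n\<close> is at least \<open>d\<close>, this is at least
    \<open>s n / 2\<close>, and in turn at least \<open>A0\<close>.\<close>
  define d where "d = 2 * real A0 + 4"
  have d0: "0 < d" by (simp add: d_def)
  have ev: "\<forall>\<^sub>F n in sequentially. d \<le> s n"
    using eventually_ge_at_top[of "nat \<lceil>C * d ^ m\<rceil>"]
  proof eventually_elim
    case (elim n)
    then have "C * d ^ m \<le> n" by linarith
    then have "d ^ m \<le> n / C" using C by (simp add: field_simps)
    then have "(d ^ m) powr (1 / m) \<le> s n" using d0 unfolding s_def by (intro powr_mono2) auto
    moreover have "(d ^ m) powr (1 / m) = d"
      using d0 m by (simp add: powr_powr flip: powr_realpow)
    ultimately show ?case by simp
  qed
  define c where "c = (1 / C) powr (1 / m) / 8"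
  have "\<forall>\<^sub>F n in sequentially. c * norm (real n powr (1 + 1 / m)) \<le> norm (real (f n))"
    using ev
  proof eventually_elim
    case (elim n)
    define a0 where "a0 = nat \<lfloor>s n\<rfloor>"
    define a where "a = (if odd a0 then a0 else a0 - 1)"
    have s0: "0 < s n" using elim d0 by linarith
    note elim = elim[unfolded d_def]
    have a0: "real a0 \<le> s n" "s n < real a0 + 1" "0 < a0" using elim unfolding a0_def by linarith+
    have a: "odd a" "a \<le> a0" "a0 \<le> a + 1" using a0(3) by (auto simp: a_def)
    have half: "s n / 2 \<le> a" "real a \<le> s n" using a a0 elim by linarith+
    have "A0 \<le> a" using half elim by linarith
    have n0: "0 < n" using s0 by (cases "n = 0") (auto simp: s_def)
    have "real a ^ m \<le> s n ^ m" using half by (intro power_mono) auto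
    also have "s n ^ m = s n powr m" using s0 by (simp add: powr_realpow)
    also have "\<dots> = real n / C" using n0 C m by (simp add: s_def powr_powr)
    finally have "C * real a ^ m \<le> n" using C by (simp add: field_simps)
    then have "a * n \<le> 4 * f n" using step a(1) \<open>A0 \<le> a\<close> by blast
    then have "real (a * n) \<le> real (4 * f n)" by (rule of_nat_mono)
    then have "real a * real n \<le> 4 * real (f n)" by simp
    moreover have "s n / 2 * real n \<le> real a * real n" using half by (intro mult_right_mono) auto
    ultimately have "s n * real n / 8 \<le> real (f n)" by simp
    moreover have "s n * real n = (1 / C) powr (1 / m) * real n powr (1 + 1 / m)"
    proof -
      have "s n = (1 / C * real n) powr (1 / m)" by (simp add: s_def)
      also have "\<dots> = (1 / C) powr (1 / m) * real n powr (1 / m)" using C by (subst powr_mult) auto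
      finally show ?thesis using n0 by (simp add: powr_add)
    qed
    ultimately show ?case by (simp add: c_def)
  qed
  moreover have "0 < c" using C by (simp add: c_def)
  ultimately show ?thesis by (intro landau_omega.bigI)
qed

text \<open>For \<open>b\<close> of order \<open>a * n\<close> the remainder is at most
  \<open>3 * a\<^sup>2\<close>. If a loop may remain, \<open>a ^ (card V + 2)\<close> must be of
  order at most \<open>b\<close>, which gives \<open>m = card V + 1\<close>. For a tree
  \<open>a ^ card E\<close> suffices, which gives \<open>m = card E - 1\<close>.\<close>

lemma threshold_bigomega:
  fixes V :: "'a set" and E :: "'a set set"
  assumes G: "simple_graph V E" "connected_graph V E" "3 \<le> card E" "card E \<le> card V"
    and m: "m = card V + 1 \<or> card E < card V \<and> m = card E - 1"
  shows "(\<lambda>n. real (upper_threshold V E n)) \<in> \<Omega>(\<lambda>n. real n powr (1 + 1 / real m))"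
proof -
  obtain K where K1: "1 \<le> K" and K: "\<And>n b r. 2 * card V \<le> n \<Longrightarrow> 4 * n \<le> b \<Longrightarrow> 0 < r \<Longrightarrow>
    (n choose 2) mod Suc b = r mod Suc b \<Longrightarrow> even b \<Longrightarrow>
    K * (real b / real n) ^ card E \<le> b \<Longrightarrow> K * real r * (real b / real n) ^ card V \<le> real b * real b \<Longrightarrow>
    (card E = card V \<Longrightarrow> K * real r * (real b / real n) ^ card V \<le> b) \<Longrightarrow> b \<le> upper_threshold V E n"
    using threshold_ge[OF G] by blast
  have fin: "finite V" "finite E"
    using G(1) finite_subset[of E "Pow V"] by (auto simp: simple_graph_def)
  have VE: "card V \<le> card E + 1"
    by (rule connected_edge_count[OF fin G(2)]) (use G(1) in \<open>auto simp: simple_graph_def\<close>)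
  have m0: "0 < m" using m G(3) by auto
  show ?thesis
  \<comment> \<open>From \<open>16 \<le> a\<close> and \<open>a * n \<le> 4 * b\<close> follows
    \<open>4 * n \<le> b\<close>. The constant 12 is this 4 times the 3 in the bound on the
    remainder.\<close>
  proof (rule bigomega_from_steps[where C = "12 * K" and ?A0.0 = "16 + 2 * card V", OF _ m0])
    show "0 < 12 * K" using K1 by simp
    fix n a :: nat
    assume a: "odd a" "16 + 2 * card V \<le> a" and n: "12 * K * real a ^ m \<le> n"
    have a1: "1 \<le> real a" using a(2) by simp
    have "12 * real a \<le> 12 * K * real a ^ m"
    proof -
      have "real a ^ 1 \<le> real a ^ m" using a1 m0 by (intro power_increasing) auto
      then have "1 * real a \<le> K * real a ^ m" using K1 by (intro mult_mono) auto
      then show ?thesis by simp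
    qed
    then have n12: "12 * a \<le> n" using n by linarith
    then obtain b r where b: "even b" "0 < r" "r \<le> 3 * a\<^sup>2" "(n choose 2) mod Suc b = r mod Suc b"
      "a * n \<le> 4 * b" "b \<le> a * n"
      using small_remainder[OF a(1), of n] a(2) by auto
    define \<rho> where "\<rho> = real b / real n"
    have n0: "0 < n" using n12 a by linarith
    have "16 * n \<le> a * n" using a(2) by (intro mult_right_mono) auto
    then have b4: "4 * n \<le> b" using b(5) by linarith
    have \<rho>1: "1 \<le> \<rho>" using b4 n0 by (simp add: \<rho>_def le_divide_eq)
    have "real b \<le> real (a * n)" using b(6) by (rule of_nat_mono)
    then have \<rho>a: "\<rho> \<le> a" using n0 by (simp add: \<rho>_def divide_le_eq)
    have "real r \<le> real (3 * a\<^sup>2)" using b(3) by (rule of_nat_mono)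
    then have r: "real r \<le> 3 * real a ^ 2" by simp
    have b1: "1 \<le> real b" using b4 n0 by linarith
    have "real (a * n) \<le> real (4 * b)" using b(5) by (rule of_nat_mono)
    then have ban: "real a * real n \<le> 4 * real b" by simp
    have "real a * (12 * K * real a ^ m) \<le> real a * real n" using n by (intro mult_left_mono) auto
    moreover have "real a * (12 * K * real a ^ m) = 4 * (3 * K * real a ^ Suc m)" by simp
    ultimately have bm: "3 * K * real a ^ Suc m \<le> b" using ban by linarith
    have pow: "\<rho> ^ i \<le> real a ^ i" for i using \<rho>1 \<rho>a by (intro power_mono) auto
    have rv: "K * real r * \<rho> ^ card V \<le> 3 * K * real a ^ (card V + 2)"
    proof -
      have "K * real r * \<rho> ^ card V \<le> K * (3 * real a ^ 2) * real a ^ card V"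
        using K1 r pow[of "card V"] \<rho>1 by (intro mult_mono) auto
      then show ?thesis by (simp add: power_add power2_eq_square mult_ac)
    qed
    have "b \<le> upper_threshold V E n"
    proof (rule K[OF _ b4 b(2,4,1)])
      show "2 * card V \<le> n" using a(2) n12 by linarith
      have "K * \<rho> ^ card E \<le> b \<and> K * real r * \<rho> ^ card V \<le> real b * real b \<and>
        (card E = card V \<longrightarrow> K * real r * \<rho> ^ card V \<le> b)"
      proof (cases "m = card V + 1")
        case True
        then have 1: "K * real r * \<rho> ^ card V \<le> b" using rv bm by simp
        have "K * \<rho> ^ card E \<le> K * \<rho> ^ card V"
          using K1 \<rho>1 G(4) by (intro mult_left_mono power_increasing) auto
        also have "\<dots> \<le> K * \<rho> ^ card V * real r"
          using mult_left_mono[of 1 "real r" "K * \<rho> ^ card V"] K1 \<rho>1 b(2) by simp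
        also have "\<dots> \<le> b" using 1 by (simp add: mult_ac)
        finally have 2: "K * \<rho> ^ card E \<le> b" by simp
        have "real b * 1 \<le> real b * real b" using b1 by (intro mult_left_mono) auto
        then show ?thesis using 1 2 by simp
      next
        case False
        then have m': "card E < card V" "Suc m = card E" using m G(3) by auto
        have "K * \<rho> ^ card E \<le> K * real a ^ card E" using K1 pow by (intro mult_left_mono) auto
        also have "\<dots> \<le> 3 * K * real a ^ Suc m" unfolding m'(2) using K1 by simp
        finally have 2: "K * \<rho> ^ card E \<le> b" using bm by linarith
        \<comment> \<open>With \<open>card V \<le> card E + 1\<close> this amounts to at least three
          edges.\<close>
        have "real a ^ (card V + 2) \<le> real a ^ (Suc m + Suc m)"
          using a1 VE m'(2) G(3) by (intro power_increasing) auto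
        moreover have "3 * K * 1 \<le> 3 * K * (3 * K)" using K1 by (intro mult_left_mono) auto
        ultimately have "3 * K * real a ^ (card V + 2) \<le> 3 * K * (3 * K) * real a ^ (Suc m + Suc m)"
          using K1 by (intro mult_mono) auto
        also have "\<dots> = (3 * K * real a ^ Suc m) * (3 * K * real a ^ Suc m)"
          by (simp only: power_add mult_ac)
        also have "\<dots> \<le> real b * real b" using bm K1 by (intro mult_mono) auto
        finally show ?thesis using rv 2 m'(1) by simp
      qed
      then show "K * (real b / real n) ^ card E \<le> b"
        "K * real r * (real b / real n) ^ card V \<le> real b * real b"
        "card E = card V \<Longrightarrow> K * real r * (real b / real n) ^ card V \<le> b"
        by (simp_all add: \<rho>_def)
    qed
    then show "a * n \<le> 4 * upper_threshold V E n" using b(5) by linarith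
  qed
qed

text \<open>For \<open>n = 2 + 2 t\<close> we have \<open>n choose 2 = (n + 1) t + 1\<close>, so every divisor \<open>d\<close> of \<open>t\<close> yields a
  bias \<open>(n + 1) d - 1\<close> that leaves a single edge for the last round.\<close>

lemma threshold_infinitely_often:
  fixes V :: "'a set" and E :: "'a set set"
  assumes G: "simple_graph V E" "connected_graph V E" "3 \<le> card E" "card E \<le> card V"
  shows "\<exists>c>0. infinite {n. c * real n powr (real (card V) / (real (card V) - 1)) \<le> real (upper_threshold V E n)}"
proof -
  obtain K where K1: "1 \<le> K" and K: "\<And>n b r. 2 * card V \<le> n \<Longrightarrow> 4 * n \<le> b \<Longrightarrow> 0 < r \<Longrightarrow>
    (n choose 2) mod Suc b = r mod Suc b \<Longrightarrow> even b \<Longrightarrow>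
    K * (real b / real n) ^ card E \<le> b \<Longrightarrow> K * real r * (real b / real n) ^ card V \<le> real b * real b \<Longrightarrow>
    (card E = card V \<Longrightarrow> K * real r * (real b / real n) ^ card V \<le> b) \<Longrightarrow> b \<le> upper_threshold V E n"
    using threshold_ge[OF G] by blast
  define m where "m = card V - 1"
  have m: "card V = Suc m" "0 < m" using G(3,4) by (auto simp: m_def)
  \<comment> \<open>The ratio \<open>b / n\<close> will be at most \<open>2 * d\<close>;
    \<open>L\<close> absorbs the resulting \<open>2 ^ card V\<close> and \<open>K\<close>.\<close>
  define L where "L = nat \<lceil>K * 2 ^ card V\<rceil>"
  have L: "K * 2 ^ card V \<le> L" unfolding L_def by (rule real_nat_ceiling_ge)
  have "1 * 1 \<le> K * 2 ^ card V" using K1 by (intro mult_mono) auto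
  then have L1: "1 \<le> real L" using L by linarith
  \<comment> \<open>As \<open>t\<close> is a power with exponent \<open>m\<close> of a fixed
    multiple of \<open>d\<close>, the divisor \<open>d\<close> has order
    \<open>n powr (1 / m)\<close>. Oddness of \<open>d\<close> makes
    \<open>b + 1 = (n + 1) * d\<close> odd, so the bias is even.\<close>
  have bound: "real n powr (1 + 1 / m) / (4 * L) \<le> upper_threshold V E n \<and> d \<le> n"
    if d: "odd d" "4 + card V \<le> d" and n: "n = 2 + 2 * (L * d) ^ m" for n d
  proof -
    define t where "t = (L * d) ^ m"
    define b where "b = (n + 1) * d - 1"
    have L0: "1 \<le> L" using L1 by simp
    have d0: "0 < d" using d by simp
    have Sb: "Suc b = (n + 1) * d" using d0 by (simp add: b_def)
    have nd: "n * d \<le> b" "b \<le> 2 * (n * d)" using d0 n by (auto simp: b_def algebra_simps)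
    have td: "d \<le> t"
    proof -
      have "d \<le> L * d" using L0 by simp
      also have "\<dots> \<le> (L * d) ^ m" using L0 d0 m(2) by (intro self_le_power) auto
      finally show ?thesis by (simp add: t_def)
    qed
    have nt: "n = 2 + 2 * t" using n by (simp add: t_def)
    have "n choose 2 = (n + 1) * t + 1" unfolding nt by (simp add: choose_two algebra_simps)
    moreover have "d dvd t" using m(2) by (simp add: t_def dvd_power_same dvd_power power_mult_distrib dvd_mult)
    then obtain k where "t = d * k" by blast
    ultimately have "n choose 2 = Suc b * k + 1" by (simp add: Sb algebra_simps)
    then have mod: "(n choose 2) mod Suc b = 1 mod Suc b" by (simp only: mod_mult_self4)
    have "even n" using nt by simp
    then have "odd (Suc b)" unfolding Sb using d(1) by simp
    then have ev: "even b" by simp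
    define \<rho> where "\<rho> = real b / real n"
    have n0: "0 < n" using nt by simp
    have "n * 4 \<le> n * d" using d(2) by (intro mult_le_mono2) simp
    then have b4: "4 * n \<le> b" using nd(1) by linarith
    have \<rho>1: "1 \<le> \<rho>" using b4 n0 by (simp add: \<rho>_def le_divide_eq)
    have "real b \<le> real (2 * (n * d))" using nd(2) by (rule of_nat_mono)
    then have \<rho>d: "\<rho> \<le> 2 * d" using n0 by (simp add: \<rho>_def divide_le_eq mult_ac)
    have "real (n * d) \<le> b" using nd(1) by (rule of_nat_mono)
    have key: "K * real 1 * \<rho> ^ card V \<le> b"
    proof -
      have "\<rho> ^ card V \<le> (2 * real d) ^ card V" using \<rho>1 \<rho>d by (intro power_mono) auto
      then have "K * \<rho> ^ card V \<le> K * (2 * real d) ^ card V" using K1 by (intro mult_left_mono) auto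
      also have "\<dots> = K * 2 ^ card V * real d ^ card V" by (simp add: power_mult_distrib)
      also have "\<dots> \<le> real L * real d ^ card V" using L by (intro mult_right_mono) auto
      also have "\<dots> \<le> real L ^ m * real d ^ card V"
      proof (rule mult_right_mono)
        have "real L ^ 1 \<le> real L ^ m" using L1 m(2) by (intro power_increasing) auto
        then show "real L \<le> real L ^ m" by simp
      qed simp
      also have "\<dots> = real t * real d" by (simp add: t_def m(1) power_mult_distrib)
      also have "\<dots> \<le> real n * real d" using nt by (intro mult_right_mono) auto
      finally show ?thesis using \<open>real (n * d) \<le> b\<close> by simp
    qed
    have b1: "1 \<le> real b" using b4 n0 by linarith
    have "b \<le> upper_threshold V E n"
    proof (rule K[OF _ b4 _ mod ev])
      show "2 * card V \<le> n" using td nt d(2) by linarith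
      have "K * \<rho> ^ card E \<le> K * \<rho> ^ card V"
        using K1 \<rho>1 G(4) by (intro mult_left_mono power_increasing) auto
      then show "K * (real b / real n) ^ card E \<le> b" using key by (simp add: \<rho>_def)
      have "real b * 1 \<le> real b * real b" using b1 by (intro mult_left_mono) auto
      then show "K * real 1 * (real b / real n) ^ card V \<le> real b * real b"
        using key by (simp add: \<rho>_def)
      show "K * real 1 * (real b / real n) ^ card V \<le> b" using key by (simp add: \<rho>_def)
    qed simp
    moreover have "real n powr (1 + 1 / m) / (4 * L) \<le> b"
    proof -
      have "1 \<le> t" using td d0 by linarith
      then have "n \<le> 4 * t" using nt by simp
      also have "4 * t \<le> 4 ^ m * t" using m(2) by (intro mult_right_mono) (auto simp: self_le_power)
      finally have "real n \<le> real (4 ^ m * t)" by (rule of_nat_mono)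
      also have "\<dots> = (4 * real L * real d) ^ m" by (simp add: t_def power_mult_distrib mult_ac)
      finally have "real n powr (1 / m) \<le> ((4 * real L * real d) ^ m) powr (1 / m)"
        by (intro powr_mono2) auto
      also have "\<dots> = 4 * real L * real d"
        using m(2) L1 d0 by (simp add: powr_powr flip: powr_realpow)
      finally have "real n * real n powr (1 / m) \<le> real n * (4 * real L * real d)"
        by (intro mult_left_mono) auto
      moreover have "real n powr (1 + 1 / m) = real n * real n powr (1 / m)" using n0 by (simp add: powr_add)
      ultimately have "real n powr (1 + 1 / m) / (4 * L) \<le> real n * real d"
        using L1 by (simp add: divide_le_eq mult_ac)
      then show ?thesis using \<open>real (n * d) \<le> b\<close> by simp
    qed
    moreover have "d \<le> n" using td nt by linarith
    ultimately show ?thesis by (simp add: order_trans)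
  qed
  have ex: "real (card V) / (real (card V) - 1) = 1 + 1 / m" using m by (simp add: field_simps)
  show ?thesis
    unfolding ex
  proof (intro exI[of _ "1 / (4 * real L)"] conjI)
    show "0 < 1 / (4 * real L)" using L1 by simp
    show "infinite {n. 1 / (4 * real L) * real n powr (1 + 1 / m) \<le> real (upper_threshold V E n)}"
    proof
      assume "finite {n. 1 / (4 * real L) * real n powr (1 + 1 / m) \<le> real (upper_threshold V E n)}"
      then obtain k where k: "\<And>n. 1 / (4 * real L) * real n powr (1 + 1 / m) \<le> real (upper_threshold V E n) \<Longrightarrow> n \<le> k"
        unfolding finite_nat_set_iff_bounded_le by blast
      define d where "d = 2 * (k + card V + 4) + 1"
      have d: "odd d" "4 + card V \<le> d" "k < d" by (auto simp: d_def)
      show False using bound[OF d(1,2) refl] k[of "2 + 2 * (L * d) ^ m"] d(3) by simp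
    qed
  qed
qed

theorem theorem1p4:
  fixes V :: "'a set" and E :: "'a set set"
  assumes "simple_graph V E" and "connected_graph V E" and "3 \<le> card E"
  shows
    "(tree_graph V E \<longrightarrow>
        (\<lambda>n. real (upper_threshold V E n)) \<in>
          \<Omega>(\<lambda>n. real n powr ((real (card V) - 1) / (real (card V) - 2)))) \<and>
     (unicyclic_graph V E \<longrightarrow>
        (\<lambda>n. real (upper_threshold V E n)) \<in>
          \<Omega>(\<lambda>n. real n powr ((real (card V) + 2) / (real (card V) + 1)))) \<and>
     (unicyclic_graph V E \<longrightarrow>
        (\<exists>c>0. infinite {n. c * real n powr (real (card V) / (real (card V) - 1))
                            \<le> real (upper_threshold V E n)}))"
proof (intro conjI impI)
  assume tree: "tree_graph V E"
  have fin: "finite V" "finite E"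
    using assms(1) finite_subset[of E "Pow V"] by (auto simp: simple_graph_def)
  have less: "card E < card V"
    using tree assms(1) fin
    by (intro acyclic_edge_count) (auto simp: tree_graph_def connected_graph_def simple_graph_def)
  have "card V \<le> card E + 1"
    by (rule connected_edge_count[OF fin assms(2)]) (use assms(1) in \<open>auto simp: simple_graph_def\<close>)
  then have V: "card V = card E + 1" using less by simp
  have "(real (card V) - 1) / (real (card V) - 2) = 1 + 1 / real (card E - 1)"
    using V assms(3) by (simp add: field_simps of_nat_diff)
  then show "(\<lambda>n. real (upper_threshold V E n)) \<in>
      \<Omega>(\<lambda>n. real n powr ((real (card V) - 1) / (real (card V) - 2)))"
    using threshold_bigomega[OF assms, of "card E - 1"] less by simp
next
  assume "unicyclic_graph V E"
  then have le: "card E \<le> card V" by (rule unicyclic_edge_count[OF assms(1)])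
  have "(real (card V) + 2) / (real (card V) + 1) = 1 + 1 / real (card V + 1)"
    by (simp add: field_simps)
  then show "(\<lambda>n. real (upper_threshold V E n)) \<in>
      \<Omega>(\<lambda>n. real n powr ((real (card V) + 2) / (real (card V) + 1)))"
    using threshold_bigomega[OF assms le, of "card V + 1"] by simp
next
  assume "unicyclic_graph V E"
  then have "card E \<le> card V" by (rule unicyclic_edge_count[OF assms(1)])
  then show "\<exists>c>0. infinite {n. c * real n powr (real (card V) / (real (card V) - 1))
      \<le> real (upper_threshold V E n)}"
    by (rule threshold_infinitely_often[OF assms])
qed

end
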